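(* Let $D=D_1\times\cdots\times D_k$ with each $D_j\subset\mathbb{C}^{n_j}$ a bounded domain, and let $p\in[1,\infty]$. Assume that for each $j=1,\dots,k$ there is a bounded linear operator $T_j:L^p_{(0,1)}(D_j)\to L^p(D_j)$ that solves the $\bar\partial_j$-equation on $D_j$ and commutes with all barred derivatives $\partial/\partial\bar z^i_m$, $i\ne j$, $1\le m\le n_i$, in the variables on $D_1,\dots,D_{j-1},D_{j+1},\dots,D_k$. Then there is a linear operator $T$ on $$\mathscr{B}^p:=\{f \ \bar\partial\text{-closed }(0,1)\text{-form on }D \;|\; f_I\in L^p(D)\text{ for all nonempty } I\subset\{1,\dots,k\}\}$$ satisfying $\bar\partial T(f)=f$. Furthermore, the estimate $$\|T(f)\|_{L^p(D)}\le C\sum_{I\neq\emptyset}\|f_I\|_{L^p(D)}$$ holds with a constant $C>0$ independent of $f$.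
   Context: Coordinates on $D$ are $(\bm{z}^1,\dots,\bm{z}^k)$ with $\bm{z}^j=(z^j_1,\dots,z^j_{n_j})$ the coordinates on $D_j$. $\bar\partial=\bar\partial_1+\cdots+\bar\partial_k$, where $\bar\partial_j u=\sum_{m=1}^{n_j}\frac{\partial u}{\partial\bar z^j_m}d\bar z^j_m$. All derivatives, equations $\bar\partial u=f$, and closedness are understood in the weak (distributional) sense. $L^p_{(0,1)}$ denotes $(0,1)$-forms with $L^p$ coefficients. "$T_j$ solves the $\bar\partial_j$-equation on $D_j$" means $\bar\partial_j(T_j\alpha)=\alpha$ for every $\alpha\in L^p_{(0,1)}(D_j)$ with $\bar\partial_j\alpha=0$. $T_j$ acts on forms $g=\sum_{m}g_m\,d\bar z^j_m$ with coefficients in $L^p(D)$ by treating the variables $\bm z^i$, $i\neq j$, as parameters. "$T_j$ commutes with $\partial/\partial\bar z^i_m$" ($i\ne j$) means $\frac{\partial}{\partial\bar z^i_m}T_j(g)=T_j\big(\frac{\partial g}{\partial\bar z^i_m}\big)$ for such $g$ whenever $g$ and $\partial g/\partial\bar z^i_m$ (derivative applied to coefficients) have coefficients in $L^p(D)$. Write a $(0,1)$-form on $D$ as $f=\sum_{j=1}^k\sum_{m=1}^{n_j}f^j_m\,d\bar z^j_m$. For $I=\{i_1,\dots,i_l\}\subset\{1,\dots,k\}$ with $l\ge1$, $f_I$ denotes the class of all derivatives $$\frac{\partial^{l-1}f^{i_1}_{m_1}}{\partial\bar z^{i_2}_{m_2}\cdots\partial\bar z^{i_l}_{m_l}},\qquad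 1\le m_s\le n_{i_s}\ (s=1,\dots,l)$$ (for $l=1$ just the coefficients $f^{i_1}_{m_1}$). "$f_I\in L^p(D)$" means every member of this class is in $L^p(D)$, and $\|f_I\|_{L^p(D)}$ is the sum of the $L^p(D)$ norms of all members of the class. *)

theory Defs
  imports "HOL-Analysis.Analysis" "HOL-Probability.Essential_Supremum"
begin

section \<open>Analysis on \<open>\<complex>\<^sup>I\<close> for a finite set \<open>I\<close> of coordinate labels\<close>

text \<open>
  The dimensions \<open>n\<^sub>j\<close> vary with \<open>j\<close>, so a complex Euclidean space is not modelled by a type but by
  the set \<open>I \<rightarrow>\<^sub>E UNIV\<close> of points \<open>z :: 'i \<Rightarrow> complex\<close> (equal to \<open>undefined\<close> off \<open>I\<close>) for a finite
  set \<open>I\<close> of coordinate labels, with the product topology and the product Lebesgue measure.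
\<close>

type_synonym 'i point = "'i \<Rightarrow> complex"
type_synonym 'i form01 = "'i \<Rightarrow> 'i point \<Rightarrow> complex"

abbreviation ctop :: "'i set \<Rightarrow> 'i point topology" where
  "ctop I \<equiv> product_topology (\<lambda>_. euclidean) I"

abbreviation cvol :: "'i set \<Rightarrow> 'i point measure" where
  "cvol I \<equiv> Pi\<^sub>M I (\<lambda>_. lborel)"

abbreviation cvol_on :: "'i set \<Rightarrow> 'i point set \<Rightarrow> 'i point measure" where
  "cvol_on I U \<equiv> restrict_space (cvol I) U"

definition bounded_domain :: "'i set \<Rightarrow> 'i point set \<Rightarrow> bool" where
  "bounded_domain I U \<longleftrightarrow> U \<noteq> {} \<and> openin (ctop I) U \<and> connectedin (ctop I) U \<and>
     (\<exists>R. \<forall>z\<in>U. \<forall>i\<in>I. norm (z i) \<le> R)"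

text \<open>
  \<open>dir_deriv i a \<phi>\<close> is the real directional derivative in the \<open>i\<close>-th coordinate in direction
  \<open>a \<in> \<complex>\<close>: \<open>a = 1\<close> gives \<open>\<partial>/\<partial>x\<^sub>i\<close>, and \<open>a = \<i>\<close> gives \<open>\<partial>/\<partial>y\<^sub>i\<close>, where \<open>z\<^sub>i = x\<^sub>i + \<i> y\<^sub>i\<close>.
\<close>

definition dir_deriv :: "'i \<Rightarrow> complex \<Rightarrow> ('i point \<Rightarrow> complex) \<Rightarrow> 'i point \<Rightarrow> complex" where
  "dir_deriv i a \<phi> z =
     vector_derivative (\<lambda>t::real. \<phi> (z(i := z i + of_real t * a))) (at 0)"

primrec C_diff :: "nat \<Rightarrow> 'i set \<Rightarrow> ('i point \<Rightarrow> complex) \<Rightarrow> bool" where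
  "C_diff 0 I \<phi> \<longleftrightarrow> continuous_map (ctop I) euclidean \<phi>"
| "C_diff (Suc r) I \<phi> \<longleftrightarrow> continuous_map (ctop I) euclidean \<phi> \<and>
     (\<forall>i\<in>I. \<forall>a\<in>{1, \<i>}.
        (\<forall>z\<in>topspace (ctop I).
           (\<lambda>t::real. \<phi> (z(i := z i + of_real t * a))) differentiable (at 0)) \<and>
        C_diff r I (dir_deriv i a \<phi>))"

definition dbar :: "'i \<Rightarrow> ('i point \<Rightarrow> complex) \<Rightarrow> 'i point \<Rightarrow> complex" where
  "dbar i \<phi> z = (dir_deriv i 1 \<phi> z + \<i> * dir_deriv i \<i> \<phi> z) / 2"

text \<open>\<open>C\<^sub>c\<^sup>\<infinity>(U)\<close>, as functions on the whole space vanishing off a compact subset of \<open>U\<close>.\<close>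

definition test_functions :: "'i set \<Rightarrow> 'i point set \<Rightarrow> ('i point \<Rightarrow> complex) set" where
  "test_functions I U = {\<phi>. (\<forall>r. C_diff r I \<phi>) \<and>
     (\<exists>K. compactin (ctop I) K \<and> K \<subseteq> U \<and> (\<forall>z\<in>topspace (ctop I) - K. \<phi> z = 0))}"

definition loc_integrable :: "'i set \<Rightarrow> 'i point set \<Rightarrow> ('i point \<Rightarrow> complex) \<Rightarrow> bool" where
  "loc_integrable I U u \<longleftrightarrow>
     (\<forall>K. compactin (ctop I) K \<and> K \<subseteq> U \<longrightarrow> set_integrable (cvol I) K u)"

text \<open>
  \<open>has_weak_dbar I U [i\<^sub>1, \<dots>, i\<^sub>r] u g\<close>: on \<open>U\<close>,
  \<open>\<partial>\<^sup>r u / \<partial>z\<^sub>i\<^sub>1-bar \<cdots> \<partial>z\<^sub>i\<^sub>r-bar = g\<close> in the sense of distributions. The intermediate derivatives need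
  not be functions.
\<close>

definition has_weak_dbar ::
    "'i set \<Rightarrow> 'i point set \<Rightarrow> 'i list \<Rightarrow> ('i point \<Rightarrow> complex) \<Rightarrow> ('i point \<Rightarrow> complex) \<Rightarrow> bool" where
  "has_weak_dbar I U is u g \<longleftrightarrow> loc_integrable I U u \<and> loc_integrable I U g \<and>
     (\<forall>\<phi>\<in>test_functions I U.
        (LINT z:U|cvol I. u z * foldr dbar is \<phi> z) =
        (-1) ^ length is * (LINT z:U|cvol I. g z * \<phi> z))"

definition weak_dbar ::
    "'i set \<Rightarrow> 'i point set \<Rightarrow> 'i list \<Rightarrow> ('i point \<Rightarrow> complex) \<Rightarrow> 'i point \<Rightarrow> complex" where
  "weak_dbar I U is u = (SOME g. has_weak_dbar I U is u g)"

text \<open>A \<open>(0,1)\<close>-form \<open>\<Sum>\<^sub>i \<alpha>\<^sub>i dz\<^sub>i-bar\<close> on \<open>U\<close> is the family \<open>\<alpha>\<close> of its coefficients, of which only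
  those with index in \<open>I\<close> are relevant.\<close>

definition dbar_equation ::
    "'i set \<Rightarrow> 'i point set \<Rightarrow> ('i point \<Rightarrow> complex) \<Rightarrow> 'i form01 \<Rightarrow> bool" where
  "dbar_equation I U u \<alpha> \<longleftrightarrow> (\<forall>i\<in>I. has_weak_dbar I U [i] u (\<alpha> i))"

text \<open>The \<open>dz\<^sub>i-bar \<and> dz\<^sub>l-bar\<close> component of \<open>\<partial>-bar \<alpha>\<close> is
  \<open>\<partial>\<alpha>\<^sub>l/\<partial>z\<^sub>i-bar - \<partial>\<alpha>\<^sub>i/\<partial>z\<^sub>l-bar\<close>, a distribution which need not be a function.\<close>

definition dbar_closed :: "'i set \<Rightarrow> 'i point set \<Rightarrow> 'i form01 \<Rightarrow> bool" where
  "dbar_closed I U \<alpha> \<longleftrightarrow> (\<forall>i\<in>I. loc_integrable I U (\<alpha> i)) \<and>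
     (\<forall>i\<in>I. \<forall>l\<in>I. \<forall>\<phi>\<in>test_functions I U.
        (LINT z:U|cvol I. \<alpha> l z * dbar i \<phi> z) = (LINT z:U|cvol I. \<alpha> i z * dbar l \<phi> z))"


section \<open>\<open>L\<^sup>p\<close> spaces, \<open>1 \<le> p \<le> \<infinity>\<close>\<close>

definition Lp_norm :: "ennreal \<Rightarrow> 'a measure \<Rightarrow> ('a \<Rightarrow> complex) \<Rightarrow> real" where
  "Lp_norm p M f =
     (if p = \<infinity> then enn2real (esssup M (\<lambda>x. ennreal (norm (f x))))
      else (LINT x|M. norm (f x) powr enn2real p) powr (1 / enn2real p))"

definition Lp :: "ennreal \<Rightarrow> 'a measure \<Rightarrow> ('a \<Rightarrow> complex) set" where
  "Lp p M = {f \<in> borel_measurable M.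
     if p = \<infinity> then esssup M (\<lambda>x. ennreal (norm (f x))) < \<infinity>
     else integrable M (\<lambda>x. norm (f x) powr enn2real p)}"

definition Lp_forms :: "ennreal \<Rightarrow> 'i set \<Rightarrow> 'i point measure \<Rightarrow> 'i form01 set" where
  "Lp_forms p I M = {\<alpha>. \<forall>i\<in>I. \<alpha> i \<in> Lp p M}"

definition Lp_form_norm :: "ennreal \<Rightarrow> 'i set \<Rightarrow> 'i point measure \<Rightarrow> 'i form01 \<Rightarrow> real" where
  "Lp_form_norm p I M \<alpha> = (\<Sum>i\<in>I. Lp_norm p M (\<alpha> i))"

text \<open>
  Operators act on representatives, and identities between their values hold almost everywhere.
  Linearity in this sense together with a norm bound makes an operator respect a.e. equality,
  so it induces a complex-linear operator on equivalence classes.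
\<close>

definition linear_into_Lp ::
    "ennreal \<Rightarrow> 'i point measure \<Rightarrow> 'i form01 set \<Rightarrow> ('i form01 \<Rightarrow> 'i point \<Rightarrow> complex) \<Rightarrow> bool" where
  "linear_into_Lp p M F T \<longleftrightarrow>
     (\<forall>\<alpha>\<in>F. T \<alpha> \<in> Lp p M) \<and>
     (\<forall>\<alpha>\<in>F. \<forall>\<beta>\<in>F. AE z in M. T (\<lambda>i x. \<alpha> i x + \<beta> i x) z = T \<alpha> z + T \<beta> z) \<and>
     (\<forall>c. \<forall>\<alpha>\<in>F. AE z in M. T (\<lambda>i x. c * \<alpha> i x) z = c * T \<alpha> z)"

definition bounded_linear_Lp ::
    "ennreal \<Rightarrow> 'i set \<Rightarrow> 'i point set \<Rightarrow> ('i form01 \<Rightarrow> 'i point \<Rightarrow> complex) \<Rightarrow> bool" where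
  "bounded_linear_Lp p I U T \<longleftrightarrow>
     linear_into_Lp p (cvol_on I U) (Lp_forms p I (cvol_on I U)) T \<and>
     (\<exists>C. \<forall>\<alpha>\<in>Lp_forms p I (cvol_on I U).
        Lp_norm p (cvol_on I U) (T \<alpha>) \<le> C * Lp_form_norm p I (cvol_on I U) \<alpha>)"

definition solves_dbar ::
    "ennreal \<Rightarrow> 'i set \<Rightarrow> 'i point set \<Rightarrow> ('i form01 \<Rightarrow> 'i point \<Rightarrow> complex) \<Rightarrow> bool" where
  "solves_dbar p I U T \<longleftrightarrow>
     (\<forall>\<alpha>\<in>Lp_forms p I (cvol_on I U). dbar_closed I U \<alpha> \<longrightarrow> dbar_equation I U (T \<alpha>) \<alpha>)"


section \<open>Product domains\<close>

text \<open>
  The coordinate \<open>z\<^sup>j\<^sub>m\<close> has label \<open>(j, m)\<close>. Thus \<open>\<complex>\<close> to the power \<open>n\<^sub>j\<close>, with coordinates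
  \<open>z\<^sup>j\<^sub>1, \<dots>\<close>, is the space over \<open>labels n {j}\<close>, and the space containing \<open>D\<^sub>1 \<times> \<cdots> \<times> D\<^sub>k\<close> is the one
  over \<open>labels n {1..k}\<close>.
\<close>

type_synonym label = "nat \<times> nat"

definition labels :: "(nat \<Rightarrow> nat) \<Rightarrow> nat set \<Rightarrow> label set" where
  "labels n J = (SIGMA j:J. {1..n j})"

definition prod_domain ::
    "(nat \<Rightarrow> nat) \<Rightarrow> (nat \<Rightarrow> label point set) \<Rightarrow> nat set \<Rightarrow> label point set" where
  "prod_domain n D J =
     {z \<in> labels n J \<rightarrow>\<^sub>E UNIV. \<forall>j\<in>J. restrict z (labels n {j}) \<in> D j}"

abbreviation prod_vol ::
    "(nat \<Rightarrow> nat) \<Rightarrow> (nat \<Rightarrow> label point set) \<Rightarrow> nat set \<Rightarrow> label point measure" where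
  "prod_vol n D J \<equiv> cvol_on (labels n J) (prod_domain n D J)"

text \<open>
  \<open>parametric_value k n D j T g u\<close>: the function \<open>u\<close> on \<open>D = D\<^sub>1 \<times> \<cdots> \<times> D\<^sub>k\<close> is the result of
  applying the operator \<open>T\<close> on \<open>D\<^sub>j\<close> to \<open>g = \<Sum>\<^sub>m g\<^sub>m dz\<^sup>j\<^sub>m-bar\<close>, whose coefficients are functions on
  \<open>D\<close>, with the variables \<open>w\<close> of the other factors treated as parameters. By Fubini, \<open>u\<close> is unique
  almost everywhere. \<open>merge\<close> assembles the point of \<open>D\<close> from its \<open>D\<^sub>j\<close>-part \<open>x\<close> and the rest \<open>w\<close>.
\<close>

definition parametric_value ::
    "nat \<Rightarrow> (nat \<Rightarrow> nat) \<Rightarrow> (nat \<Rightarrow> label point set) \<Rightarrow> nat \<Rightarrow>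
     (label form01 \<Rightarrow> label point \<Rightarrow> complex) \<Rightarrow> label form01 \<Rightarrow> (label point \<Rightarrow> complex) \<Rightarrow> bool" where
  "parametric_value k n D j T g u \<longleftrightarrow>
     u \<in> borel_measurable (prod_vol n D {1..k}) \<and>
     (let J = {1..k} - {j};
          glue = (\<lambda>x w. merge (labels n {j}) (labels n J) (x, w))
      in AE w in prod_vol n D J. AE x in prod_vol n D {j}.
           u (glue x w) = T (\<lambda>i y. g i (glue y w)) x)"

text \<open>
  The convention that \<open>T\<close> acts parameterwise on forms with coefficients in \<open>L\<^sup>p(D)\<close>. A parameterwise
  value is automatically in \<open>L\<^sup>p(D)\<close> if it is jointly measurable. For \<open>p < \<infinity>\<close> a jointly measurable
  version always exists (by density of finite sums of products), but for \<open>p = \<infinity>\<close> this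
  has to be part of the convention.
\<close>

definition acts_parametrically ::
    "ennreal \<Rightarrow> nat \<Rightarrow> (nat \<Rightarrow> nat) \<Rightarrow> (nat \<Rightarrow> label point set) \<Rightarrow> nat \<Rightarrow>
     (label form01 \<Rightarrow> label point \<Rightarrow> complex) \<Rightarrow> bool" where
  "acts_parametrically p k n D j T \<longleftrightarrow>
     (\<forall>g\<in>Lp_forms p (labels n {j}) (prod_vol n D {1..k}). \<exists>u. parametric_value k n D j T g u)"

text \<open>
  In the following definition \<open>g\<close> and \<open>h = \<partial>g/\<partial>z\<^sup>i\<^sub>m-bar\<close> (applied to coefficients) both have
  coefficients in \<open>L\<^sup>p(D)\<close>; \<open>u\<close> and \<open>v\<close> are the parameterwise values of \<open>T\<close> on \<open>g\<close> and \<open>h\<close>.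
\<close>

definition commutes_with_dbar ::
    "ennreal \<Rightarrow> nat \<Rightarrow> (nat \<Rightarrow> nat) \<Rightarrow> (nat \<Rightarrow> label point set) \<Rightarrow> nat \<Rightarrow>
     (label form01 \<Rightarrow> label point \<Rightarrow> complex) \<Rightarrow> label \<Rightarrow> bool" where
  "commutes_with_dbar p k n D j T im \<longleftrightarrow>
     (\<forall>g\<in>Lp_forms p (labels n {j}) (prod_vol n D {1..k}).
      \<forall>h\<in>Lp_forms p (labels n {j}) (prod_vol n D {1..k}).
      \<forall>u v.
        (\<forall>l\<in>labels n {j}.
           has_weak_dbar (labels n {1..k}) (prod_domain n D {1..k}) [im] (g l) (h l)) \<and>
        parametric_value k n D j T g u \<and> parametric_value k n D j T h v \<longrightarrow>
        has_weak_dbar (labels n {1..k}) (prod_domain n D {1..k}) [im] u v)"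


section \<open>The classes \<open>f\<^sub>I\<close> and the space \<open>\<B>\<^sup>p\<close>\<close>

text \<open>
  For \<open>I = {i\<^sub>1 < \<dots> < i\<^sub>l}\<close> the members of \<open>f\<^sub>I\<close> are indexed by the multi-indices
  \<open>m \<in> (\<Pi>\<^sub>E i\<in>I. {1..n i})\<close>; the member belonging to \<open>m\<close> is
  \<open>\<partial>\<^sup>l\<^sup>-\<^sup>1 f\<^sup>i\<^sup>1 / \<partial>z\<^sup>i\<^sup>2-bar \<cdots> \<partial>z\<^sup>i\<^sup>l-bar\<close> with lower indices \<open>m i\<^sub>1, \<dots>, m i\<^sub>l\<close>. For closed \<open>f\<close> it
  does not depend on the enumeration of \<open>I\<close>; the increasing one lists every member once.
\<close>

definition lead_label :: "nat set \<Rightarrow> (nat \<Rightarrow> nat) \<Rightarrow> label" where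
  "lead_label I m = (let i = hd (sorted_list_of_set I) in (i, m i))"

definition deriv_labels :: "nat set \<Rightarrow> (nat \<Rightarrow> nat) \<Rightarrow> label list" where
  "deriv_labels I m = map (\<lambda>i. (i, m i)) (tl (sorted_list_of_set I))"

definition class_in_Lp ::
    "ennreal \<Rightarrow> nat \<Rightarrow> (nat \<Rightarrow> nat) \<Rightarrow> (nat \<Rightarrow> label point set) \<Rightarrow> nat set \<Rightarrow> label form01 \<Rightarrow> bool" where
  "class_in_Lp p k n D I f \<longleftrightarrow>
     (\<forall>m\<in>(\<Pi>\<^sub>E i\<in>I. {1..n i}). \<exists>g\<in>Lp p (prod_vol n D {1..k}).
        has_weak_dbar (labels n {1..k}) (prod_domain n D {1..k})
          (deriv_labels I m) (f (lead_label I m)) g)"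

definition class_norm ::
    "ennreal \<Rightarrow> nat \<Rightarrow> (nat \<Rightarrow> nat) \<Rightarrow> (nat \<Rightarrow> label point set) \<Rightarrow> nat set \<Rightarrow> label form01 \<Rightarrow> real" where
  "class_norm p k n D I f =
     (\<Sum>m\<in>(\<Pi>\<^sub>E i\<in>I. {1..n i}).
        Lp_norm p (prod_vol n D {1..k})
          (weak_dbar (labels n {1..k}) (prod_domain n D {1..k})
             (deriv_labels I m) (f (lead_label I m))))"

definition B_space ::
    "ennreal \<Rightarrow> nat \<Rightarrow> (nat \<Rightarrow> nat) \<Rightarrow> (nat \<Rightarrow> label point set) \<Rightarrow> label form01 set" where
  "B_space p k n D =
     {f. dbar_closed (labels n {1..k}) (prod_domain n D {1..k}) f \<and>
         (\<forall>I. I \<subseteq> {1..k} \<and> I \<noteq> {} \<longrightarrow> class_in_Lp p k n D I f)}"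

end

(* The groups of variables are solved for one after the other. If the closed form f has vanishing
   coefficients in the groups 1, ..., j-1, let u be T_j applied parameterwise to the group-j part of f.
   On almost every slice that part is closed (test against a countable dense family of test
   functions), so by Fubini the group-j derivatives of u are the group-j coefficients of f. By
   commutation the earlier derivatives of u vanish and the later ones are T_j applied to mixed
   derivatives of f. Hence f - dbar u is closed, its coefficients vanish in the groups 1, ..., j, and
   its mixed derivatives in the remaining groups are those of f minus T_j of those with one more
   derivative, which are again in L^p. After k steps nothing is left.

   For p < infinity, a jointly measurable parameterwise value of T_j is obtained by starting from
   indicators of rectangles and passing to dominated limits. *)

theory Submission
  imports Defs
begin

section \<open>Calculus of \<open>C_diff\<close>: explicit derivatives, frozen variables, smooth
  cutoffs\<close>

section \<open>Differentiable functions of finitely many complex variables\<close>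

text \<open>Unrolled, the solution is, up to null sets, the sum over nonempty I = {i1 < ... < il} of
  (-1)^(l-1) T_il ... T_i1 applied to the class f_I. Each step spends exactly one derivative, in its
  own group, so mixed derivatives with at most one index per group are all that is ever needed, and
  each summand is bounded by the norm of one class. Weak derivatives and parameterwise values are
  determined only almost everywhere. They are therefore chosen by \<open>SOME\<close>, and linearity
  is recovered from uniqueness statements. The given operators act on representatives; that they
  respect a.e. equality follows from linearity and the norm bound. The exceptional null set of
  parameters depends on the test function, which is the reason for a countable family. Norm
  inequalities are needed only up to constants, so crude factors counting summands stand in for
  Minkowski's inequality. Boundedness of the domains makes the measures finite and puts every
  \<open>L\<^sup>p\<close> inside \<open>L\<^sup>1\<close>, where Fubini applies for all p.\<close>

lemma continuous_map_binop:
  fixes f :: "'a \<Rightarrow> 'b::topological_space" and g :: "'a \<Rightarrow> 'c::topological_space"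
  assumes "continuous_map X euclidean f" "continuous_map X euclidean g"
    and "continuous_on UNIV (\<lambda>p. h (fst p) (snd p) :: 'd::topological_space)"
  shows "continuous_map X euclidean (\<lambda>x. h (f x) (g x))"
proof -
  have "continuous_map X (prod_topology euclidean euclidean) (\<lambda>x. (f x, g x))"
    unfolding continuous_map_paired using assms(1,2) by blast
  then have "continuous_map X euclidean (\<lambda>x. (f x, g x))" by (simp add: euclidean_product_topology)
  from continuous_map_compose[OF this, of euclidean "\<lambda>p. h (fst p) (snd p)"] assms(3)
  show ?thesis by (simp add: o_def)
qed

lemma continuous_map_comp_continuous:
  fixes f :: "'a \<Rightarrow> 'b::topological_space" and h :: "'b \<Rightarrow> 'c::topological_space"
  assumes "continuous_map X euclidean f" "continuous_on UNIV h"
  shows "continuous_map X euclidean (\<lambda>x. h (f x))"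
  using continuous_map_compose[OF assms(1), of euclidean h] assms(2) by (simp add: o_def)

lemma continuous_map_cadd:
  fixes f g :: "'a \<Rightarrow> complex"
  assumes "continuous_map X euclidean f" "continuous_map X euclidean g"
  shows "continuous_map X euclidean (\<lambda>x. f x + g x)"
  by (rule continuous_map_binop[OF assms]) (intro continuous_intros)

lemma continuous_map_cmult:
  fixes f g :: "'a \<Rightarrow> complex"
  assumes "continuous_map X euclidean f" "continuous_map X euclidean g"
  shows "continuous_map X euclidean (\<lambda>x. f x * g x)"
  by (rule continuous_map_binop[OF assms]) (intro continuous_intros)

lemma topspace_ctop: "topspace (ctop I) = I \<rightarrow>\<^sub>E UNIV"
  by simp

lemma C_diff_continuous: "C_diff r I \<phi> \<Longrightarrow> continuous_map (ctop I) euclidean \<phi>"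
  by (cases r) auto

lemma dir_deriv_cong:
  assumes "\<And>z. z \<in> I \<rightarrow>\<^sub>E UNIV \<Longrightarrow> \<phi> z = \<psi> z" "i \<in> I" "z \<in> I \<rightarrow>\<^sub>E UNIV"
  shows "dir_deriv i a \<phi> z = dir_deriv i a \<psi> z"
proof -
  have "z(i := c) \<in> I \<rightarrow>\<^sub>E UNIV" for c using assms(2,3) by (auto simp: PiE_iff extensional_def)
  then show ?thesis unfolding dir_deriv_def using assms(1) by simp
qed

text \<open>Points off \<open>I \<rightarrow>\<^sub>E UNIV\<close> carry no meaning. A shift of a
  coordinate labelled in \<open>I\<close> does not leave the space, so derivatives of every order
  see only values there.\<close>

lemma C_diff_cong:
  assumes "\<And>z. z \<in> I \<rightarrow>\<^sub>E UNIV \<Longrightarrow> \<phi> z = \<psi> z"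
  shows "C_diff r I \<phi> \<longleftrightarrow> C_diff r I \<psi>"
  using assms
proof (induction r arbitrary: \<phi> \<psi>)
  case 0
  then show ?case by (auto intro: continuous_map_eq)
next
  case (Suc r)
  have up: "z(i := c) \<in> I \<rightarrow>\<^sub>E UNIV" if "z \<in> I \<rightarrow>\<^sub>E UNIV" "i \<in> I" for c z i
    using that by (auto simp: PiE_iff extensional_def)
  have "(\<lambda>t::real. \<phi> (z(i := z i + of_real t * a))) = (\<lambda>t. \<psi> (z(i := z i + of_real t * a)))"
    if "z \<in> I \<rightarrow>\<^sub>E UNIV" "i \<in> I" for z i a
    using Suc.prems up[OF that] by (intro ext) blast
  moreover have "continuous_map (ctop I) euclidean \<phi> \<longleftrightarrow> continuous_map (ctop I) euclidean \<psi>"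
    using Suc.prems by (auto intro: continuous_map_eq)
  moreover have "C_diff r I (dir_deriv i a \<phi>) \<longleftrightarrow> C_diff r I (dir_deriv i a \<psi>)" if "i \<in> I" for i a
    by (rule Suc.IH) (simp add: dir_deriv_cong[OF Suc.prems that])
  ultimately show ?case by (simp del: topspace_product_topology add: topspace_ctop)
qed

lemma C_diff_has_derivative:
  assumes "C_diff (Suc r) I \<phi>" "i \<in> I" "a \<in> {1, \<i>}" "z \<in> I \<rightarrow>\<^sub>E UNIV"
  shows "((\<lambda>t::real. \<phi> (z(i := z i + of_real t * a))) has_vector_derivative dir_deriv i a \<phi> z) (at 0)"
  using assms unfolding dir_deriv_def
  by (auto simp: vector_derivative_works[symmetric])

text \<open>Lets a proof of smoothness write its derivatives down explicitly: any
  \<open>\<psi>\<close> that is the derivative at the points of the space serves, since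
  \<open>dir_deriv\<close> agrees with it there and \<open>C_diff_cong\<close> discards the
  rest.\<close>

lemma C_diff_Suc_iff:
  "C_diff (Suc r) I \<phi> \<longleftrightarrow> continuous_map (ctop I) euclidean \<phi> \<and>
     (\<forall>i\<in>I. \<forall>a\<in>{1, \<i>}. \<exists>\<psi>. C_diff r I \<psi> \<and> (\<forall>z\<in>I \<rightarrow>\<^sub>E UNIV.
        ((\<lambda>t::real. \<phi> (z(i := z i + of_real t * a))) has_vector_derivative \<psi> z) (at 0)))"
  (is "?L \<longleftrightarrow> ?R")
proof
  assume L: ?L
  show ?R
  proof (intro conjI ballI)
    show "continuous_map (ctop I) euclidean \<phi>" using L by simp
    fix i a assume "i \<in> I" "a \<in> {1, \<i>}"
    then show "\<exists>\<psi>. C_diff r I \<psi> \<and> (\<forall>z\<in>I \<rightarrow>\<^sub>E UNIV.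
        ((\<lambda>t::real. \<phi> (z(i := z i + of_real t * a))) has_vector_derivative \<psi> z) (at 0))"
      using L C_diff_has_derivative[OF L] by (intro exI[of _ "dir_deriv i a \<phi>"]) auto
  qed
next
  assume R: ?R
  show ?L
    unfolding C_diff.simps
  proof (intro conjI ballI)
    show "continuous_map (ctop I) euclidean \<phi>" using R by simp
    fix i a assume ia: "i \<in> I" "a \<in> {1, \<i>}"
    with R obtain \<psi> where \<psi>: "C_diff r I \<psi>" "\<And>z. z\<in>I \<rightarrow>\<^sub>E UNIV \<Longrightarrow>
        ((\<lambda>t::real. \<phi> (z(i := z i + of_real t * a))) has_vector_derivative \<psi> z) (at 0)" by blast
    show "(\<lambda>t::real. \<phi> (z(i := z i + of_real t * a))) differentiable (at 0)" if "z \<in> topspace (ctop I)" for z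
      using \<psi>(2) that by (auto simp: has_vector_derivative_def differentiable_def)
    have "dir_deriv i a \<phi> z = \<psi> z" if "z\<in>I \<rightarrow>\<^sub>E UNIV" for z
      unfolding dir_deriv_def using \<psi>(2)[OF that] by (rule vector_derivative_at)
    then show "C_diff r I (dir_deriv i a \<phi>)" using C_diff_cong \<psi>(1) by blast
  qed
qed

lemma C_diff_SucI:
  assumes "continuous_map (ctop I) euclidean \<phi>"
    and "\<And>i a. i \<in> I \<Longrightarrow> a \<in> {1, \<i>} \<Longrightarrow> C_diff r I (\<psi> i a)"
    and "\<And>i a z. i \<in> I \<Longrightarrow> a \<in> {1, \<i>} \<Longrightarrow> z \<in> I \<rightarrow>\<^sub>E UNIV \<Longrightarrow>
        ((\<lambda>t::real. \<phi> (z(i := z i + of_real t * a))) has_vector_derivative \<psi> i a z) (at 0)"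
  shows "C_diff (Suc r) I \<phi>"
  unfolding C_diff_Suc_iff using assms by blast

lemma C_diff_dir_deriv: "C_diff (Suc r) I \<phi> \<Longrightarrow> i \<in> I \<Longrightarrow> a \<in> {1, \<i>} \<Longrightarrow> C_diff r I (dir_deriv i a \<phi>)"
  by auto

text \<open>The recursion does not list the lower orders, so this is an induction of its own. The
  product rule needs it, because one factor stays undifferentiated and must count at the lower
  order.\<close>

lemma C_diff_Suc_imp: "C_diff (Suc r) I \<phi> \<Longrightarrow> C_diff r I \<phi>"
proof (induction r arbitrary: \<phi>)
  case (Suc r)
  show ?case
    using C_diff_has_derivative[OF Suc.prems] Suc.IH[OF C_diff_dir_deriv[OF Suc.prems]]
      C_diff_continuous[OF Suc.prems]
    by (intro C_diff_SucI[where \<psi> = "\<lambda>i a. dir_deriv i a \<phi>"])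
qed simp

lemma C_diff_const: "C_diff r I (\<lambda>_. c)"
proof (induction r arbitrary: c)
  case (Suc r)
  show ?case by (rule C_diff_SucI[where \<psi> = "\<lambda>i a z. 0"]) (auto intro: Suc.IH)
qed simp

lemma C_diff_add:
  "C_diff r I \<phi> \<Longrightarrow> C_diff r I \<psi> \<Longrightarrow> C_diff r I (\<lambda>z. \<phi> z + \<psi> z)"
proof (induction r arbitrary: \<phi> \<psi>)
  case 0
  then show ?case by (simp add: continuous_map_cadd)
next
  case (Suc r)
  show ?case
    using Suc.IH[OF C_diff_dir_deriv[OF Suc.prems(1)] C_diff_dir_deriv[OF Suc.prems(2)]]
    by (intro C_diff_SucI[where \<psi> = "\<lambda>i a z. dir_deriv i a \<phi> z + dir_deriv i a \<psi> z"]
          continuous_map_cadd has_vector_derivative_add C_diff_has_derivative[OF Suc.prems(1)]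
          C_diff_has_derivative[OF Suc.prems(2)] C_diff_continuous[OF Suc.prems(1)]
          C_diff_continuous[OF Suc.prems(2)])
qed

lemma C_diff_mult:
  "C_diff r I \<phi> \<Longrightarrow> C_diff r I \<psi> \<Longrightarrow> C_diff r I (\<lambda>z. \<phi> z * \<psi> z)"
proof (induction r arbitrary: \<phi> \<psi>)
  case 0
  then show ?case by (simp add: continuous_map_cmult)
next
  case (Suc r)
  note lower = C_diff_Suc_imp[OF Suc.prems(1)] C_diff_Suc_imp[OF Suc.prems(2)]
  show ?case
  proof (rule C_diff_SucI[where \<psi> = "\<lambda>i a z. \<phi> z * dir_deriv i a \<psi> z + dir_deriv i a \<phi> z * \<psi> z"])
    fix i a and z :: "'a point" assume *: "i \<in> I" "a \<in> {1, \<i>}" "z \<in> I \<rightarrow>\<^sub>E UNIV"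
    show "((\<lambda>t. \<phi> (z(i := z i + of_real t * a)) * \<psi> (z(i := z i + of_real t * a)))
        has_vector_derivative \<phi> z * dir_deriv i a \<psi> z + dir_deriv i a \<phi> z * \<psi> z) (at 0)"
      using has_vector_derivative_mult[OF C_diff_has_derivative[OF Suc.prems(1) *]
          C_diff_has_derivative[OF Suc.prems(2) *]] by (simp del: fun_upd_apply)
  qed (auto intro!: C_diff_add Suc.IH C_diff_dir_deriv Suc.prems lower continuous_map_cmult
        C_diff_continuous[OF Suc.prems(1)] C_diff_continuous[OF Suc.prems(2)]
        simp del: C_diff.simps)
qed

lemma C_diff_prod:
  "(\<And>a. a \<in> A \<Longrightarrow> C_diff r I (\<phi> a)) \<Longrightarrow> C_diff r I (\<lambda>z. \<Prod>a\<in>A. \<phi> a z)"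
  by (induction A rule: infinite_finite_induct) (auto intro: C_diff_const C_diff_mult)

lemma dir_deriv_affine:
  assumes "C_diff (Suc r) I \<phi>" "C_diff (Suc r) I \<psi>" "i \<in> I" "a \<in> {1, \<i>}" "z \<in> I \<rightarrow>\<^sub>E UNIV"
  shows "dir_deriv i a (\<lambda>z. b * \<phi> z + c * \<psi> z) z = b * dir_deriv i a \<phi> z + c * dir_deriv i a \<psi> z"
  unfolding dir_deriv_def[of i a "\<lambda>z. b * \<phi> z + c * \<psi> z"]
  by (intro vector_derivative_at has_vector_derivative_add has_vector_derivative_mult_right
      C_diff_has_derivative[OF assms(1,3-)] C_diff_has_derivative[OF assms(2-)])

lemma C_diff_dbar:
  assumes "C_diff (Suc r) I \<phi>" "i \<in> I" shows "C_diff r I (dbar i \<phi>)"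
proof -
  have "dbar i \<phi> = (\<lambda>z. (1/2) * dir_deriv i 1 \<phi> z + (\<i>/2) * dir_deriv i \<i> \<phi> z)"
    by (auto simp: dbar_def fun_eq_iff add_divide_distrib)
  moreover have "C_diff r I (\<lambda>z. (1/2) * dir_deriv i 1 \<phi> z + (\<i>/2) * dir_deriv i \<i> \<phi> z)"
    using C_diff_dir_deriv[OF assms, of 1] C_diff_dir_deriv[OF assms, of \<i>]
    by (intro C_diff_add C_diff_mult C_diff_const) auto
  ultimately show ?thesis by simp
qed

lemma restrict_upd: "restrict (z(i := c)) I = (if i \<in> I then (restrict z I)(i := c) else restrict z I)"
  by (auto simp: fun_eq_iff)

lemma merge_upd:
  "i \<in> I \<Longrightarrow> merge I J (x(i := c), w) = (merge I J (x, w))(i := c)"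
  "i \<in> J \<Longrightarrow> i \<notin> I \<Longrightarrow> merge I J (x, w(i := c)) = (merge I J (x, w))(i := c)"
  by (auto simp: fun_eq_iff merge_def)

lemma continuous_map_restrict_ctop:
  assumes "I \<subseteq> K" shows "continuous_map (ctop K) (ctop I) (\<lambda>z. restrict z I)"
  using assms by (auto simp: continuous_map_componentwise intro!: continuous_map_product_projection
      continuous_map_eq[OF continuous_map_product_projection])

lemma continuous_map_merge:
  "continuous_map (prod_topology (ctop I) (ctop J)) (ctop (I \<union> J)) (merge I J)"
  unfolding continuous_map_componentwise
proof (intro conjI ballI)
  show "merge I J ` topspace (prod_topology (ctop I) (ctop J)) \<subseteq> extensional (I \<union> J)" by auto
  fix k assume k: "k \<in> I \<union> J"
  show "continuous_map (prod_topology (ctop I) (ctop J)) euclidean (\<lambda>x. merge I J x k)"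
  proof (cases "k \<in> I")
    case True
    then show ?thesis by (auto simp: merge_def case_prod_unfold
          intro!: continuous_map_compose[OF continuous_map_fst continuous_map_product_projection, unfolded o_def])
  next
    case False
    with k show ?thesis by (auto simp: merge_def case_prod_unfold
          intro!: continuous_map_compose[OF continuous_map_snd continuous_map_product_projection, unfolded o_def])
  qed
qed

lemma continuous_map_merge_left:
  assumes "w \<in> J \<rightarrow>\<^sub>E UNIV"
  shows "continuous_map (ctop I) (ctop (I \<union> J)) (\<lambda>x. merge I J (x, w))"
proof -
  have "continuous_map (ctop I) (prod_topology (ctop I) (ctop J)) (\<lambda>x. (x, w))"
    using assms by (auto simp: continuous_map_paired)
  from continuous_map_compose[OF this continuous_map_merge] show ?thesis by (simp add: o_def)
qed

text \<open>A shift of a coordinate outside \<open>I\<close> is invisible after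
  \<open>restrict\<close>, so those derivatives are zero. This turns functions of one group of
  variables into functions of all of them.\<close>

lemma C_diff_restrict:
  "I \<subseteq> K \<Longrightarrow> C_diff r I \<phi> \<Longrightarrow> C_diff r K (\<lambda>z. \<phi> (restrict z I))"
proof (induction r arbitrary: \<phi>)
  case 0
  then show ?case
    using continuous_map_compose[OF continuous_map_restrict_ctop[of I K], of euclidean \<phi>]
    by (simp add: o_def del: restrict_apply)
next
  case (Suc r)
  show ?case
  proof (rule C_diff_SucI[where \<psi> = "\<lambda>i a z. if i \<in> I then dir_deriv i a \<phi> (restrict z I) else 0"])
    show "continuous_map (ctop K) euclidean (\<lambda>z. \<phi> (restrict z I))"
      using continuous_map_compose[OF continuous_map_restrict_ctop[OF Suc.prems(1)] C_diff_continuous[OF Suc.prems(2)]]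
      by (simp add: o_def)
    fix i a and z :: "'a point" assume *: "i \<in> K" "a \<in> {1, \<i>}"
    show "C_diff r K (\<lambda>z. if i \<in> I then dir_deriv i a \<phi> (restrict z I) else 0)"
      using Suc.IH[OF Suc.prems(1) C_diff_dir_deriv[OF Suc.prems(2) _ *(2)]]
      by (cases "i \<in> I") (auto intro: C_diff_const simp del: restrict_apply)
    assume "z \<in> K \<rightarrow>\<^sub>E UNIV"
    show "((\<lambda>t::real. \<phi> (restrict (z(i := z i + complex_of_real t * a)) I)) has_vector_derivative
            (if i \<in> I then dir_deriv i a \<phi> (restrict z I) else 0)) (at 0)"
    proof (cases "i \<in> I")
      case True
      have "restrict z I i = z i" using True by simp
      with C_diff_has_derivative[OF Suc.prems(2) True *(2), of "restrict z I"] True show ?thesis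
        by (simp add: restrict_upd del: fun_upd_apply restrict_apply)
    next
      case False
      then show ?thesis by (simp add: restrict_upd del: fun_upd_apply restrict_apply)
    qed
  qed
qed

lemma dir_deriv_merge:
  assumes "i \<in> I"
  shows "dir_deriv i a (\<lambda>x. \<phi> (merge I J (x, w))) x = dir_deriv i a \<phi> (merge I J (x, w))"
proof -
  have "merge I J (x, w) i = x i" using assms by (simp add: merge_def)
  then show ?thesis unfolding dir_deriv_def using assms by (simp add: merge_upd)
qed

lemma dbar_merge:
  "i \<in> I \<Longrightarrow> dbar i (\<lambda>x. \<phi> (merge I J (x, w))) x = dbar i \<phi> (merge I J (x, w))"
  unfolding dbar_def by (simp add: dir_deriv_merge)

text \<open>The variables in \<open>J\<close> are frozen at \<open>w\<close>. Shifting a coordinate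
  in \<open>I\<close> commutes with \<open>merge\<close>, so each derivative of a slice is a slice
  of a derivative.\<close>

lemma C_diff_merge:
  assumes "w \<in> J \<rightarrow>\<^sub>E UNIV"
  shows "C_diff r (I \<union> J) \<phi> \<Longrightarrow> C_diff r I (\<lambda>x. \<phi> (merge I J (x, w)))"
proof (induction r arbitrary: \<phi>)
  case 0
  then show ?case
    using continuous_map_compose[OF continuous_map_merge_left[OF assms, of I], of euclidean \<phi>] by (simp add: o_def)
next
  case (Suc r)
  show ?case
  proof (rule C_diff_SucI[where \<psi> = "\<lambda>i a x. dir_deriv i a \<phi> (merge I J (x, w))"])
    show "continuous_map (ctop I) euclidean (\<lambda>x. \<phi> (merge I J (x, w)))"
      using continuous_map_compose[OF continuous_map_merge_left[OF assms] C_diff_continuous[OF Suc.prems]]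
      by (simp add: o_def)
    fix i a and x :: "'a point" assume *: "i \<in> I" "a \<in> {1, \<i>}"
    show "C_diff r I (\<lambda>x. dir_deriv i a \<phi> (merge I J (x, w)))"
      using Suc.IH[OF C_diff_dir_deriv[OF Suc.prems _ *(2), of i]] *(1) by simp
    assume x: "x \<in> I \<rightarrow>\<^sub>E UNIV"
    have "merge I J (x, w) \<in> I \<union> J \<rightarrow>\<^sub>E UNIV" using x assms by (auto simp: PiE_iff)
    from C_diff_has_derivative[OF Suc.prems _ *(2) this, of i] *(1)
    have "((\<lambda>t::real. \<phi> ((merge I J (x, w))(i := merge I J (x, w) i + complex_of_real t * a)))
       has_vector_derivative dir_deriv i a \<phi> (merge I J (x, w))) (at 0)" by blast
    moreover have "merge I J (x, w) i = x i" using * by (simp add: merge_def)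
    ultimately show "((\<lambda>t::real. \<phi> (merge I J (x(i := x i + complex_of_real t * a), w))) has_vector_derivative
            dir_deriv i a \<phi> (merge I J (x, w))) (at 0)"
      using *(1) by (simp add: merge_upd del: fun_upd_apply)
  qed
qed

section \<open>Smooth cutoff functions of boxes\<close>

definition smooth_real :: "(real \<Rightarrow> real) \<Rightarrow> bool" where
  "smooth_real f \<longleftrightarrow> (\<exists>F. F 0 = f \<and> (\<forall>m t. (F m has_real_derivative F (Suc m) t) (at t)))"

lemma smooth_real_deriv:
  assumes "smooth_real f"
  obtains f' where "smooth_real f'" "\<And>t. (f has_real_derivative f' t) (at t)"
proof -
  from assms obtain F where F: "F 0 = f" "\<And>m t. (F m has_real_derivative F (Suc m) t) (at t)"
    unfolding smooth_real_def by blast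
  have "smooth_real (F 1)" unfolding smooth_real_def
    using F(2) by (intro exI[of _ "\<lambda>m. F (Suc m)"]) auto
  with F show thesis by (intro that[of "F 1"]) auto
qed

lemma smooth_real_continuous: "smooth_real f \<Longrightarrow> continuous_on UNIV f"
  by (meson DERIV_continuous_on smooth_real_deriv)

lemma smooth_real_affine:
  assumes "smooth_real f" shows "smooth_real (\<lambda>t. f (a * t + b))"
proof -
  from assms obtain F where F: "F 0 = f" "\<And>m t. (F m has_real_derivative F (Suc m) t) (at t)"
    unfolding smooth_real_def by blast
  show ?thesis unfolding smooth_real_def
  proof (intro exI[of _ "\<lambda>m t. a ^ m * F m (a * t + b)"] conjI allI)
    fix m t
    have "((\<lambda>t. F m (a * t + b)) has_real_derivative F (Suc m) (a * t + b) * a) (at t)"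
      by (rule DERIV_chain'[OF _ F(2), of "\<lambda>t. a * t + b" a t]) (auto intro!: derivative_eq_intros)
    from DERIV_cmult[OF this, of "a ^ m"]
    show "((\<lambda>t. a ^ m * F m (a * t + b)) has_real_derivative a ^ Suc m * F (Suc m) (a * t + b)) (at t)"
      by (simp add: algebra_simps)
  qed (use F in auto)
qed

lemma continuous_map_smooth_coordinate:
  assumes "i \<in> I" "bounded_linear \<rho>" "smooth_real f"
  shows "continuous_map (ctop I) euclidean (\<lambda>z. complex_of_real (f (\<rho> (z i))))"
proof (rule continuous_map_comp_continuous[where h = "\<lambda>u. of_real (f (\<rho> u))"])
  show "continuous_map (ctop I) euclidean (\<lambda>z. z i)"
    using continuous_map_product_projection[OF assms(1), of "\<lambda>_. euclidean"] .
  show "continuous_on UNIV (\<lambda>u. complex_of_real (f (\<rho> u)))"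
    by (intro continuous_on_of_real continuous_on_compose2[OF smooth_real_continuous[OF assms(3)]]
        linear_continuous_on assms(2)) auto
qed

text \<open>In the application \<open>\<rho>\<close> is \<open>Re\<close> or \<open>Im\<close>.
  Differentiating in direction \<open>a\<close> produces the constant factor \<open>\<rho> a\<close>
  and replaces \<open>f\<close> by its derivative, which is smooth again; so the induction lets
  \<open>f\<close> vary.\<close>

lemma C_diff_coordinate:
  assumes "i \<in> I" "bounded_linear \<rho>"
  shows "smooth_real f \<Longrightarrow> C_diff r I (\<lambda>z. of_real (f (\<rho> (z i))))"
proof (induction r arbitrary: f)
  case 0
  show ?case using continuous_map_smooth_coordinate[OF assms 0] by simp
next
  case (Suc r)
  obtain f' where f': "smooth_real f'" "\<And>t. (f has_real_derivative f' t) (at t)"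
    using smooth_real_deriv[OF Suc.prems] by blast
  show ?case
  proof (rule C_diff_SucI[where \<psi> = "\<lambda>l a z. (if l = i then of_real (\<rho> a) else 0) * of_real (f' (\<rho> (z i)))"])
    show "continuous_map (ctop I) euclidean (\<lambda>z. complex_of_real (f (\<rho> (z i))))"
      by (rule continuous_map_smooth_coordinate[OF assms Suc.prems])
    fix l a
    show "C_diff r I (\<lambda>z. (if l = i then of_real (\<rho> a) else 0) * of_real (f' (\<rho> (z i))))"
      by (intro C_diff_mult C_diff_const Suc.IH f')
    fix z :: "'a point"
    interpret \<rho>: bounded_linear \<rho> by fact
    have "((\<lambda>t. f (\<rho> (z i + of_real t * a))) has_real_derivative f' (\<rho> (z i)) * \<rho> a) (at 0)"
    proof -
      have "\<rho> (z i + of_real t * a) = \<rho> (z i) + t * \<rho> a" for t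
        by (simp add: \<rho>.add scaleR_conv_of_real[symmetric] \<rho>.scaleR)
      moreover have "((\<lambda>t. f (\<rho> (z i) + t * \<rho> a)) has_real_derivative f' (\<rho> (z i)) * \<rho> a) (at 0)"
        using f'(2)[of "\<rho> (z i)"] by (auto intro!: derivative_eq_intros DERIV_chain'[where g = f])
      ultimately show ?thesis by simp
    qed
    then have "((\<lambda>t. complex_of_real (f (\<rho> (z i + of_real t * a)))) has_vector_derivative
        of_real (f' (\<rho> (z i)) * \<rho> a)) (at 0)"
      by (intro has_vector_derivative_of_real) (simp add: has_real_derivative_iff_has_vector_derivative)
    then show "((\<lambda>t. complex_of_real (f (\<rho> ((z(l := z l + of_real t * a)) i)))) has_vector_derivative
        (if l = i then of_real (\<rho> a) else 0) * of_real (f' (\<rho> (z i)))) (at 0)"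
      by (cases "l = i") (auto simp: mult.commute)
  qed
qed

text \<open>The functions P(1/t) e^(-1/t), extended by 0. The polynomial is carried along because
  this family, unlike e^(-1/t) alone, is closed under differentiation.\<close>

definition flat :: "real poly \<Rightarrow> real \<Rightarrow> real" where
  "flat P t = (if t \<le> 0 then 0 else poly P (inverse t) * exp (- inverse t))"

lemma poly_exp_tendsto_0: "((\<lambda>x::real. poly P x * exp (- x)) \<longlongrightarrow> 0) at_top"
proof -
  have "((\<lambda>x::real. \<Sum>i\<le>degree P. coeff P i * (x ^ i / exp x)) \<longlongrightarrow> 0) at_top"
    by (intro tendsto_null_sum tendsto_mult_right_zero tendsto_power_div_exp_0)
  then show ?thesis
    by (simp add: poly_altdef sum_distrib_right exp_minus divide_inverse mult.assoc)
qed

lemma flat_tendsto_0: "(flat P \<longlongrightarrow> 0) (at 0)"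
proof (rule filterlim_split_at)
  show "(flat P \<longlongrightarrow> 0) (at_left 0)"
    by (rule tendsto_eventually) (auto simp: flat_def eventually_at_filter)
  have "eventually (\<lambda>x::real. flat P (inverse x) = poly P x * exp (- x)) at_top"
    using eventually_gt_at_top[of 0] by eventually_elim (simp add: flat_def)
  with poly_exp_tendsto_0[of P] have "((\<lambda>x. flat P (inverse x)) \<longlongrightarrow> 0) at_top"
    by (subst tendsto_cong)
  then show "(flat P \<longlongrightarrow> 0) (at_right 0)" by (simp add: filterlim_at_right_to_top)
qed

text \<open>With s = 1/t one has ds/dt = -s^2, so P(s) e^(-s) has the derivative s^2 (P(s) - P'(s))
  e^(-s); the polynomial \<open>[:0, 0, 1:]\<close> is s^2.\<close>

lemma flat_has_derivative:
  "(flat P has_real_derivative flat ([:0, 0, 1:] * (P - pderiv P)) t) (at t)"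
proof -
  consider "t < 0" | "t = 0" | "t > 0" by linarith
  then show ?thesis
  proof cases
    case 1
    have "eventually (\<lambda>s. s < 0) (nhds t)" using 1 by (simp add: eventually_nhds_in_open[of "{..<0}", simplified])
    then have "eventually (\<lambda>s. flat P s = 0) (nhds t)"
      by eventually_elim (simp add: flat_def)
    then have "(flat P has_real_derivative 0) (at t)"
      by (subst DERIV_cong_ev[OF refl _ refl]) auto
    then show ?thesis using 1 by (simp add: flat_def)
  next
    case 2
    \<comment> \<open>Dividing by t multiplies by 1/t, which shifts the polynomial by one degree:
      the difference quotient at 0 is again a \<open>flat\<close> function and tends to 0.\<close>
    have "(flat P t - flat P 0) / (t - 0) = flat (pCons 0 P) t" for t
      by (simp add: flat_def field_simps)
    then have "((\<lambda>t. (flat P t - flat P 0) / (t - 0)) \<longlongrightarrow> 0) (at 0)"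
      using flat_tendsto_0[of "pCons 0 P"] by simp
    then show ?thesis using 2 by (simp add: has_field_derivative_iff flat_def)
  next
    case 3
    have "eventually (\<lambda>s. 0 < s) (nhds t)" using 3 by (simp add: eventually_nhds_in_open[of "{0<..}", simplified])
    then have *: "eventually (\<lambda>s. flat P s = poly P (inverse s) * exp (- inverse s)) (nhds t)"
      by eventually_elim (simp add: flat_def)
    have i: "(inverse has_real_derivative - (inverse t ^ 2)) (at t)"
      using DERIV_inverse[of t] 3 by (simp add: numeral_2_eq_2)
    have "((\<lambda>s. poly P (inverse s) * exp (- inverse s)) has_real_derivative
        poly (pderiv P) (inverse t) * - (inverse t ^ 2) * exp (- inverse t) +
        exp (- inverse t) * - (- (inverse t ^ 2)) * poly P (inverse t)) (at t)"
      by (intro DERIV_mult DERIV_chain2[OF poly_DERIV i] DERIV_fun_exp DERIV_minus i)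
    moreover have "poly (pderiv P) (inverse t) * - (inverse t ^ 2) * exp (- inverse t) +
        exp (- inverse t) * - (- (inverse t ^ 2)) * poly P (inverse t) =
        flat ([:0, 0, 1:] * (P - pderiv P)) t"
      using 3 by (simp add: flat_def algebra_simps power2_eq_square)
    ultimately have "((\<lambda>s. poly P (inverse s) * exp (- inverse s)) has_real_derivative
        flat ([:0, 0, 1:] * (P - pderiv P)) t) (at t)" by simp
    then show ?thesis by (subst DERIV_cong_ev[OF refl * refl])
  qed
qed

definition cutoff :: "real \<Rightarrow> real" where
  "cutoff = flat 1"

lemma smooth_real_cutoff: "smooth_real cutoff"
  unfolding smooth_real_def cutoff_def
proof (intro exI conjI allI)
  let ?Q = "\<lambda>m. ((\<lambda>P. [:0, 0, 1:] * (P - pderiv P)) ^^ m) 1"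
  show "flat (?Q 0) = flat 1" by simp
  show "(flat (?Q m) has_real_derivative flat (?Q (Suc m)) t) (at t)" for m t
    using flat_has_derivative[of "?Q m" t] by (simp only: funpow.simps o_apply)
qed

lemma cutoff_bounds: "0 \<le> cutoff t" "cutoff t \<le> 1"
  by (auto simp: cutoff_def flat_def)

lemma cutoff_nonpos: "t \<le> 0 \<Longrightarrow> cutoff t = 0"
  by (simp add: cutoff_def flat_def)

lemma cutoff_scaled_tendsto:
  "(\<lambda>m. cutoff (real m * t)) \<longlonglongrightarrow> (if t > 0 then 1 else 0)"
proof (cases "t > 0")
  case True
  have "(\<lambda>m. exp (- inverse (real m * t))) \<longlonglongrightarrow> exp (- 0)"
    by (intro tendsto_exp tendsto_minus tendsto_inverse_0_at_top
        filterlim_at_top_mult_tendsto_pos[OF tendsto_const True] filterlim_real_sequentially)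
  moreover have "eventually (\<lambda>m. cutoff (real m * t) = exp (- inverse (real m * t))) sequentially"
    using eventually_gt_at_top[of 0] by eventually_elim (use True in \<open>simp add: cutoff_def flat_def mult_le_0_iff\<close>)
  ultimately show ?thesis using True by (simp add: tendsto_cong)
next
  case False
  then have "cutoff (real m * t) = 0" for m by (intro cutoff_nonpos) (simp add: mult_nonneg_nonpos)
  with False show ?thesis by simp
qed

text \<open>One one-sided cutoff for each of the four faces per complex coordinate. Scaling by
  \<open>m\<close> sharpens them: the limit is the indicator of the open box, with values bounded by
  1 and supports in one fixed closed box. These functions do the work of mollifiers.\<close>

definition box_cutoff :: "'i set \<Rightarrow> 'i point \<Rightarrow> 'i point \<Rightarrow> nat \<Rightarrow> 'i point \<Rightarrow> complex" where
  "box_cutoff I \<alpha> \<beta> m z = (\<Prod>i\<in>I.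
     of_real (cutoff (real m * (Re (z i) - Re (\<alpha> i)))) * of_real (cutoff (real m * (Re (\<beta> i) - Re (z i)))) *
     (of_real (cutoff (real m * (Im (z i) - Im (\<alpha> i)))) * of_real (cutoff (real m * (Im (\<beta> i) - Im (z i))))))"

lemma C_diff_box_cutoff: "C_diff r I (box_cutoff I \<alpha> \<beta> m)"
proof -
  have 1: "C_diff r I (\<lambda>z. of_real (cutoff (real m * (\<rho> (z i) - c))))" if "i \<in> I" "bounded_linear \<rho>" for i \<rho> c
    using C_diff_coordinate[OF that smooth_real_affine[OF smooth_real_cutoff, of "real m" "- real m * c"], of r]
    by (simp add: algebra_simps)
  have 2: "C_diff r I (\<lambda>z. of_real (cutoff (real m * (c - \<rho> (z i)))))" if "i \<in> I" "bounded_linear \<rho>" for i \<rho> c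
    using C_diff_coordinate[OF that smooth_real_affine[OF smooth_real_cutoff, of "- real m" "real m * c"], of r]
    by (simp add: algebra_simps)
  show ?thesis
    unfolding box_cutoff_def
    by (intro C_diff_prod C_diff_mult 1 2 bounded_linear_Re bounded_linear_Im)
qed

lemma norm_box_cutoff_le: "norm (box_cutoff I \<alpha> \<beta> m z) \<le> 1"
  unfolding box_cutoff_def prod_norm[symmetric]
  by (intro prod_le_1) (auto simp: norm_mult cutoff_bounds mult_le_one)

lemma box_cutoff_eq_0:
  assumes "finite I" "\<not> (\<forall>i\<in>I. z i \<in> box (\<alpha> i) (\<beta> i))"
  shows "box_cutoff I \<alpha> \<beta> m z = 0"
proof -
  from assms(2) obtain i where i: "i \<in> I" "z i \<notin> box (\<alpha> i) (\<beta> i)" by blast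
  have "cutoff (real m * t) = 0" if "t \<le> 0" for t
    using that by (intro cutoff_nonpos) (simp add: mult_nonneg_nonpos)
  then show ?thesis
    unfolding box_cutoff_def using i assms(1)
    by (intro prod_zero bexI[of _ i]) (auto simp: in_box_complex_iff not_less)
qed

lemma box_cutoff_tendsto:
  assumes "finite I"
  shows "(\<lambda>m. box_cutoff I \<alpha> \<beta> m z) \<longlonglongrightarrow> (if \<forall>i\<in>I. z i \<in> box (\<alpha> i) (\<beta> i) then 1 else 0)"
proof (cases "\<forall>i\<in>I. z i \<in> box (\<alpha> i) (\<beta> i)")
  case True
  have "(\<lambda>m. box_cutoff I \<alpha> \<beta> m z) \<longlonglongrightarrow> (\<Prod>i\<in>I. of_real 1 * of_real 1 * (of_real 1 * of_real 1))"
    unfolding box_cutoff_def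
  proof (intro tendsto_prod tendsto_mult tendsto_of_real)
    fix i assume "i \<in> I"
    with True have "z i \<in> box (\<alpha> i) (\<beta> i)" by blast
    then show "(\<lambda>m. cutoff (real m * (Re (z i) - Re (\<alpha> i)))) \<longlonglongrightarrow> 1"
      "(\<lambda>m. cutoff (real m * (Re (\<beta> i) - Re (z i)))) \<longlonglongrightarrow> 1"
      "(\<lambda>m. cutoff (real m * (Im (z i) - Im (\<alpha> i)))) \<longlonglongrightarrow> 1"
      "(\<lambda>m. cutoff (real m * (Im (\<beta> i) - Im (z i)))) \<longlonglongrightarrow> 1"
      using cutoff_scaled_tendsto[of "Re (z i) - Re (\<alpha> i)"] cutoff_scaled_tendsto[of "Re (\<beta> i) - Re (z i)"]
        cutoff_scaled_tendsto[of "Im (z i) - Im (\<alpha> i)"] cutoff_scaled_tendsto[of "Im (\<beta> i) - Im (z i)"]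
      by (simp_all add: in_box_complex_iff)
  qed
  with True show ?thesis by simp
next
  case False
  then have "box_cutoff I \<alpha> \<beta> m z = 0" for m by (rule box_cutoff_eq_0[OF assms])
  with False show ?thesis by (simp only: if_False tendsto_const)
qed

section \<open>Test functions under differentiation, slicing and products\<close>

section \<open>Test functions\<close>

lemma test_functionsD:
  assumes "\<phi> \<in> test_functions I U"
  shows "C_diff r I \<phi>"
  using assms by (simp add: test_functions_def)

lemma box_cutoff_test_function:
  assumes "finite I" "(\<Pi>\<^sub>E i\<in>I. cbox (\<alpha> i) (\<beta> i)) \<subseteq> U"
  shows "box_cutoff I \<alpha> \<beta> m \<in> test_functions I U"
  unfolding test_functions_def
proof (intro CollectI conjI allI exI[of _ "\<Pi>\<^sub>E i\<in>I. cbox (\<alpha> i) (\<beta> i)"])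
  show "C_diff r I (box_cutoff I \<alpha> \<beta> m)" for r by (rule C_diff_box_cutoff)
  show "compactin (ctop I) (\<Pi>\<^sub>E i\<in>I. cbox (\<alpha> i) (\<beta> i))"
    by (simp add: compactin_PiE)
  show "\<forall>z\<in>topspace (ctop I) - (\<Pi>\<^sub>E i\<in>I. cbox (\<alpha> i) (\<beta> i)). box_cutoff I \<alpha> \<beta> m z = 0"
  proof
    fix z assume z: "z \<in> topspace (ctop I) - (\<Pi>\<^sub>E i\<in>I. cbox (\<alpha> i) (\<beta> i))"
    then have "\<exists>i\<in>I. z i \<notin> cbox (\<alpha> i) (\<beta> i)" by (auto simp: PiE_iff)
    then have "\<not> (\<forall>i\<in>I. z i \<in> box (\<alpha> i) (\<beta> i))" using box_subset_cbox by blast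
    then show "box_cutoff I \<alpha> \<beta> m z = 0" by (rule box_cutoff_eq_0[OF assms(1)])
  qed
qed (fact assms(2))

lemma continuous_map_line:
  assumes "z \<in> I \<rightarrow>\<^sub>E UNIV" "i \<in> I"
  shows "continuous_map euclidean (ctop I) (\<lambda>t::real. z(i := z i + of_real t * a))"
  unfolding continuous_map_componentwise
proof (intro conjI ballI)
  show "(\<lambda>t::real. z(i := z i + of_real t * a)) ` topspace euclidean \<subseteq> extensional I"
    using assms by (auto simp: PiE_iff extensional_def)
  show "continuous_map euclidean euclidean (\<lambda>t::real. (z(i := z i + of_real t * a)) l)" for l
    by (cases "l = i") (auto intro!: continuous_intros)
qed

text \<open>A compact set is closed in this Hausdorff space, so a line through a point off
  \<open>K\<close> avoids \<open>K\<close> for small parameters, and the function vanishes along it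
  near 0.\<close>

lemma dir_deriv_outside_support:
  assumes "compactin (ctop I) K" "\<And>z. z \<in> (I \<rightarrow>\<^sub>E UNIV) - K \<Longrightarrow> \<phi> z = 0"
    and z: "z \<in> (I \<rightarrow>\<^sub>E UNIV) - K" "i \<in> I"
  shows "dir_deriv i a \<phi> z = 0"
proof -
  have "Hausdorff_space (ctop I)" by (simp add: Hausdorff_space_product_topology)
  then have "closedin (ctop I) K" using assms(1) by (rule compactin_imp_closedin)
  then have "openin (ctop I) (topspace (ctop I) - K)" by (rule openin_diff[OF openin_topspace])
  from openin_continuous_map_preimage[OF continuous_map_line this, of z i a] z
  have o: "open {t::real. z(i := z i + of_real t * a) \<in> topspace (ctop I) - K}" by simp
  let ?S = "{t::real. z(i := z i + of_real t * a) \<in> topspace (ctop I) - K}"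
  have "((\<lambda>t::real. \<phi> (z(i := z i + of_real t * a))) has_vector_derivative 0) (at 0)"
  proof (rule has_vector_derivative_transform_within_open[where f = "\<lambda>_. 0" and S = ?S])
    show "open ?S" by (rule o)
    show "0 \<in> ?S" using z(1) by (simp add: fun_upd_idem)
    show "0 = \<phi> (z(i := z i + of_real t * a))" if "t \<in> ?S" for t using that assms(2) by simp
  qed simp
  then show ?thesis unfolding dir_deriv_def by (rule vector_derivative_at)
qed

lemma dbar_test_function:
  assumes "\<phi> \<in> test_functions I U" "i \<in> I"
  shows "dbar i \<phi> \<in> test_functions I U"
proof -
  obtain K where K: "compactin (ctop I) K" "K \<subseteq> U" "\<And>z. z \<in> (I \<rightarrow>\<^sub>E UNIV) - K \<Longrightarrow> \<phi> z = 0"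
    using assms(1) by (auto simp: test_functions_def)
  have "dbar i \<phi> z = 0" if "z \<in> (I \<rightarrow>\<^sub>E UNIV) - K" for z
    using dir_deriv_outside_support[OF K(1,3) that assms(2)] by (simp add: dbar_def)
  with K C_diff_dbar[OF test_functionsD[OF assms(1)] assms(2)] show ?thesis
    by (auto simp: test_functions_def)
qed

lemma test_function_bounded:
  assumes "\<phi> \<in> test_functions I U"
  obtains B where "B \<ge> 0" "\<And>z. z \<in> I \<rightarrow>\<^sub>E UNIV \<Longrightarrow> norm (\<phi> z) \<le> B"
proof -
  obtain K where K: "compactin (ctop I) K" "K \<subseteq> U" "\<And>z. z \<in> (I \<rightarrow>\<^sub>E UNIV) - K \<Longrightarrow> \<phi> z = 0"
    using assms(1) by (auto simp: test_functions_def)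
  have "compactin euclidean (\<phi> ` K)"
    using image_compactin[OF K(1) C_diff_continuous[OF test_functionsD[OF assms, of 0]]] .
  then have "bounded (\<phi> ` K)" by (simp add: compact_imp_bounded)
  then obtain B where B: "B > 0" "\<And>z. z \<in> K \<Longrightarrow> norm (\<phi> z) \<le> B" unfolding bounded_pos by auto
  have "norm (\<phi> z) \<le> B" if "z \<in> I \<rightarrow>\<^sub>E UNIV" for z
    using B K(3)[of z] that by (cases "z \<in> K") auto
  with B(1) show thesis by (intro that[of B]) auto
qed

text \<open>The slice is supported in the projection of the support, a continuous image of a compact
  set. This makes Fubini compatible with the weak formulation.\<close>

lemma test_function_slice:
  assumes "\<phi> \<in> test_functions (I \<union> J) U" "w \<in> J \<rightarrow>\<^sub>E UNIV"
    and "\<And>z. z \<in> U \<Longrightarrow> restrict z I \<in> V"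
  shows "(\<lambda>x. \<phi> (merge I J (x, w))) \<in> test_functions I V"
proof -
  obtain K where K: "compactin (ctop (I \<union> J)) K" "K \<subseteq> U" "\<And>z. z \<in> (I \<union> J \<rightarrow>\<^sub>E UNIV) - K \<Longrightarrow> \<phi> z = 0"
    using assms(1) by (auto simp: test_functions_def)
  let ?K = "(\<lambda>z. restrict z I) ` K"
  have "compactin (ctop I) ?K" by (rule image_compactin[OF K(1) continuous_map_restrict_ctop]) simp
  moreover have "?K \<subseteq> V" using K(2) assms(3) by auto
  moreover have "\<phi> (merge I J (x, w)) = 0" if x: "x \<in> (I \<rightarrow>\<^sub>E UNIV) - ?K" for x
  proof (rule K(3))
    have "restrict (merge I J (x, w)) I = x" using x by (auto simp: fun_eq_iff merge_def PiE_iff extensional_def)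
    then have "merge I J (x, w) \<notin> K" using x by (metis DiffD2 imageI)
    then show "merge I J (x, w) \<in> (I \<union> J \<rightarrow>\<^sub>E UNIV) - K" using x assms(2) by (auto simp: PiE_iff)
  qed
  ultimately show ?thesis
    using C_diff_merge[OF assms(2) test_functionsD[OF assms(1)]] unfolding test_functions_def by auto
qed

text \<open>The support is contained in the two compact supports glued by \<open>merge\<close>. Such
  products separate the two groups of variables and can therefore detect identities slice by
  slice.\<close>

lemma test_function_product:
  assumes "\<phi> \<in> test_functions I V" "\<psi> \<in> test_functions J W" "I \<inter> J = {}"
    and "\<And>z. z \<in> I \<union> J \<rightarrow>\<^sub>E UNIV \<Longrightarrow> restrict z I \<in> V \<Longrightarrow> restrict z J \<in> W \<Longrightarrow> z \<in> U"
  shows "(\<lambda>z. \<phi> (restrict z I) * \<psi> (restrict z J)) \<in> test_functions (I \<union> J) U"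
proof -
  obtain K where K: "compactin (ctop I) K" "K \<subseteq> V" "\<And>z. z \<in> (I \<rightarrow>\<^sub>E UNIV) - K \<Longrightarrow> \<phi> z = 0"
    using assms(1) by (auto simp: test_functions_def)
  obtain L where L: "compactin (ctop J) L" "L \<subseteq> W" "\<And>z. z \<in> (J \<rightarrow>\<^sub>E UNIV) - L \<Longrightarrow> \<psi> z = 0"
    using assms(2) by (auto simp: test_functions_def)
  have sub: "K \<subseteq> I \<rightarrow>\<^sub>E UNIV" "L \<subseteq> J \<rightarrow>\<^sub>E UNIV"
    using compactin_subset_topspace[OF K(1)] compactin_subset_topspace[OF L(1)] by auto
  let ?K = "merge I J ` (K \<times> L)"
  have r: "restrict (merge I J (x, w)) I = x" "restrict (merge I J (x, w)) J = w"
    if "x \<in> I \<rightarrow>\<^sub>E UNIV" "w \<in> J \<rightarrow>\<^sub>E UNIV" for x w :: "'a point"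
    using that assms(3) by (auto simp: fun_eq_iff merge_def PiE_iff extensional_def)
  have "compactin (prod_topology (ctop I) (ctop J)) (K \<times> L)" using K(1) L(1) by (simp add: compactin_Times)
  from image_compactin[OF this continuous_map_merge] have "compactin (ctop (I \<union> J)) ?K" .
  moreover have "?K \<subseteq> U"
  proof (clarify)
    fix x w assume xw: "x \<in> K" "w \<in> L"
    then have xw': "x \<in> I \<rightarrow>\<^sub>E UNIV" "w \<in> J \<rightarrow>\<^sub>E UNIV" using sub by auto
    show "merge I J (x, w) \<in> U"
    proof (rule assms(4))
      show "merge I J (x, w) \<in> I \<union> J \<rightarrow>\<^sub>E UNIV" using xw' by (auto simp: PiE_iff)
    qed (use r[OF xw'] xw K(2) L(2) in auto)
  qed
  moreover have "\<phi> (restrict z I) * \<psi> (restrict z J) = 0" if z: "z \<in> (I \<union> J \<rightarrow>\<^sub>E UNIV) - ?K" for z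
  proof -
    have "z = merge I J (restrict z I, restrict z J)" using z by (auto simp: fun_eq_iff merge_def PiE_iff extensional_def)
    then have "restrict z I \<notin> K \<or> restrict z J \<notin> L" using z by (metis DiffD2 SigmaI imageI)
    then show ?thesis using K(3)[of "restrict z I"] L(3)[of "restrict z J"] z by auto
  qed
  moreover have "C_diff r (I \<union> J) (\<lambda>z. \<phi> (restrict z I) * \<psi> (restrict z J))" for r
    by (intro C_diff_mult C_diff_restrict test_functionsD[OF assms(1)] test_functionsD[OF assms(2)]) auto
  ultimately show ?thesis unfolding test_functions_def by (auto intro!: exI[of _ ?K])
qed

lemma dbar_product:
  assumes "C_diff 1 I \<phi>" "I \<inter> J = {}" "i \<in> I" "z \<in> I \<union> J \<rightarrow>\<^sub>E UNIV"
  shows "dbar i (\<lambda>z. \<phi> (restrict z I) * \<psi> (restrict z J)) z = dbar i \<phi> (restrict z I) * \<psi> (restrict z J)"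
proof -
  have "dir_deriv i a (\<lambda>z. \<phi> (restrict z I) * \<psi> (restrict z J)) z = dir_deriv i a \<phi> (restrict z I) * \<psi> (restrict z J)"
    if a: "a \<in> {1, \<i>}" for a
  proof -
    have iJ: "i \<notin> J" using assms by auto
    have "((\<lambda>t::real. \<phi> ((restrict z I)(i := restrict z I i + of_real t * a)) * \<psi> (restrict z J))
        has_vector_derivative dir_deriv i a \<phi> (restrict z I) * \<psi> (restrict z J)) (at 0)"
      using assms by (intro has_vector_derivative_mult_left C_diff_has_derivative[where r = 0 and I = I] a) auto
    then show ?thesis
      using assms(3) iJ unfolding dir_deriv_def
      by (intro vector_derivative_at) (simp add: restrict_upd del: fun_upd_apply)
  qed
  then show ?thesis by (simp add: dbar_def field_simps)
qed

section \<open>Rational boxes, measurability, and functions orthogonal to all test functions\<close>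

section \<open>Rational boxes and the fundamental lemma of the calculus of variations\<close>

definition open_box :: "'i set \<Rightarrow> 'i point \<Rightarrow> 'i point \<Rightarrow> 'i point set" where
  "open_box I \<alpha> \<beta> = (\<Pi>\<^sub>E i\<in>I. box (\<alpha> i) (\<beta> i))"

definition closed_box :: "'i set \<Rightarrow> 'i point \<Rightarrow> 'i point \<Rightarrow> 'i point set" where
  "closed_box I \<alpha> \<beta> = (\<Pi>\<^sub>E i\<in>I. cbox (\<alpha> i) (\<beta> i))"

definition rational_points :: "'i set \<Rightarrow> 'i point set" where
  "rational_points I = (I \<rightarrow>\<^sub>E {c. Re c \<in> \<rat> \<and> Im c \<in> \<rat>})"

lemma countable_rational_complex: "countable {c. Re c \<in> \<rat> \<and> Im c \<in> \<rat>}"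
proof -
  have "{c. Re c \<in> \<rat> \<and> Im c \<in> \<rat>} = (\<lambda>(a, b). Complex a b) ` (\<rat> \<times> \<rat>)"
  proof safe
    fix c assume "Re c \<in> \<rat>" "Im c \<in> \<rat>"
    then show "c \<in> (\<lambda>(a, b). Complex a b) ` (\<rat> \<times> \<rat>)"
      by (intro image_eqI[of _ _ "(Re c, Im c)"]) auto
  qed auto
  then show ?thesis by (simp add: countable_rat)
qed

lemma countable_rational_points: "finite I \<Longrightarrow> countable (rational_points I)"
  unfolding rational_points_def by (intro countable_PiE countable_rational_complex)

lemma open_box_subset_closed_box: "open_box I \<alpha> \<beta> \<subseteq> closed_box I \<alpha> \<beta>"
  unfolding open_box_def closed_box_def using box_subset_cbox by (intro PiE_mono) auto

lemma openin_open_box: "finite I \<Longrightarrow> openin (ctop I) (open_box I \<alpha> \<beta>)"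
  unfolding open_box_def by (intro openin_PiE[THEN iffD2]) auto

lemma compactin_closed_box: "compactin (ctop I) (closed_box I \<alpha> \<beta>)"
  unfolding closed_box_def by (simp add: compactin_PiE)

lemma open_box_measurable: "finite I \<Longrightarrow> open_box I \<alpha> \<beta> \<in> sets (cvol I)"
  unfolding open_box_def by (intro sets_PiM_I_finite) auto

lemma rational_box_in_open:
  assumes "finite I" "openin (ctop I) U" "z \<in> U"
  obtains \<alpha> \<beta> where "\<alpha> \<in> rational_points I" "\<beta> \<in> rational_points I"
    "z \<in> open_box I \<alpha> \<beta>" "closed_box I \<alpha> \<beta> \<subseteq> U"
proof -
  have "\<exists>V. (\<forall>i\<in>I. open (V i)) \<and> z \<in> Pi\<^sub>E I V \<and> Pi\<^sub>E I V \<subseteq> U"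
    using assms(2,3) unfolding openin_product_topology_alt by (simp only: open_openin) blast
  then obtain V where V: "\<And>i. i \<in> I \<Longrightarrow> open (V i)" "z \<in> Pi\<^sub>E I V" "Pi\<^sub>E I V \<subseteq> U"
    by blast
  let ?Q = "\<lambda>i p. (Re (fst p) \<in> \<rat> \<and> Im (fst p) \<in> \<rat>) \<and> (Re (snd p) \<in> \<rat> \<and> Im (snd p) \<in> \<rat>) \<and>
    z i \<in> box (fst p) (snd p) \<and> cbox (fst p) (snd p) \<subseteq> V i"
  have "\<exists>p. ?Q i p" if i: "i \<in> I" for i
  proof -
    have "z i \<in> V i" using V(2) i by auto
    then obtain e where e: "e > 0" "cball (z i) e \<subseteq> V i"
      using V(1)[OF i] open_contains_cball by blast
    obtain a b :: complex where ab: "\<And>v. v \<in> Basis \<Longrightarrow> a \<bullet> v \<in> \<rat> \<and> b \<bullet> v \<in> \<rat>" "z i \<in> box a b" "box a b \<subseteq> ball (z i) e"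
      using rational_boxes[OF e(1), of "z i"] by blast
    \<comment> \<open>Passing from the open box to the closed one only keeps it in the closed ball,
      which is why \<open>e\<close> was chosen for \<open>cball\<close>.\<close>
    have "closure (box a b) \<subseteq> closure (ball (z i) e)" using ab(3) by (rule closure_mono)
    moreover have "box a b \<noteq> {}" using ab(2) by blast
    ultimately have "cbox a b \<subseteq> V i" using e closure_box[of a b] by auto
    with ab(2) ab(1)[of 1] ab(1)[of \<i>] show ?thesis
      by (intro exI[of _ "(a, b)"]) (auto simp: Basis_complex_def inner_complex_def)
  qed
  then have "\<forall>i\<in>I. \<exists>p. ?Q i p" by blast
  then obtain f where f: "\<forall>i\<in>I. ?Q i (f i)" by (rule bchoice[THEN exE])
  define a b where "a i = fst (f i)" and "b i = snd (f i)" for i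
  have ab: "\<And>i. i \<in> I \<Longrightarrow> Re (a i) \<in> \<rat> \<and> Im (a i) \<in> \<rat>"
    "\<And>i. i \<in> I \<Longrightarrow> Re (b i) \<in> \<rat> \<and> Im (b i) \<in> \<rat>" "\<And>i. i \<in> I \<Longrightarrow> z i \<in> box (a i) (b i)"
    "\<And>i. i \<in> I \<Longrightarrow> cbox (a i) (b i) \<subseteq> V i" using f by (auto simp: a_def b_def)
  show thesis
  proof (rule that[of "restrict a I" "restrict b I"])
    show "restrict a I \<in> rational_points I" "restrict b I \<in> rational_points I"
      using ab(1,2) by (auto simp: rational_points_def)
    show "z \<in> open_box I (restrict a I) (restrict b I)"
      using ab(3) V(2) by (simp add: open_box_def PiE_iff)
    have "closed_box I (restrict a I) (restrict b I) \<subseteq> Pi\<^sub>E I V"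
      unfolding closed_box_def by (rule PiE_mono) (simp add: ab(4))
    with V(3) show "closed_box I (restrict a I) (restrict b I) \<subseteq> U" by simp
  qed
qed

lemma open_eq_Union_boxes:
  assumes "finite I" "openin (ctop I) U"
  shows "U = (\<Union>(\<alpha>, \<beta>)\<in>{(\<alpha>, \<beta>). \<alpha> \<in> rational_points I \<and> \<beta> \<in> rational_points I \<and> closed_box I \<alpha> \<beta> \<subseteq> U}. open_box I \<alpha> \<beta>)"
  (is "U = ?R")
proof
  show "U \<subseteq> ?R"
  proof
    fix z assume "z \<in> U"
    then obtain \<alpha> \<beta> where "\<alpha> \<in> rational_points I" "\<beta> \<in> rational_points I"
      "z \<in> open_box I \<alpha> \<beta>" "closed_box I \<alpha> \<beta> \<subseteq> U" by (rule rational_box_in_open[OF assms])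
    then show "z \<in> ?R" by (intro UN_I[of "(\<alpha>, \<beta>)"]) auto
  qed
  show "?R \<subseteq> U"
  proof (rule UN_least, clarify)
    fix \<alpha> \<beta> z assume "closed_box I \<alpha> \<beta> \<subseteq> U" "z \<in> open_box I \<alpha> \<beta>"
    then show "z \<in> U" using open_box_subset_closed_box by blast
  qed
qed

lemma countable_box_pairs:
  assumes "finite I"
  shows "countable {(\<alpha>, \<beta>). \<alpha> \<in> rational_points I \<and> \<beta> \<in> rational_points I \<and> P \<alpha> \<beta>}"
  by (rule countable_subset[of _ "rational_points I \<times> rational_points I"])
    (auto simp: countable_rational_points assms)

text \<open>The topology and the sigma-algebra are both products, but defined independently of each
  other. Countably many rational boxes exhaust an open set, and each box is measurable; this ties
  the two together.\<close>

lemma openin_measurable: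
  assumes "finite I" "openin (ctop I) U"
  shows "U \<in> sets (cvol I)"
proof -
  let ?P = "{(\<alpha>, \<beta>). \<alpha> \<in> rational_points I \<and> \<beta> \<in> rational_points I \<and> closed_box I \<alpha> \<beta> \<subseteq> U}"
  have "(\<Union>(\<alpha>, \<beta>)\<in>?P. open_box I \<alpha> \<beta>) \<in> sets (cvol I)"
  proof (rule sets.countable_UN'')
    show "countable ?P" by (rule countable_box_pairs[OF assms(1)])
    show "(case p of (\<alpha>, \<beta>) \<Rightarrow> open_box I \<alpha> \<beta>) \<in> sets (cvol I)" for p
      using open_box_measurable[OF assms(1)] by (cases p) simp
  qed
  then show ?thesis using open_eq_Union_boxes[OF assms] by simp
qed

lemma compactin_measurable:
  assumes "finite I" "compactin (ctop I) K"
  shows "K \<in> sets (cvol I)"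
proof -
  have "Hausdorff_space (ctop I)" by (simp add: Hausdorff_space_product_topology)
  then have "closedin (ctop I) K" using assms(2) by (rule compactin_imp_closedin)
  then have "topspace (ctop I) - K \<in> sets (cvol I)"
    by (intro openin_measurable[OF assms(1)] openin_diff[OF openin_topspace])
  then have "space (cvol I) - (topspace (ctop I) - K) \<in> sets (cvol I)" by blast
  moreover have "space (cvol I) - (topspace (ctop I) - K) = K"
    using compactin_subset_topspace[OF assms(2)] by (auto simp: space_PiM)
  ultimately show ?thesis by simp
qed

lemma continuous_map_measurable:
  assumes "finite I" "continuous_map (ctop I) euclidean \<phi>"
  shows "\<phi> \<in> borel_measurable (cvol I)"
proof (rule borel_measurableI)
  fix S :: "'b set" assume "open S"
  then have "openin (ctop I) {z \<in> topspace (ctop I). \<phi> z \<in> S}"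
    by (intro openin_continuous_map_preimage[OF assms(2)]) simp
  moreover have "\<phi> -` S \<inter> space (cvol I) = {z \<in> topspace (ctop I). \<phi> z \<in> S}"
    by (auto simp: space_PiM)
  ultimately show "\<phi> -` S \<inter> space (cvol I) \<in> sets (cvol I)" using openin_measurable[OF assms(1)] by simp
qed

lemma test_function_measurable:
  "finite I \<Longrightarrow> \<phi> \<in> test_functions I U \<Longrightarrow> \<phi> \<in> borel_measurable (cvol I)"
  by (rule continuous_map_measurable[OF _ C_diff_continuous[OF test_functionsD[of _ _ _ 0]]])

text \<open>Integrability of \<open>g\<close> is available on compact subsets, and the product lives
  on the support of \<open>\<phi>\<close>, where \<open>\<phi>\<close> is bounded.\<close>

lemma test_function_integrable:
  assumes "finite I" "loc_integrable I U g" "\<phi> \<in> test_functions I U"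
  shows "set_integrable (cvol I) U (\<lambda>z. g z * \<phi> z)"
proof -
  obtain K where K: "compactin (ctop I) K" "K \<subseteq> U" "\<And>z. z \<in> (I \<rightarrow>\<^sub>E UNIV) - K \<Longrightarrow> \<phi> z = 0"
    using assms(3) by (auto simp: test_functions_def)
  obtain B where B: "B \<ge> 0" "\<And>z. z \<in> I \<rightarrow>\<^sub>E UNIV \<Longrightarrow> norm (\<phi> z) \<le> B"
    using test_function_bounded[OF assms(3)] by blast
  have gK: "integrable (cvol I) (\<lambda>z. indicator K z *\<^sub>R g z)"
    using assms(2) K(1,2) by (auto simp: loc_integrable_def set_integrable_def)
  have [measurable]: "\<phi> \<in> borel_measurable (cvol I)" using test_function_measurable[OF assms(1,3)] .
  note [measurable] = borel_measurable_integrable[OF gK]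
  have "integrable (cvol I) (\<lambda>z. (indicator K z *\<^sub>R g z) * \<phi> z)"
  proof (rule Bochner_Integration.integrable_bound[where f = "\<lambda>z. B *\<^sub>R (indicator K z *\<^sub>R g z)"])
    show "integrable (cvol I) (\<lambda>z. B *\<^sub>R (indicator K z *\<^sub>R g z))" by (intro integrable_scaleR_right gK)
    show "AE z in cvol I. norm ((indicator K z *\<^sub>R g z) * \<phi> z) \<le> norm (B *\<^sub>R (indicator K z *\<^sub>R g z))"
    proof (rule AE_I2)
      fix z :: "'a point" assume "z \<in> space (cvol I)"
      then have "norm (\<phi> z) \<le> B" using B(2)[of z] by (simp add: space_PiM)
      then show "norm ((indicator K z *\<^sub>R g z) * \<phi> z) \<le> norm (B *\<^sub>R (indicator K z *\<^sub>R g z))"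
        using B(1) by (auto simp: norm_mult indicator_def mult.commute[of _ "norm (\<phi> z)"] intro: mult_right_mono)
    qed
  qed measurable
  moreover have "(indicator K z *\<^sub>R g z) * \<phi> z = indicator U z *\<^sub>R (g z * \<phi> z)" if "z \<in> space (cvol I)" for z
    using that K(2) K(3)[of z] by (auto simp: space_PiM indicator_def)
  ultimately show ?thesis
    unfolding set_integrable_def by (subst Bochner_Integration.integrable_cong[OF refl]) (rule sym)
qed

text \<open>The box cutoffs are test functions that converge to the indicator of the open box and
  vanish off one closed box on which \<open>g\<close> is integrable; dominated convergence carries
  the vanishing over.\<close>

lemma integral_open_box_eq_0:
  assumes "finite I" "loc_integrable I U g" "closed_box I \<alpha> \<beta> \<subseteq> U"
    and zero: "\<And>\<phi>. \<phi> \<in> test_functions I U \<Longrightarrow> (LINT z:U|cvol I. g z * \<phi> z) = 0"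
  shows "(LINT z:open_box I \<alpha> \<beta>|cvol I. g z) = 0"
proof -
  let ?K = "closed_box I \<alpha> \<beta>"
  have gK: "integrable (cvol I) (\<lambda>z. indicator ?K z *\<^sub>R g z)"
    using assms(2,3) compactin_closed_box[of I \<alpha> \<beta>] by (auto simp: loc_integrable_def set_integrable_def)
  have t: "box_cutoff I \<alpha> \<beta> m \<in> test_functions I U" for m
    using box_cutoff_test_function[OF assms(1)] assms(3) by (auto simp: closed_box_def)
  note [measurable] = borel_measurable_integrable[OF gK] test_function_measurable[OF assms(1) t]
    open_box_measurable[OF assms(1), of \<alpha> \<beta>] compactin_measurable[OF assms(1) compactin_closed_box, of \<alpha> \<beta>]
  let ?f = "\<lambda>m z. (indicator ?K z *\<^sub>R g z) * box_cutoff I \<alpha> \<beta> m z"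
  have eq: "indicator ?K z *\<^sub>R g z * (if \<forall>i\<in>I. z i \<in> box (\<alpha> i) (\<beta> i) then 1 else 0) = indicator (open_box I \<alpha> \<beta>) z *\<^sub>R g z"
    if "z \<in> space (cvol I)" for z
  proof -
    have "(\<forall>i\<in>I. z i \<in> box (\<alpha> i) (\<beta> i)) \<longleftrightarrow> z \<in> open_box I \<alpha> \<beta>"
      using that by (auto simp: space_PiM open_box_def PiE_iff)
    then show ?thesis using open_box_subset_closed_box[of I \<alpha> \<beta>] by (auto simp: indicator_def)
  qed
  have "(\<lambda>m. integral\<^sup>L (cvol I) (?f m)) \<longlonglongrightarrow>
      (LINT z|cvol I. indicator (open_box I \<alpha> \<beta>) z *\<^sub>R g z)"
  proof (rule integral_dominated_convergence[where w = "\<lambda>z. norm (indicator ?K z *\<^sub>R g z)"])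
    show "AE z in cvol I. (\<lambda>m. ?f m z) \<longlonglongrightarrow> indicator (open_box I \<alpha> \<beta>) z *\<^sub>R g z"
    proof (rule AE_I2)
      fix z :: "'a point" assume z: "z \<in> space (cvol I)"
      have "(\<lambda>m. ?f m z) \<longlonglongrightarrow> indicator ?K z *\<^sub>R g z * (if \<forall>i\<in>I. z i \<in> box (\<alpha> i) (\<beta> i) then 1 else 0)"
        by (intro tendsto_mult_left box_cutoff_tendsto assms(1))
      then show "(\<lambda>m. ?f m z) \<longlonglongrightarrow> indicator (open_box I \<alpha> \<beta>) z *\<^sub>R g z" unfolding eq[OF z] .
    qed
    show "AE z in cvol I. norm (?f m z) \<le> norm (indicator ?K z *\<^sub>R g z)" for m
      using norm_box_cutoff_le[of I \<alpha> \<beta> m] by (intro AE_I2) (auto simp: norm_mult indicator_def mult_left_le)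
    have "(\<lambda>z. indicator (open_box I \<alpha> \<beta>) z *\<^sub>R (indicator ?K z *\<^sub>R g z)) \<in> borel_measurable (cvol I)" by measurable
    moreover have "(\<lambda>z. indicator (open_box I \<alpha> \<beta>) z *\<^sub>R (indicator ?K z *\<^sub>R g z)) = (\<lambda>z. indicator (open_box I \<alpha> \<beta>) z *\<^sub>R g z)"
      using open_box_subset_closed_box[of I \<alpha> \<beta>] by (auto simp: fun_eq_iff indicator_def)
    ultimately show "(\<lambda>z. indicator (open_box I \<alpha> \<beta>) z *\<^sub>R g z) \<in> borel_measurable (cvol I)" by simp
    show "?f m \<in> borel_measurable (cvol I)" for m by measurable
    show "integrable (cvol I) (\<lambda>z. norm (indicator ?K z *\<^sub>R g z))" by (rule integrable_norm[OF gK])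
  qed
  moreover have "integral\<^sup>L (cvol I) (?f m) = 0" for m
  proof -
    have "?f m z = indicator U z *\<^sub>R (g z * box_cutoff I \<alpha> \<beta> m z)" if "z \<in> space (cvol I)" for z
    proof (cases "z \<in> ?K")
      case False
      then have "\<not> (\<forall>i\<in>I. z i \<in> box (\<alpha> i) (\<beta> i))"
        using that subsetD[OF open_box_subset_closed_box, of z I \<alpha> \<beta>]
        by (simp add: space_PiM open_box_def PiE_iff) blast
      then have "box_cutoff I \<alpha> \<beta> m z = 0" by (rule box_cutoff_eq_0[OF assms(1)])
      then show ?thesis by simp
    next
      case True
      then show ?thesis using assms(3) by (auto simp: indicator_def)
    qed
    then have "integral\<^sup>L (cvol I) (?f m) = (LINT z:U|cvol I. g z * box_cutoff I \<alpha> \<beta> m z)"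
      unfolding set_lebesgue_integral_def by (intro Bochner_Integration.integral_cong) auto
    then show ?thesis using zero[OF t] by simp
  qed
  ultimately show ?thesis by (simp add: set_lebesgue_integral_def LIMSEQ_const_iff)
qed

lemma box_inter_box:
  "box a b \<inter> box c d = box (Complex (max (Re a) (Re c)) (max (Im a) (Im c))) (Complex (min (Re b) (Re d)) (min (Im b) (Im d)))"
  by (auto simp: in_box_complex_iff)

lemma cbox_inter_cbox:
  "cbox a b \<inter> cbox c d = cbox (Complex (max (Re a) (Re c)) (max (Im a) (Im c))) (Complex (min (Re b) (Re d)) (min (Im b) (Im d)))"
  by (auto simp: in_cbox_complex_iff)

text \<open>The closed boxes are controlled as well because integrals are known to vanish only over
  boxes whose closed box stays inside the region considered.\<close>

lemma open_box_inter_open_box: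
  obtains \<alpha>'' \<beta>'' where "open_box I \<alpha> \<beta> \<inter> open_box I \<alpha>' \<beta>' = open_box I \<alpha>'' \<beta>''"
    "closed_box I \<alpha>'' \<beta>'' \<subseteq> closed_box I \<alpha> \<beta>"
proof
  let ?a = "\<lambda>i. Complex (max (Re (\<alpha> i)) (Re (\<alpha>' i))) (max (Im (\<alpha> i)) (Im (\<alpha>' i)))"
  let ?b = "\<lambda>i. Complex (min (Re (\<beta> i)) (Re (\<beta>' i))) (min (Im (\<beta> i)) (Im (\<beta>' i)))"
  show "open_box I \<alpha> \<beta> \<inter> open_box I \<alpha>' \<beta>' = open_box I ?a ?b"
    unfolding open_box_def box_inter_box[symmetric] by auto
  show "closed_box I ?a ?b \<subseteq> closed_box I \<alpha> \<beta>"
    unfolding closed_box_def cbox_inter_cbox[symmetric] by (intro PiE_mono) auto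
qed

lemma sigma_finite_cvol:
  assumes "finite I" shows "sigma_finite_measure (cvol I)"
proof -
  interpret product_sigma_finite "\<lambda>_. lborel :: complex measure" ..
  show ?thesis by (rule sigma_finite[OF assms])
qed

text \<open>Provides a generator stable under intersection, as induction over the sigma-algebra
  requires.\<close>

lemma sets_cvol:
  assumes "finite I"
  shows "sets (cvol I) = sigma_sets (I \<rightarrow>\<^sub>E UNIV) {open_box I \<alpha> \<beta> | \<alpha> \<beta>. True}"
proof -
  let ?E = "\<lambda>i::'a. range (\<lambda>(a, b). box a b :: complex set)"
  let ?S = "range (\<lambda>m. box (Complex (- real m) (- real m)) (Complex (real m) (real m)))"
  \<comment> \<open>In each factor the whole plane must be a countable union of generating boxes;
    open squares of half-width \<open>m\<close> serve.\<close>
  have cover: "\<exists>S\<subseteq>?E i. countable S \<and> UNIV = \<Union>S" for i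
  proof (intro exI[of _ ?S] conjI)
    show "UNIV = \<Union>?S"
    proof (intro equalityI subsetI)
      fix c :: complex
      obtain m where m: "\<bar>Re c\<bar> + \<bar>Im c\<bar> < real m" using reals_Archimedean2 by blast
      then have "c \<in> box (Complex (- real m) (- real m)) (Complex (real m) (real m))"
        unfolding in_box_complex_iff by auto
      then show "c \<in> \<Union>?S" by blast
    qed simp
  qed auto
  have "sets (cvol I) = sets (Pi\<^sub>M I (\<lambda>_. sigma UNIV (range (\<lambda>(a, b). box a b :: complex set))))"
    by (intro sets_PiM_cong) (simp_all add: borel_eq_box)
  also have "\<dots> = sets (sigma (I \<rightarrow>\<^sub>E UNIV) {{f\<in>(I \<rightarrow>\<^sub>E UNIV). \<forall>i\<in>j. f i \<in> A i} | A j. j \<in> {I} \<and> A \<in> Pi j ?E})"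
    by (rule sets_PiM_sigma) (use cover assms in auto)
  also have "{{f\<in>(I \<rightarrow>\<^sub>E UNIV). \<forall>i\<in>j. f i \<in> A i} | A j. j \<in> {I} \<and> A \<in> Pi j ?E} = {open_box I \<alpha> \<beta> | \<alpha> \<beta>. True}"
  proof (intro set_eqI iffI)
    fix X assume "X \<in> {{f\<in>(I \<rightarrow>\<^sub>E UNIV). \<forall>i\<in>j. f i \<in> A i} | A j. j \<in> {I} \<and> A \<in> Pi j ?E}"
    then obtain A where A: "X = {f\<in>(I \<rightarrow>\<^sub>E UNIV). \<forall>i\<in>I. f i \<in> A i}" "A \<in> Pi I ?E" by auto
    then have "\<forall>i\<in>I. \<exists>a b. A i = box a b" by fastforce
    then obtain a b where "\<And>i. i \<in> I \<Longrightarrow> A i = box (a i) (b i)" by metis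
    then have "X = open_box I a b" unfolding A open_box_def by auto
    then show "X \<in> {open_box I \<alpha> \<beta> | \<alpha> \<beta>. True}" by blast
  next
    fix X assume "X \<in> {open_box I \<alpha> \<beta> | \<alpha> \<beta>. True}"
    then obtain a b where X: "X = open_box I a b" by blast
    have 1: "X = {f\<in>(I \<rightarrow>\<^sub>E UNIV). \<forall>i\<in>I. f i \<in> box (a i) (b i)}" unfolding X open_box_def by auto
    have 2: "(\<lambda>i. box (a i) (b i)) \<in> Pi I ?E" by auto
    show "X \<in> {{f\<in>(I \<rightarrow>\<^sub>E UNIV). \<forall>i\<in>j. f i \<in> A i} | A j. j \<in> {I} \<and> A \<in> Pi j ?E}"
      by (rule CollectI, rule exI[of _ "\<lambda>i. box (a i) (b i)"], rule exI[of _ I])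
        (intro conjI singletonI 1 2)
  qed
  finally show ?thesis by (subst (asm) sets_measure_of) (auto simp: open_box_def)
qed

text \<open>The measurable sets over which the cut-off function has integral 0 contain an
  intersection-stable generator and are closed under complements and countable disjoint unions, so
  they are all measurable sets. A function with this property is zero a.e.\<close>

lemma AE_eq_0_on_open_box:
  fixes g :: "'i point \<Rightarrow> complex"
  assumes I: "finite I" and "set_integrable (cvol I) (open_box I \<alpha> \<beta>) g"
    and zero: "\<And>\<alpha>' \<beta>'. closed_box I \<alpha>' \<beta>' \<subseteq> closed_box I \<alpha> \<beta> \<Longrightarrow> (LINT z:open_box I \<alpha>' \<beta>'|cvol I. g z) = 0"
  shows "AE z in cvol I. z \<in> open_box I \<alpha> \<beta> \<longrightarrow> g z = 0"
proof -
  let ?B = "open_box I \<alpha> \<beta>" and ?G = "{open_box I \<alpha> \<beta> | \<alpha> \<beta>. True}"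
  let ?g = "\<lambda>z. indicator ?B z *\<^sub>R g z"
  have int: "integrable (cvol I) ?g" using assms(2) by (simp add: set_integrable_def)
  have inter: "indicator A z *\<^sub>R ?g z = indicator (A \<inter> ?B) z *\<^sub>R g z" for A z by (auto simp: indicator_def)
  have intA: "integrable (cvol I) (\<lambda>z. indicator A z *\<^sub>R ?g z)" if "A \<in> sets (cvol I)" for A
    by (rule integrable_mult_indicator[OF that int])
  have sigma: "sigma_sets (I \<rightarrow>\<^sub>E UNIV) ?G = sets (cvol I)" using sets_cvol[OF I] by simp
  have "AE z in cvol I. ?g z = 0"
  proof (rule sigma_finite_measure.density_zero[OF sigma_finite_cvol[OF I] int])
    fix A assume "A \<in> sets (cvol I)"
    then have A: "A \<in> sigma_sets (I \<rightarrow>\<^sub>E UNIV) ?G" using sets_cvol[OF I] by blast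
    have "Int_stable ?G"
      unfolding Int_stable_def by (auto, metis open_box_inter_open_box)
    moreover have "?G \<subseteq> Pow (I \<rightarrow>\<^sub>E UNIV)" by (auto simp: open_box_def)
    ultimately show "set_lebesgue_integral (cvol I) A ?g = 0"
      using A
    proof (induction rule: sigma_sets_induct_disjoint)
      case (basic A)
      then obtain \<alpha>1 \<beta>1 where A: "A = open_box I \<alpha>1 \<beta>1" by blast
      obtain \<alpha>2 \<beta>2 where 2: "?B \<inter> A = open_box I \<alpha>2 \<beta>2" "closed_box I \<alpha>2 \<beta>2 \<subseteq> closed_box I \<alpha> \<beta>"
        unfolding A using open_box_inter_open_box by metis
      have "set_lebesgue_integral (cvol I) A ?g = (LINT z:open_box I \<alpha>2 \<beta>2|cvol I. g z)"
        unfolding set_lebesgue_integral_def inter 2(1)[symmetric] by (simp add: Int_commute)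
      then show ?case using zero[OF 2(2)] by simp
    next
      case empty
      then show ?case by (simp add: set_lebesgue_integral_def)
    next
      case (compl A)
      then have A: "A \<in> sets (cvol I)" using sigma by blast
      have "set_lebesgue_integral (cvol I) ((I \<rightarrow>\<^sub>E UNIV) - A) ?g = (LINT z|cvol I. ?g z - indicator A z *\<^sub>R ?g z)"
        unfolding set_lebesgue_integral_def
        by (intro Bochner_Integration.integral_cong) (auto simp: space_PiM indicator_def)
      also have "\<dots> = (LINT z:?B|cvol I. g z) - set_lebesgue_integral (cvol I) A ?g"
        unfolding set_lebesgue_integral_def using int intA[OF A] by simp
      finally show ?case using compl zero[OF order_refl] by simp
    next
      case (union A)
      then have A: "A i \<in> sets (cvol I)" for i using sigma by blast
      have "set_lebesgue_integral (cvol I) (\<Union>i. A i) ?g = (\<Sum>i. set_lebesgue_integral (cvol I) (A i) ?g)"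
      proof (rule lebesgue_integral_countable_add)
        show "A i \<in> sets (cvol I)" for i by (rule A)
        show "A i \<inter> A j = {}" if "i \<noteq> j" for i j using union(1) that by (auto simp: disjoint_family_on_def)
        show "set_integrable (cvol I) (\<Union>i. A i) ?g" unfolding set_integrable_def using A by (intro intA) auto
      qed
      then show ?case using union by simp
    qed
  qed
  then show ?thesis by eventually_elim auto
qed

text \<open>Local integrability allows the vanishing to be shown only box by box; countably many
  rational boxes leave a single null set.\<close>

lemma fundamental_lemma:
  assumes "finite I" "openin (ctop I) U" "loc_integrable I U g"
    and zero: "\<And>\<phi>. \<phi> \<in> test_functions I U \<Longrightarrow> (LINT z:U|cvol I. g z * \<phi> z) = 0"
  shows "AE z in cvol I. z \<in> U \<longrightarrow> g z = 0"
proof -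
  let ?P = "{(\<alpha>, \<beta>). \<alpha> \<in> rational_points I \<and> \<beta> \<in> rational_points I \<and> closed_box I \<alpha> \<beta> \<subseteq> U}"
  have "AE z in cvol I. \<forall>p\<in>?P. z \<in> open_box I (fst p) (snd p) \<longrightarrow> g z = 0"
  proof (subst AE_ball_countable[OF countable_box_pairs[OF assms(1)]], rule ballI)
    fix p assume "p \<in> ?P"
    then have p: "closed_box I (fst p) (snd p) \<subseteq> U" by auto
    show "AE z in cvol I. z \<in> open_box I (fst p) (snd p) \<longrightarrow> g z = 0"
    proof (rule AE_eq_0_on_open_box[OF assms(1)])
      have "set_integrable (cvol I) (closed_box I (fst p) (snd p)) g"
        using assms(3) compactin_closed_box[of I "fst p" "snd p"] p unfolding loc_integrable_def by blast
      then show "set_integrable (cvol I) (open_box I (fst p) (snd p)) g"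
        by (rule set_integrable_subset) (auto intro: open_box_measurable assms(1) open_box_subset_closed_box[THEN subsetD])
      show "(LINT z:open_box I \<alpha>' \<beta>'|cvol I. g z) = 0" if "closed_box I \<alpha>' \<beta>' \<subseteq> closed_box I (fst p) (snd p)" for \<alpha>' \<beta>'
        using integral_open_box_eq_0[OF assms(1,3) _ zero] that p by blast
    qed
  qed
  then show ?thesis
  proof eventually_elim
    case (elim z)
    show ?case
    proof
      assume "z \<in> U"
      then obtain p where "p \<in> ?P" "z \<in> open_box I (fst p) (snd p)"
        by (subst (asm) open_eq_Union_boxes[OF assms(1,2)]) fastforce
      then show "g z = 0" using elim by blast
    qed
  qed
qed

section \<open>Equality of mixed partial derivatives, and commuting \<open>dbar\<close>
  operators\<close>

section \<open>Symmetry of second derivatives\<close>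

text \<open>The second difference of \<open>G\<close> over the square of side \<open>h\<close> is
  evaluated by the mean value theorem in both orders. This yields two points of the square at which
  \<open>G12\<close> and \<open>G21\<close> agree; let \<open>h\<close> tend to 0 and use
  continuity.\<close>

lemma mixed_partials_real:
  fixes G :: "real \<Rightarrow> real \<Rightarrow> real"
  assumes G1: "\<And>s t. ((\<lambda>s. G s t) has_real_derivative G1 s t) (at s)"
    and G2: "\<And>s t. ((\<lambda>t. G s t) has_real_derivative G2 s t) (at t)"
    and G12: "\<And>s t. ((\<lambda>t. G1 s t) has_real_derivative G12 s t) (at t)"
    and G21: "\<And>s t. ((\<lambda>s. G2 s t) has_real_derivative G21 s t) (at s)"
    and c12: "continuous_on UNIV (\<lambda>p. G12 (fst p) (snd p))"
    and c21: "continuous_on UNIV (\<lambda>p. G21 (fst p) (snd p))"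
  shows "G12 0 0 = G21 0 0"
proof -
  \<comment> \<open>Both intermediate points are packed into one \<open>q\<close>, so that a single
    choice over \<open>h = 1/(m+1)\<close> produces both sequences.\<close>
  have ex: "\<exists>q. 0 < fst (fst q) \<and> fst (fst q) < h \<and> 0 < snd (fst q) \<and> snd (fst q) < h \<and>
      0 < fst (snd q) \<and> fst (snd q) < h \<and> 0 < snd (snd q) \<and> snd (snd q) < h \<and>
      G12 (fst (fst q)) (snd (fst q)) = G21 (fst (snd q)) (snd (snd q))" if h: "h > 0" for h
  proof -
    have d1: "DERIV (\<lambda>s. G s h - G s 0) s :> G1 s h - G1 s 0" for s
      by (intro DERIV_diff G1)
    obtain \<sigma> where \<sigma>: "0 < \<sigma>" "\<sigma> < h" "(G h h - G h 0) - (G 0 h - G 0 0) = (h - 0) * (G1 \<sigma> h - G1 \<sigma> 0)"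
      using MVT2[OF h, of "\<lambda>s. G s h - G s 0" "\<lambda>s. G1 s h - G1 s 0"] d1 by blast
    obtain \<tau> where \<tau>: "0 < \<tau>" "\<tau> < h" "G1 \<sigma> h - G1 \<sigma> 0 = (h - 0) * G12 \<sigma> \<tau>"
      using MVT2[OF h, of "\<lambda>t. G1 \<sigma> t" "\<lambda>t. G12 \<sigma> t"] G12 by blast
    have d2: "DERIV (\<lambda>t. G h t - G 0 t) t :> G2 h t - G2 0 t" for t
      by (intro DERIV_diff G2)
    obtain \<tau>' where \<tau>': "0 < \<tau>'" "\<tau>' < h" "(G h h - G 0 h) - (G h 0 - G 0 0) = (h - 0) * (G2 h \<tau>' - G2 0 \<tau>')"
      using MVT2[OF h, of "\<lambda>t. G h t - G 0 t" "\<lambda>t. G2 h t - G2 0 t"] d2 by blast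
    obtain \<sigma>' where \<sigma>': "0 < \<sigma>'" "\<sigma>' < h" "G2 h \<tau>' - G2 0 \<tau>' = (h - 0) * G21 \<sigma>' \<tau>'"
      using MVT2[OF h, of "\<lambda>s. G2 s \<tau>'" "\<lambda>s. G21 s \<tau>'"] G21 by blast
    have "G h h - G h 0 - (G 0 h - G 0 0) = h * (h * G12 \<sigma> \<tau>)" using \<sigma>(3) \<tau>(3) by simp
    moreover have "G h h - G 0 h - (G h 0 - G 0 0) = h * (h * G21 \<sigma>' \<tau>')" using \<tau>'(3) \<sigma>'(3) by simp
    ultimately have "h * (h * G12 \<sigma> \<tau>) = h * (h * G21 \<sigma>' \<tau>')" by linarith
    then have "G12 \<sigma> \<tau> = G21 \<sigma>' \<tau>'" using h by simp
    with \<sigma> \<tau> \<sigma>' \<tau>' show ?thesis by (intro exI[of _ "((\<sigma>, \<tau>), (\<sigma>', \<tau>'))"]) simp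
  qed
  have "\<forall>m::nat. \<exists>q. 0 < fst (fst q) \<and> fst (fst q) < inverse (real (Suc m)) \<and> 0 < snd (fst q) \<and> snd (fst q) < inverse (real (Suc m)) \<and>
      0 < fst (snd q) \<and> fst (snd q) < inverse (real (Suc m)) \<and> 0 < snd (snd q) \<and> snd (snd q) < inverse (real (Suc m)) \<and>
      G12 (fst (fst q)) (snd (fst q)) = G21 (fst (snd q)) (snd (snd q))"
    by (intro allI ex) simp
  from choice[OF this] obtain q where q: "\<And>m::nat. 0 < fst (fst (q m)) \<and> fst (fst (q m)) < inverse (real (Suc m)) \<and>
      0 < snd (fst (q m)) \<and> snd (fst (q m)) < inverse (real (Suc m)) \<and>
      0 < fst (snd (q m)) \<and> fst (snd (q m)) < inverse (real (Suc m)) \<and>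
      0 < snd (snd (q m)) \<and> snd (snd (q m)) < inverse (real (Suc m)) \<and>
      G12 (fst (fst (q m))) (snd (fst (q m))) = G21 (fst (snd (q m))) (snd (snd (q m)))" by blast
  have sq: "r \<longlonglongrightarrow> 0" if "\<And>m. 0 < r m \<and> r m < inverse (real (Suc m))" for r :: "nat \<Rightarrow> real"
    by (rule tendsto_sandwich[OF _ _ tendsto_const LIMSEQ_inverse_real_of_nat])
      (use that in \<open>auto intro!: always_eventually less_imp_le\<close>)
  have l1: "(\<lambda>m. (fst (fst (q m)), snd (fst (q m)))) \<longlonglongrightarrow> (0, 0)"
    by (intro tendsto_Pair sq) (use q in blast)+
  have l2: "(\<lambda>m. (fst (snd (q m)), snd (snd (q m)))) \<longlonglongrightarrow> (0, 0)"
    by (intro tendsto_Pair sq) (use q in blast)+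
  have "(\<lambda>m. G12 (fst (fst (q m))) (snd (fst (q m)))) \<longlonglongrightarrow> G12 0 0"
    using continuous_on_tendsto_compose[OF c12 l1] by simp
  moreover have "(\<lambda>m. G21 (fst (snd (q m))) (snd (snd (q m)))) \<longlonglongrightarrow> G21 0 0"
    using continuous_on_tendsto_compose[OF c21 l2] by simp
  ultimately show ?thesis using q LIMSEQ_unique by simp
qed

text \<open>The mean value theorem fails for complex values, so real and imaginary parts are treated
  separately.\<close>

lemma mixed_partials_complex:
  fixes G :: "real \<Rightarrow> real \<Rightarrow> complex"
  assumes "\<And>s t. ((\<lambda>s. G s t) has_vector_derivative G1 s t) (at s)"
    and "\<And>s t. ((\<lambda>t. G s t) has_vector_derivative G2 s t) (at t)"
    and "\<And>s t. ((\<lambda>t. G1 s t) has_vector_derivative G12 s t) (at t)"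
    and "\<And>s t. ((\<lambda>s. G2 s t) has_vector_derivative G21 s t) (at s)"
    and "continuous_on UNIV (\<lambda>p. G12 (fst p) (snd p))"
    and "continuous_on UNIV (\<lambda>p. G21 (fst p) (snd p))"
  shows "G12 0 0 = G21 0 0"
proof (rule complex_eqI)
  have *: "((\<lambda>s. \<rho> (f s)) has_real_derivative \<rho> f') (at s)"
    if "bounded_linear \<rho>" "(f has_vector_derivative f') (at s)" for \<rho> and f :: "real \<Rightarrow> complex" and f' s
    using bounded_linear.has_vector_derivative[OF that] by (simp add: has_real_derivative_iff_has_vector_derivative)
  show "Re (G12 0 0) = Re (G21 0 0)"
    by (rule mixed_partials_real[where G = "\<lambda>s t. Re (G s t)" and ?G1.0 = "\<lambda>s t. Re (G1 s t)" and
          ?G2.0 = "\<lambda>s t. Re (G2 s t)"])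
      (intro * bounded_linear_Re assms continuous_on_Re)+
  show "Im (G12 0 0) = Im (G21 0 0)"
    by (rule mixed_partials_real[where G = "\<lambda>s t. Im (G s t)" and ?G1.0 = "\<lambda>s t. Im (G1 s t)" and
          ?G2.0 = "\<lambda>s t. Im (G2 s t)"])
      (intro * bounded_linear_Im assms continuous_on_Im)+
qed

text \<open>\<open>C_diff\<close> differentiates at parameter 0 only. Moving the base point along
  the line gives the derivative at every parameter, as the mean value theorem requires.\<close>

lemma C_diff_has_derivative_at:
  assumes "C_diff (Suc r) I \<phi>" "i \<in> I" "a \<in> {1, \<i>}" "z \<in> I \<rightarrow>\<^sub>E UNIV"
  shows "((\<lambda>s::real. \<phi> (z(i := z i + of_real s * a))) has_vector_derivative
    dir_deriv i a \<phi> (z(i := z i + of_real t * a))) (at t)"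
proof -
  let ?y = "z(i := z i + of_real t * a)"
  have y: "?y \<in> I \<rightarrow>\<^sub>E UNIV" using assms by (auto simp: PiE_iff extensional_def)
  have "((\<lambda>s::real. s - t) has_vector_derivative 1) (at t)"
    by (auto intro!: derivative_eq_intros)
  moreover have "((\<lambda>s::real. \<phi> (?y(i := ?y i + of_real s * a))) has_vector_derivative dir_deriv i a \<phi> ?y) (at (t - t))"
    using C_diff_has_derivative[OF assms(1-3) y] by simp
  ultimately have "(((\<lambda>s::real. \<phi> (?y(i := ?y i + of_real s * a))) \<circ> (\<lambda>s. s - t)) has_vector_derivative
      1 *\<^sub>R dir_deriv i a \<phi> ?y) (at t)"
    by (rule vector_diff_chain_at)
  moreover have "((\<lambda>s::real. \<phi> (?y(i := ?y i + of_real s * a))) \<circ> (\<lambda>s. s - t)) = (\<lambda>s. \<phi> (z(i := z i + of_real s * a)))"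
    by (auto simp: fun_eq_iff algebra_simps intro!: arg_cong[where f = \<phi>])
  ultimately show ?thesis by simp
qed

lemma continuous_map_plane:
  assumes "z \<in> I \<rightarrow>\<^sub>E UNIV" "i \<in> I" "l \<in> I"
  shows "continuous_map euclidean (ctop I)
    (\<lambda>p::real \<times> real. z(i := z i + of_real (fst p) * a, l := z l + of_real (snd p) * b))"
  unfolding continuous_map_componentwise
proof (intro conjI ballI)
  show "(\<lambda>p::real \<times> real. z(i := z i + of_real (fst p) * a, l := z l + of_real (snd p) * b)) ` topspace euclidean
      \<subseteq> extensional I"
    using assms by (auto simp: PiE_iff extensional_def)
  show "continuous_map euclidean euclidean
      (\<lambda>p::real \<times> real. (z(i := z i + of_real (fst p) * a, l := z l + of_real (snd p) * b)) m)" for m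
    by (cases "m = i"; cases "m = l") (auto intro!: continuous_intros)
qed

text \<open>The function is restricted to the real plane through \<open>z\<close> in the two
  directions. Distinct labels make the two shifts independent; for equal labels the commutation of
  \<open>dbar\<close> is trivial.\<close>

lemma dir_deriv_commute:
  assumes \<phi>: "C_diff (Suc (Suc 0)) I \<phi>" and il: "i \<in> I" "l \<in> I" "i \<noteq> l"
    and ab: "a \<in> {1, \<i>}" "b \<in> {1, \<i>}" and z: "z \<in> I \<rightarrow>\<^sub>E UNIV"
  shows "dir_deriv i a (dir_deriv l b \<phi>) z = dir_deriv l b (dir_deriv i a \<phi>) z"
proof -
  define P where "P s t = z(i := z i + of_real s * a, l := z l + of_real t * b)" for s t :: real
  have z': "z(l := c) \<in> I \<rightarrow>\<^sub>E UNIV" "z(i := c) \<in> I \<rightarrow>\<^sub>E UNIV" for c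
    using z il by (auto simp: PiE_iff extensional_def)
  have Pi: "(z(l := z l + of_real t * b))(i := (z(l := z l + of_real t * b)) i + of_real s * a) = P s t"
    and Pl: "(z(i := z i + of_real s * a))(l := (z(i := z i + of_real s * a)) l + of_real t * b) = P s t" for s t
    using il by (auto simp: P_def fun_eq_iff)
  have di: "((\<lambda>s. \<psi> (P s t)) has_vector_derivative dir_deriv i a \<psi> (P s t)) (at s)"
    and dl: "((\<lambda>t. \<psi> (P s t)) has_vector_derivative dir_deriv l b \<psi> (P s t)) (at t)"
    if "C_diff (Suc 0) I \<psi>" for \<psi> s t
    using C_diff_has_derivative_at[OF that il(1) ab(1) z'(1), of "z l + of_real t * b" s]
      C_diff_has_derivative_at[OF that il(2) ab(2) z'(2), of "z i + of_real s * a" t]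
    unfolding Pi Pl by auto
  have 0: "P 0 0 = z" by (simp add: P_def)
  note \<phi>' = C_diff_Suc_imp[OF \<phi>]
  note \<phi>i = C_diff_dir_deriv[OF \<phi> il(1) ab(1)]
  note \<phi>l = C_diff_dir_deriv[OF \<phi> il(2) ab(2)]
  have c: "continuous_on UNIV (\<lambda>p. \<psi> (P (fst p) (snd p)))" if "continuous_map (ctop I) euclidean \<psi>" for \<psi> :: "'a point \<Rightarrow> complex"
    using continuous_map_compose[OF continuous_map_plane[OF z il(1,2), of a b] that]
    by (simp add: o_def P_def)
  have "dir_deriv l b (dir_deriv i a \<phi>) (P 0 0) = dir_deriv i a (dir_deriv l b \<phi>) (P 0 0)"
  proof (rule mixed_partials_complex[where G = "\<lambda>s t. \<phi> (P s t)" and ?G1.0 = "\<lambda>s t. dir_deriv i a \<phi> (P s t)"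
        and ?G2.0 = "\<lambda>s t. dir_deriv l b \<phi> (P s t)" and ?G12.0 = "\<lambda>s t. dir_deriv l b (dir_deriv i a \<phi>) (P s t)"
        and ?G21.0 = "\<lambda>s t. dir_deriv i a (dir_deriv l b \<phi>) (P s t)"])
    show "((\<lambda>s. \<phi> (P s t)) has_vector_derivative dir_deriv i a \<phi> (P s t)) (at s)" for s t by (rule di[OF \<phi>'])
    show "((\<lambda>t. \<phi> (P s t)) has_vector_derivative dir_deriv l b \<phi> (P s t)) (at t)" for s t by (rule dl[OF \<phi>'])
    show "((\<lambda>t. dir_deriv i a \<phi> (P s t)) has_vector_derivative dir_deriv l b (dir_deriv i a \<phi>) (P s t)) (at t)" for s t
      by (rule dl[OF \<phi>i])
    show "((\<lambda>s. dir_deriv l b \<phi> (P s t)) has_vector_derivative dir_deriv i a (dir_deriv l b \<phi>) (P s t)) (at s)" for s t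
      by (rule di[OF \<phi>l])
    show "continuous_on UNIV (\<lambda>p. dir_deriv l b (dir_deriv i a \<phi>) (P (fst p) (snd p)))"
      by (intro c C_diff_continuous[OF C_diff_dir_deriv[OF \<phi>i il(2) ab(2)]])
    show "continuous_on UNIV (\<lambda>p. dir_deriv i a (dir_deriv l b \<phi>) (P (fst p) (snd p)))"
      by (intro c C_diff_continuous[OF C_diff_dir_deriv[OF \<phi>l il(1) ab(1)]])
  qed
  then show ?thesis by (simp add: 0)
qed

lemma dbar_commute:
  assumes \<phi>: "C_diff (Suc (Suc 0)) I \<phi>" and il: "i \<in> I" "l \<in> I" and z: "z \<in> I \<rightarrow>\<^sub>E UNIV"
  shows "dbar i (dbar l \<phi>) z = dbar l (dbar i \<phi>) z"
proof (cases "i = l")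
  case False
  have expand: "dir_deriv m a (dbar m' \<phi>) z =
      (1/2) * dir_deriv m a (dir_deriv m' 1 \<phi>) z + (\<i>/2) * dir_deriv m a (dir_deriv m' \<i> \<phi>) z"
    if "m \<in> I" "m' \<in> I" "a \<in> {1, \<i>}" for m m' a
  proof -
    have "dbar m' \<phi> = (\<lambda>z. (1/2) * dir_deriv m' 1 \<phi> z + (\<i>/2) * dir_deriv m' \<i> \<phi> z)"
      by (auto simp: dbar_def fun_eq_iff add_divide_distrib)
    then show ?thesis
      using dir_deriv_affine[OF C_diff_dir_deriv[OF \<phi> that(2)] C_diff_dir_deriv[OF \<phi> that(2)] that(1,3) z, of 1 \<i> "1/2" "\<i>/2"]
      by simp
  qed
  have sw: "dir_deriv i a (dir_deriv l b \<phi>) z = dir_deriv l b (dir_deriv i a \<phi>) z" if "a \<in> {1, \<i>}" "b \<in> {1, \<i>}" for a b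
    by (rule dir_deriv_commute[OF \<phi> il False that z])
  show ?thesis
    unfolding dbar_def[of i "dbar l \<phi>"] dbar_def[of l "dbar i \<phi>"]
    using il by (simp add: expand sw field_simps)
qed simp

section \<open>Weak derivatives: linearity, uniqueness, composition, closedness\<close>

section \<open>Weak derivatives\<close>

lemma loc_integrable_add:
  "loc_integrable I U u \<Longrightarrow> loc_integrable I U v \<Longrightarrow> loc_integrable I U (\<lambda>z. u z + v z)"
  unfolding loc_integrable_def by (auto intro: set_integral_add)

lemma loc_integrable_mult:
  "loc_integrable I U u \<Longrightarrow> loc_integrable I U (\<lambda>z. c * u z)"
  unfolding loc_integrable_def by (auto intro: set_integrable_mult_right)

lemma loc_integrable_0: "loc_integrable I U (\<lambda>_. 0)"
  by (simp add: loc_integrable_def set_integrable_def)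

lemma foldr_dbar_test_function:
  "\<phi> \<in> test_functions I U \<Longrightarrow> set is \<subseteq> I \<Longrightarrow> foldr dbar is \<phi> \<in> test_functions I U"
  by (induction "is") (auto intro: dbar_test_function)

lemma has_weak_dbarD:
  assumes "has_weak_dbar I U is u g"
  shows "loc_integrable I U u" "loc_integrable I U g"
    and "\<phi> \<in> test_functions I U \<Longrightarrow>
      (LINT z:U|cvol I. u z * foldr dbar is \<phi> z) = (-1) ^ length is * (LINT z:U|cvol I. g z * \<phi> z)"
  using assms by (auto simp: has_weak_dbar_def)

lemma integral_test_add:
  assumes "finite I" "loc_integrable I U u" "loc_integrable I U v" "\<phi> \<in> test_functions I U"
  shows "(LINT z:U|cvol I. (u z + v z) * \<phi> z) = (LINT z:U|cvol I. u z * \<phi> z) + (LINT z:U|cvol I. v z * \<phi> z)"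
  using set_integral_add(2)[OF test_function_integrable[OF assms(1,2,4)] test_function_integrable[OF assms(1,3,4)]]
  by (simp add: distrib_right)

lemma integral_test_mult:
  "(LINT z:U|cvol I. (c * u z) * \<phi> z) = c * (LINT z:U|cvol I. u z * \<phi> (z :: 'i point) :: complex)"
  by (simp add: mult.assoc)

lemma integral_test_cong:
  assumes "finite I" "loc_integrable I U u" "loc_integrable I U v" "\<phi> \<in> test_functions I U"
    and "AE z in cvol I. z \<in> U \<longrightarrow> u z = v z"
  shows "(LINT z:U|cvol I. u z * \<phi> z) = (LINT z:U|cvol I. v z * \<phi> z)"
  unfolding set_lebesgue_integral_def
proof (rule integral_cong_AE)
  show "(\<lambda>z. indicator U z *\<^sub>R (u z * \<phi> z)) \<in> borel_measurable (cvol I)"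
    using test_function_integrable[OF assms(1,2,4)]
    unfolding set_integrable_def by (rule borel_measurable_integrable)
  show "(\<lambda>z. indicator U z *\<^sub>R (v z * \<phi> z)) \<in> borel_measurable (cvol I)"
    using test_function_integrable[OF assms(1,3,4)]
    unfolding set_integrable_def by (rule borel_measurable_integrable)
  show "AE z in cvol I. indicator U z *\<^sub>R (u z * \<phi> z) = indicator U z *\<^sub>R (v z * \<phi> z)"
    using assms(5) by eventually_elim (auto simp: indicator_def)
qed

lemma has_weak_dbar_add:
  assumes "finite I" "set is \<subseteq> I" "has_weak_dbar I U is u g" "has_weak_dbar I U is v h"
  shows "has_weak_dbar I U is (\<lambda>z. u z + v z) (\<lambda>z. g z + h z)"
  unfolding has_weak_dbar_def
  using has_weak_dbarD[OF assms(3)] has_weak_dbarD[OF assms(4)] assms(1,2)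
  by (simp add: loc_integrable_add integral_test_add foldr_dbar_test_function distrib_left)

lemma has_weak_dbar_mult:
  assumes "has_weak_dbar I U is u g"
  shows "has_weak_dbar I U is (\<lambda>z. c * u z) (\<lambda>z. c * g z)"
  unfolding has_weak_dbar_def
  using has_weak_dbarD[OF assms] by (simp add: loc_integrable_mult integral_test_mult del: set_integral_mult_right)

lemma has_weak_dbar_diff:
  assumes "finite I" "set is \<subseteq> I" "has_weak_dbar I U is u g" "has_weak_dbar I U is v h"
  shows "has_weak_dbar I U is (\<lambda>z. u z - v z) (\<lambda>z. g z - h z)"
  using has_weak_dbar_add[OF assms(1-3) has_weak_dbar_mult[OF assms(4), of "-1"]] by simp

lemma has_weak_dbar_0: "has_weak_dbar I U is (\<lambda>_. 0) (\<lambda>_. 0)"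
  by (simp add: has_weak_dbar_def loc_integrable_0)

lemma has_weak_dbar_cong:
  assumes "finite I" "set is \<subseteq> I" "has_weak_dbar I U is u g"
    and "loc_integrable I U u'" "loc_integrable I U g'"
    and "AE z in cvol I. z \<in> U \<longrightarrow> u z = u' z" "AE z in cvol I. z \<in> U \<longrightarrow> g z = g' z"
  shows "has_weak_dbar I U is u' g'"
  unfolding has_weak_dbar_def
proof (intro conjI ballI)
  fix \<phi> assume \<phi>: "\<phi> \<in> test_functions I U"
  note \<phi>' = foldr_dbar_test_function[OF \<phi> assms(2)]
  show "(LINT z:U|cvol I. u' z * foldr dbar is \<phi> z) = (-1) ^ length is * (LINT z:U|cvol I. g' z * \<phi> z)"
    using has_weak_dbarD(3)[OF assms(3) \<phi>]
      integral_test_cong[OF assms(1) has_weak_dbarD(1)[OF assms(3)] assms(4) \<phi>' assms(6)]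
      integral_test_cong[OF assms(1) has_weak_dbarD(2)[OF assms(3)] assms(5) \<phi> assms(7)] by simp
qed (use assms in auto)

lemma has_weak_dbar_unique:
  assumes "finite I" "openin (ctop I) U" "has_weak_dbar I U is u g" "has_weak_dbar I U is u h"
  shows "AE z in cvol I. z \<in> U \<longrightarrow> g z = h z"
proof -
  note g = has_weak_dbarD[OF assms(3)] and h = has_weak_dbarD[OF assms(4)]
  have "AE z in cvol I. z \<in> U \<longrightarrow> g z + (-1) * h z = 0"
  proof (rule fundamental_lemma[OF assms(1,2)])
    show "loc_integrable I U (\<lambda>z. g z + (-1) * h z)"
      by (intro loc_integrable_add loc_integrable_mult g h)
    fix \<phi> assume \<phi>: "\<phi> \<in> test_functions I U"
    show "(LINT z:U|cvol I. (g z + (-1) * h z) * \<phi> z) = 0"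
      using g(3)[OF \<phi>] h(3)[OF \<phi>] \<phi>
      by (subst integral_test_add[OF assms(1) g(2) loc_integrable_mult[OF h(2)] \<phi>])
        (simp only: integral_test_mult, simp)
  qed
  then show ?thesis by eventually_elim simp
qed

text \<open>\<open>foldr\<close> applies the last label of the list to the test function first.
  Testing the identity for \<open>is\<close> with \<open>dbar i \<phi>\<close> and comparing with
  the one for \<open>is @ [i]\<close> therefore differentiates \<open>g\<close> once more. In this
  way mixed derivatives of the data become successive derivatives of functions.\<close>

lemma has_weak_dbar_append:
  assumes "i \<in> I" "has_weak_dbar I U is u g" "has_weak_dbar I U (is @ [i]) u h"
  shows "has_weak_dbar I U [i] g h"
  unfolding has_weak_dbar_def
proof (intro conjI ballI)
  fix \<phi> assume \<phi>: "\<phi> \<in> test_functions I U"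
  have "(-1) ^ length is * (LINT z:U|cvol I. g z * dbar i \<phi> z) = (LINT z:U|cvol I. u z * foldr dbar is (dbar i \<phi>) z)"
    using has_weak_dbarD(3)[OF assms(2) dbar_test_function[OF \<phi> assms(1)]] by simp
  also have "\<dots> = (-1) ^ length is * (- (LINT z:U|cvol I. h z * \<phi> z))"
    using has_weak_dbarD(3)[OF assms(3) \<phi>] by simp
  finally have "(LINT z:U|cvol I. g z * dbar i \<phi> z) = - (LINT z:U|cvol I. h z * \<phi> z)"
    by (subst (asm) mult_left_cancel) auto
  then show "(LINT z:U|cvol I. g z * foldr dbar [i] \<phi> z) = (-1) ^ length [i] * (LINT z:U|cvol I. h z * \<phi> z)"
    by simp
qed (use has_weak_dbarD[OF assms(2)] has_weak_dbarD[OF assms(3)] in auto)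

text \<open>Both sides are minus the integral of \<open>u\<close> against a second derivative of the
  test function, and there the two \<open>dbar\<close> operators commute.\<close>

lemma dbar_equation_imp_closed:
  assumes "dbar_equation I U u \<alpha>" "finite I" "U \<subseteq> I \<rightarrow>\<^sub>E UNIV"
  shows "dbar_closed I U \<alpha>"
  unfolding dbar_closed_def
proof (intro conjI ballI)
  fix i assume "i \<in> I"
  then have "has_weak_dbar I U [i] u (\<alpha> i)" using assms(1) by (auto simp: dbar_equation_def)
  then show "loc_integrable I U (\<alpha> i)" by (rule has_weak_dbarD(2))
next
  fix i l \<phi> assume il: "i \<in> I" "l \<in> I" and \<phi>: "\<phi> \<in> test_functions I U"
  have i: "has_weak_dbar I U [i] u (\<alpha> i)" and l: "has_weak_dbar I U [l] u (\<alpha> l)"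
    using assms(1) il by (auto simp: dbar_equation_def)
  have "- (LINT z:U|cvol I. \<alpha> l z * dbar i \<phi> z) = (LINT z:U|cvol I. u z * dbar l (dbar i \<phi>) z)"
    using has_weak_dbarD(3)[OF l dbar_test_function[OF \<phi> il(1)]] by simp
  also have "\<dots> = (LINT z:U|cvol I. u z * dbar i (dbar l \<phi>) z)"
    unfolding set_lebesgue_integral_def
  proof (rule Bochner_Integration.integral_cong[OF refl])
    fix z
    show "indicator U z *\<^sub>R (u z * dbar l (dbar i \<phi>) z) = indicator U z *\<^sub>R (u z * dbar i (dbar l \<phi>) z)"
      using dbar_commute[OF test_functionsD[OF \<phi>] il, of z] assms(3) by (auto simp: indicator_def)
  qed
  also have "\<dots> = - (LINT z:U|cvol I. \<alpha> i z * dbar l \<phi> z)"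
    using has_weak_dbarD(3)[OF i dbar_test_function[OF \<phi> il(2)]] by simp
  finally show "(LINT z:U|cvol I. \<alpha> l z * dbar i \<phi> z) = (LINT z:U|cvol I. \<alpha> i z * dbar l \<phi> z)" by simp
qed

lemma dbar_closed_diff:
  assumes "finite I" "dbar_closed I U \<alpha>" "dbar_closed I U \<beta>"
  shows "dbar_closed I U (\<lambda>i z. \<alpha> i z - \<beta> i z)"
proof -
  have la: "loc_integrable I U (\<alpha> i)" and lb: "loc_integrable I U (\<lambda>z. (-1) * \<beta> i z)" if "i \<in> I" for i
    using that assms(2,3) loc_integrable_mult[of I U "\<beta> i" "-1"] by (auto simp: dbar_closed_def)
  have "loc_integrable I U (\<lambda>z. \<alpha> i z - \<beta> i z)" if "i \<in> I" for i
    using loc_integrable_add[OF la lb, OF that that] by simp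
  moreover have "(LINT z:U|cvol I. (\<alpha> i z - \<beta> i z) * \<phi> z) =
      (LINT z:U|cvol I. \<alpha> i z * \<phi> z) - (LINT z:U|cvol I. \<beta> i z * \<phi> z)"
    if "i \<in> I" "\<phi> \<in> test_functions I U" for i \<phi>
    using integral_test_add[OF assms(1) la[OF that(1)] lb[OF that(1)] that(2)]
      integral_test_mult[where I = I and U = U and c = "-1" and u = "\<beta> i" and \<phi> = \<phi>] by simp
  ultimately show ?thesis
    using assms(2,3) by (simp add: dbar_closed_def dbar_test_function)
qed

lemma dbar_closed_cong:
  assumes "finite I" "dbar_closed I U \<alpha>" "\<And>i. i \<in> I \<Longrightarrow> loc_integrable I U (\<beta> i)"
    and "\<And>i. i \<in> I \<Longrightarrow> AE z in cvol I. z \<in> U \<longrightarrow> \<alpha> i z = \<beta> i z"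
  shows "dbar_closed I U \<beta>"
  unfolding dbar_closed_def
proof (intro conjI ballI)
  have la: "loc_integrable I U (\<alpha> i)" if "i \<in> I" for i using assms(2) that by (auto simp: dbar_closed_def)
  fix i l \<phi> assume il: "i \<in> I" "l \<in> I" and \<phi>: "\<phi> \<in> test_functions I U"
  show "(LINT z:U|cvol I. \<beta> l z * dbar i \<phi> z) = (LINT z:U|cvol I. \<beta> i z * dbar l \<phi> z)"
    using integral_test_cong[OF assms(1) la[OF il(1)] assms(3)[OF il(1)] dbar_test_function[OF \<phi> il(2)] assms(4)[OF il(1)]]
      integral_test_cong[OF assms(1) la[OF il(2)] assms(3)[OF il(2)] dbar_test_function[OF \<phi> il(1)] assms(4)[OF il(2)]]
      assms(2) il \<phi> by (simp add: dbar_closed_def)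
qed (use assms in auto)

section \<open>Estimates for \<open>Lp\<close> with unsharp constants; slices of \<open>Lp\<close>
  functions\<close>

section \<open>\<open>L\<^sup>p\<close> spaces\<close>

lemma Lp_measurable: "f \<in> Lp p M \<Longrightarrow> f \<in> borel_measurable M"
  by (simp add: Lp_def)

lemma Lp_norm_nonneg: "0 \<le> Lp_norm p M f"
  by (simp add: Lp_norm_def)

lemma Lp_norm_powr:
  assumes "p \<noteq> \<infinity>" "1 \<le> p"
  shows "Lp_norm p M f powr enn2real p = (LINT x|M. norm (f x) powr enn2real p)"
proof -
  have "enn2real p \<ge> 1" using assms by (metis enn2real_1 enn2real_mono infinity_ennreal_def top.not_eq_extremum)
  moreover have "0 \<le> (LINT x|M. norm (f x) powr enn2real p)" by simp
  ultimately show ?thesis using assms by (simp add: Lp_norm_def powr_powr)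
qed

lemma enn2real_ge_1: "p \<noteq> \<infinity> \<Longrightarrow> 1 \<le> p \<Longrightarrow> 1 \<le> enn2real p"
  by (metis enn2real_1 enn2real_mono infinity_ennreal_def top.not_eq_extremum)

lemma Lp_infinity_AE_le:
  assumes "f \<in> Lp p M" "p = \<infinity>"
  shows "AE x in M. norm (f x) \<le> Lp_norm p M f"
proof -
  have fin: "esssup M (\<lambda>x. ennreal (norm (f x))) < \<infinity>" using assms by (simp add: Lp_def)
  have "AE x in M. ennreal (norm (f x)) \<le> esssup M (\<lambda>x. ennreal (norm (f x)))" by (rule esssup_AE)
  then show ?thesis
  proof eventually_elim
    case (elim x)
    then have "enn2real (ennreal (norm (f x))) \<le> enn2real (esssup M (\<lambda>x. ennreal (norm (f x))))"
      using fin by (intro enn2real_mono) auto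
    then show ?case using assms(2) by (simp add: Lp_norm_def)
  qed
qed

lemma Lp_infinityI:
  assumes "f \<in> borel_measurable M" "AE x in M. norm (f x) \<le> C" "0 \<le> C"
  shows "f \<in> Lp \<infinity> M" "Lp_norm \<infinity> M f \<le> C"
proof -
  have "esssup M (\<lambda>x. ennreal (norm (f x))) \<le> ennreal C"
    using assms by (intro esssup_I) (auto elim!: eventually_mono intro!: ennreal_leI)
  moreover from this have "enn2real (esssup M (\<lambda>x. ennreal (norm (f x)))) \<le> enn2real (ennreal C)"
    by (intro enn2real_mono) auto
  ultimately show "f \<in> Lp \<infinity> M" "Lp_norm \<infinity> M f \<le> C"
    using assms by (auto simp: Lp_def Lp_norm_def intro: le_less_trans)
qed

lemma Lp_finiteI:
  assumes "p \<noteq> \<infinity>" "1 \<le> p" "f \<in> borel_measurable M" "0 \<le> C"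
    and le: "(\<integral>\<^sup>+x. ennreal (norm (f x) powr enn2real p) \<partial>M) \<le> ennreal (C powr enn2real p)"
  shows "f \<in> Lp p M" "Lp_norm p M f \<le> C"
proof -
  have [measurable]: "f \<in> borel_measurable M" by fact
  have q: "enn2real p \<ge> 1" using assms enn2real_ge_1 by blast
  have int: "integrable M (\<lambda>x. norm (f x) powr enn2real p)"
    by (rule integrableI_nonneg) (use le in \<open>auto intro: le_less_trans\<close>)
  then show "f \<in> Lp p M" using assms by (simp add: Lp_def)
  have "ennreal (LINT x|M. norm (f x) powr enn2real p) \<le> ennreal (C powr enn2real p)"
    using le by (subst nn_integral_eq_integral[OF int, symmetric]) auto
  then have "(LINT x|M. norm (f x) powr enn2real p) \<le> C powr enn2real p" by (simp add: ennreal_le_iff)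
  then have "(LINT x|M. norm (f x) powr enn2real p) powr (1 / enn2real p) \<le> (C powr enn2real p) powr (1 / enn2real p)"
    by (intro powr_mono2) auto
  then show "Lp_norm p M f \<le> C" using assms q by (simp add: Lp_norm_def powr_powr)
qed

lemma nn_integral_Lp_norm:
  assumes "p \<noteq> \<infinity>" "1 \<le> p" "f \<in> Lp p M"
  shows "(\<integral>\<^sup>+x. ennreal (norm (f x) powr enn2real p) \<partial>M) = ennreal (Lp_norm p M f powr enn2real p)"
  using assms by (subst nn_integral_eq_integral) (auto simp: Lp_norm_powr Lp_def)

text \<open>Every summand is at most the maximum, and the maximum is itself one of the summands. The
  factor is crude, but only its finiteness matters.\<close>

lemma sum_powr_le:
  fixes a :: "'i \<Rightarrow> real"
  assumes "finite I" "\<And>i. i \<in> I \<Longrightarrow> 0 \<le> a i" "1 \<le> q"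
  shows "(\<Sum>i\<in>I. a i) powr q \<le> real (card I) powr q * (\<Sum>i\<in>I. a i powr q)"
proof (cases "I = {}")
  case False
  define m where "m = Max (a ` I)"
  have m: "a i \<le> m" if "i \<in> I" for i using assms(1) that by (simp add: m_def)
  have "m \<in> a ` I" using assms(1) False by (simp add: m_def)
  then obtain j where j: "j \<in> I" "m = a j" by blast
  have "(\<Sum>i\<in>I. a i) \<le> real (card I) * m" using sum_bounded_above[of I a m] m by simp
  then have "(\<Sum>i\<in>I. a i) powr q \<le> (real (card I) * m) powr q"
    using assms by (intro powr_mono2 sum_nonneg) auto
  also have "\<dots> = real (card I) powr q * a j powr q" using assms j by (simp add: powr_mult)
  also have "\<dots> \<le> real (card I) powr q * (\<Sum>i\<in>I. a i powr q)"
    by (intro mult_left_mono member_le_sum j assms(1)) auto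
  finally show ?thesis .
qed simp

text \<open>Each summand is at most the power of the whole sum; the resulting factor
  \<open>card I\<close> can be moved inside the power because it is at least 1 and so is
  \<open>q\<close>.\<close>

lemma powr_sum_le:
  fixes b :: "'i \<Rightarrow> real"
  assumes "finite I" "\<And>i. i \<in> I \<Longrightarrow> 0 \<le> b i" "1 \<le> q"
  shows "(\<Sum>i\<in>I. b i powr q) \<le> (real (card I) * (\<Sum>i\<in>I. b i)) powr q"
proof (cases "I = {}")
  case False
  have c: "1 \<le> real (card I)" using False assms(1) by (simp add: Suc_leI card_gt_0_iff)
  have "(\<Sum>i\<in>I. b i powr q) \<le> (\<Sum>i\<in>I. (\<Sum>i\<in>I. b i) powr q)"
    using assms by (intro sum_mono powr_mono2 member_le_sum) auto
  also have "\<dots> = real (card I) powr 1 * (\<Sum>i\<in>I. b i) powr q" using c by simp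
  also have "\<dots> \<le> real (card I) powr q * (\<Sum>i\<in>I. b i) powr q"
    using c assms(3) by (intro mult_right_mono powr_mono) auto
  also have "\<dots> = (real (card I) * (\<Sum>i\<in>I. b i)) powr q"
    using assms by (subst powr_mult) (auto intro: sum_nonneg)
  finally show ?thesis .
qed simp

text \<open>The source of the stability of \<open>Lp\<close> under sums, multiples and dominated
  limits. One factor \<open>card I\<close> stems from \<open>sum_powr_le\<close> under the integral,
  the other from \<open>powr_sum_le\<close> for the norms.\<close>

lemma Lp_dominated:
  assumes p: "1 \<le> p" and I: "finite I" and C: "0 \<le> C"
    and h: "h \<in> borel_measurable M" and g: "\<And>i. i \<in> I \<Longrightarrow> g i \<in> Lp p M"
    and le: "AE x in M. norm (h x) \<le> C * (\<Sum>i\<in>I. norm (g i x))"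
  shows "h \<in> Lp p M" "Lp_norm p M h \<le> C * real (card I) * real (card I) * (\<Sum>i\<in>I. Lp_norm p M (g i))"
proof -
  let ?N = "real (card I)" and ?S = "\<Sum>i\<in>I. Lp_norm p M (g i)"
  have S: "0 \<le> ?S" by (intro sum_nonneg Lp_norm_nonneg)
  have "h \<in> Lp p M \<and> Lp_norm p M h \<le> C * ?N * ?N * ?S"
  proof (cases "p = \<infinity>")
    case True
    have "AE x in M. \<forall>i\<in>I. norm (g i x) \<le> Lp_norm p M (g i)"
      by (subst AE_ball_countable[OF countable_finite[OF I]]) (intro ballI Lp_infinity_AE_le g True)
    then have AE: "AE x in M. norm (h x) \<le> C * ?S"
      using le
    proof eventually_elim
      case (elim x)
      then show ?case using C by (meson mult_left_mono order_trans sum_mono)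
    qed
    \<comment> \<open>For \<open>p = \<infinity>\<close> the estimate has no extra factor; the
      common bound is reached since \<open>card I \<ge> 1\<close>, except for an empty sum, where
      both sides are 0.\<close>
    have "C * ?S \<le> C * ?N * ?N * ?S"
    proof (cases "I = {}")
      case False
      then have "1 \<le> ?N" using I by (simp add: Suc_leI card_gt_0_iff)
      then have "C * 1 \<le> C * (?N * ?N)" using C by (intro mult_left_mono) (auto simp: mult_ge1_I)
      then show ?thesis using S by (simp add: mult.assoc[symmetric] mult_right_mono)
    qed simp
    with Lp_infinityI[OF h AE] C S True show ?thesis by auto
  next
    case False
    let ?q = "enn2real p"
    have q: "1 \<le> ?q" using False p by (rule enn2real_ge_1)
    have [measurable]: "h \<in> borel_measurable M" by fact
    have gm: "g i \<in> borel_measurable M" if "i \<in> I" for i using g[OF that] by (rule Lp_measurable)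
    have "(\<integral>\<^sup>+x. ennreal (norm (h x) powr ?q) \<partial>M) \<le>
        (\<integral>\<^sup>+x. ennreal ((C * ?N) powr ?q) * (\<Sum>i\<in>I. ennreal (norm (g i x) powr ?q)) \<partial>M)"
    proof (intro nn_integral_mono_AE)
      show "AE x in M. ennreal (norm (h x) powr ?q) \<le> ennreal ((C * ?N) powr ?q) * (\<Sum>i\<in>I. ennreal (norm (g i x) powr ?q))"
        using le
      proof eventually_elim
        case (elim x)
        have "norm (h x) powr ?q \<le> (C * (\<Sum>i\<in>I. norm (g i x))) powr ?q"
          using elim q by (intro powr_mono2) auto
        also have "\<dots> = C powr ?q * (\<Sum>i\<in>I. norm (g i x)) powr ?q"
          by (rule powr_mult)
        also have "\<dots> \<le> C powr ?q * (?N powr ?q * (\<Sum>i\<in>I. norm (g i x) powr ?q))"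
          by (intro mult_left_mono sum_powr_le I q) auto
        finally have "ennreal (norm (h x) powr ?q) \<le> ennreal ((C * ?N) powr ?q * (\<Sum>i\<in>I. norm (g i x) powr ?q))"
          using C by (intro ennreal_leI) (simp add: powr_mult mult.assoc)
        then show ?case by (simp add: ennreal_mult sum_nonneg)
      qed
    qed
    also have "\<dots> = ennreal ((C * ?N) powr ?q) * (\<Sum>i\<in>I. \<integral>\<^sup>+x. ennreal (norm (g i x) powr ?q) \<partial>M)"
    proof -
      have "(\<lambda>x. ennreal (norm (g i x) powr ?q)) \<in> borel_measurable M" if "i \<in> I" for i
        using gm[OF that] by measurable
      then show ?thesis by (simp add: nn_integral_cmult nn_integral_sum borel_measurable_sum del: sum_ennreal)
    qed
    also have "\<dots> = ennreal ((C * ?N) powr ?q * (\<Sum>i\<in>I. Lp_norm p M (g i) powr ?q))"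
      using g False p by (simp add: nn_integral_Lp_norm ennreal_mult sum_nonneg)
    also have "\<dots> \<le> ennreal ((C * ?N) powr ?q * (?N * ?S) powr ?q)"
      by (intro ennreal_leI mult_left_mono powr_sum_le I q Lp_norm_nonneg) auto
    also have "\<dots> = ennreal ((C * ?N * ?N * ?S) powr ?q)"
      using C S by (simp add: powr_mult mult.assoc)
    finally show ?thesis
      using Lp_finiteI[OF False p h, of "C * ?N * ?N * ?S"] C S by simp
  qed
  then show "h \<in> Lp p M" "Lp_norm p M h \<le> C * ?N * ?N * ?S" by auto
qed

text \<open>The constant is the square of the number of summands, from \<open>Lp_dominated\<close>
  with the index set \<open>{True, False}\<close>.\<close>

lemma Lp_add:
  assumes "1 \<le> p" "f \<in> Lp p M" "g \<in> Lp p M"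
  shows "(\<lambda>x. f x + g x) \<in> Lp p M" "Lp_norm p M (\<lambda>x. f x + g x) \<le> 4 * (Lp_norm p M f + Lp_norm p M g)"
proof -
  note [measurable] = Lp_measurable[OF assms(2)] Lp_measurable[OF assms(3)]
  have g: "(\<lambda>b. if b then f else g) i \<in> Lp p M" if "i \<in> {True, False}" for i using assms by auto
  have "AE x in M. norm (f x + g x) \<le> 1 * (\<Sum>i\<in>{True, False}. norm ((\<lambda>b. if b then f else g) i x))"
    by (intro AE_I2) (simp add: norm_triangle_ineq)
  from Lp_dominated[OF assms(1) _ _ _ g this]
  show "(\<lambda>x. f x + g x) \<in> Lp p M" "Lp_norm p M (\<lambda>x. f x + g x) \<le> 4 * (Lp_norm p M f + Lp_norm p M g)"
    by simp_all
qed

lemma Lp_mult: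
  assumes "1 \<le> p" "f \<in> Lp p M"
  shows "(\<lambda>x. c * f x) \<in> Lp p M" "Lp_norm p M (\<lambda>x. c * f x) \<le> norm c * Lp_norm p M f"
proof -
  note [measurable] = Lp_measurable[OF assms(2)]
  have "AE x in M. norm (c * f x) \<le> norm c * (\<Sum>i\<in>{()}. norm (f x))"
    by (intro AE_I2) (simp add: norm_mult)
  from Lp_dominated[OF assms(1) _ _ _ _ this] assms(2)
  show "(\<lambda>x. c * f x) \<in> Lp p M" "Lp_norm p M (\<lambda>x. c * f x) \<le> norm c * Lp_norm p M f"
    by simp_all
qed

lemma Lp_diff:
  assumes "1 \<le> p" "f \<in> Lp p M" "g \<in> Lp p M"
  shows "(\<lambda>x. f x - g x) \<in> Lp p M" "Lp_norm p M (\<lambda>x. f x - g x) \<le> 4 * (Lp_norm p M f + Lp_norm p M g)"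
proof -
  show "(\<lambda>x. f x - g x) \<in> Lp p M"
    using Lp_add(1)[OF assms(1,2) Lp_mult(1)[OF assms(1,3), of "-1"]] by simp
  have "Lp_norm p M (\<lambda>x. f x + (-1) * g x) \<le> 4 * (Lp_norm p M f + Lp_norm p M (\<lambda>x. (-1) * g x))"
    by (intro Lp_add assms Lp_mult)
  also have "\<dots> \<le> 4 * (Lp_norm p M f + Lp_norm p M g)"
    using Lp_mult(2)[OF assms(1,3), of "-1"] by simp
  finally show "Lp_norm p M (\<lambda>x. f x - g x) \<le> 4 * (Lp_norm p M f + Lp_norm p M g)" by simp
qed

lemma Lp_0: "1 \<le> p \<Longrightarrow> (\<lambda>_. 0) \<in> Lp p M"
  by (rule Lp_dominated(1)[where I = "{} :: unit set" and C = 0]) auto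

lemma Lp_norm_0: "1 \<le> p \<Longrightarrow> Lp_norm p M (\<lambda>_. 0) = 0"
  using Lp_dominated(2)[of p "{} :: unit set" 0 "\<lambda>_. 0" M "\<lambda>_ _. 0"] Lp_norm_nonneg[of p M "\<lambda>_. 0"] by simp

lemma Lp_cong_AE:
  assumes "f \<in> Lp p M" "g \<in> borel_measurable M" "AE x in M. f x = g x"
  shows "g \<in> Lp p M" "Lp_norm p M g = Lp_norm p M f"
proof -
  note [measurable] = Lp_measurable[OF assms(1)] assms(2)
  have "esssup M (\<lambda>x. ennreal (norm (f x))) = esssup M (\<lambda>x. ennreal (norm (g x)))"
    by (rule esssup_AE_cong) (use assms(3) in auto)
  moreover have "integrable M (\<lambda>x. norm (f x) powr enn2real p) = integrable M (\<lambda>x. norm (g x) powr enn2real p)"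
    by (rule integrable_cong_AE) (use assms(3) in auto)
  moreover have "(LINT x|M. norm (f x) powr enn2real p) = (LINT x|M. norm (g x) powr enn2real p)"
    by (rule integral_cong_AE) (use assms(3) in auto)
  ultimately show "g \<in> Lp p M" "Lp_norm p M g = Lp_norm p M f"
    using assms by (auto simp: Lp_def Lp_norm_def)
qed

lemma Lp_norm_eq_0_AE:
  assumes "1 \<le> p" "f \<in> Lp p M" "Lp_norm p M f \<le> 0"
  shows "AE x in M. f x = 0"
proof (cases "p = \<infinity>")
  case True
  have "AE x in M. norm (f x) \<le> Lp_norm p M f" using assms(2) True by (rule Lp_infinity_AE_le)
  then show ?thesis
  proof eventually_elim
    case (elim x)
    then have "norm (f x) \<le> 0" using assms(3) by linarith
    then show ?case by simp
  qed
next
  case False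
  then have q: "1 \<le> enn2real p" using assms(1) enn2real_ge_1 by blast
  have "Lp_norm p M f = 0" using assms(3) Lp_norm_nonneg[of p M f] by simp
  then have "(LINT x|M. norm (f x) powr enn2real p) = 0" using Lp_norm_powr[OF False assms(1), of M f] q by simp
  moreover have "integrable M (\<lambda>x. norm (f x) powr enn2real p)" using assms(2) False by (simp add: Lp_def)
  ultimately have "AE x in M. norm (f x) powr enn2real p = 0"
    by (subst (asm) integral_nonneg_eq_0_iff_AE) auto
  then show ?thesis by (auto elim!: eventually_mono)
qed

text \<open>For \<open>t > \<epsilon>\<close> the factor \<open>t powr (1 - q)\<close> is at most
  \<open>\<epsilon> powr (1 - q)\<close>, the exponent being nonpositive. With
  \<open>\<epsilon> = 1\<close> this embeds \<open>L\<^sup>p\<close> into \<open>L\<^sup>1\<close>;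
  small \<open>\<epsilon>\<close> makes the embedding quantitative. It takes the place of Hoelder's
  inequality.\<close>

lemma le_add_powr:
  fixes t \<epsilon> q :: real
  assumes "0 \<le> t" "0 < \<epsilon>" "1 \<le> q"
  shows "t \<le> \<epsilon> + \<epsilon> powr (1 - q) * t powr q"
proof (cases "t \<le> \<epsilon>")
  case False
  then have t: "0 < t" "\<epsilon> \<le> t" using assms by auto
  have "t powr (1 - q) \<le> \<epsilon> powr (1 - q)"
    using t assms by (intro powr_mono2') auto
  then have "t powr (1 - q) * t powr q \<le> \<epsilon> powr (1 - q) * t powr q"
    by (rule mult_right_mono) simp
  moreover have "t powr (1 - q) * t powr q = t" using t by (simp add: powr_add[symmetric])
  ultimately show ?thesis using assms by simp
next
  case True
  have "0 \<le> \<epsilon> powr (1 - q) * t powr q" by simp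
  then show ?thesis using True by linarith
qed

lemma (in finite_measure) Lp_integrable:
  assumes "1 \<le> p" "f \<in> Lp p M"
  shows "integrable M f"
proof (cases "p = \<infinity>")
  case True
  then show ?thesis
    by (intro integrable_const_bound[of _ "Lp_norm p M f"] Lp_infinity_AE_le Lp_measurable[OF assms(2)] assms(2))
next
  case False
  have q: "1 \<le> enn2real p" using enn2real_ge_1[OF False assms(1)] .
  have [measurable]: "f \<in> borel_measurable M" using assms(2) by (rule Lp_measurable)
  have "integrable M (\<lambda>x. 1 + norm (f x) powr enn2real p)"
    using assms(2) False by (intro Bochner_Integration.integrable_add) (auto simp: Lp_def)
  then show ?thesis
    by (rule Bochner_Integration.integrable_bound)
      (use le_add_powr[OF norm_ge_zero, of 1 "enn2real p"] q in \<open>auto intro!: AE_I2 simp: abs_of_nonneg\<close>)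
qed

lemma Lp_distr:
  assumes [measurable]: "t \<in> measurable M N" "f \<in> borel_measurable N"
  shows "f \<in> Lp p (distr M N t) \<longleftrightarrow> (\<lambda>x. f (t x)) \<in> Lp p M"
    and "Lp_norm p (distr M N t) f = Lp_norm p M (\<lambda>x. f (t x))"
proof -
  have "esssup (distr M N t) (\<lambda>x. ennreal (norm (f x))) = esssup M (\<lambda>x. ennreal (norm (f (t x))))"
    by (simp add: esssup_eq_AE AE_distr_iff)
  moreover have "integrable (distr M N t) (\<lambda>x. norm (f x) powr enn2real p) = integrable M (\<lambda>x. norm (f (t x)) powr enn2real p)"
    by (rule integrable_distr_eq) auto
  moreover have "(LINT x|distr M N t. norm (f x) powr enn2real p) = (LINT x|M. norm (f (t x)) powr enn2real p)"
    by (rule integral_distr) auto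
  ultimately show "f \<in> Lp p (distr M N t) \<longleftrightarrow> (\<lambda>x. f (t x)) \<in> Lp p M"
      "Lp_norm p (distr M N t) f = Lp_norm p M (\<lambda>x. f (t x))"
    by (auto simp: Lp_def Lp_norm_def)
qed

lemma (in pair_sigma_finite) AE_Lp_slice:
  assumes "1 \<le> p" "g \<in> Lp p (M1 \<Otimes>\<^sub>M M2)"
  shows "AE w in M1. (\<lambda>x. g (w, x)) \<in> Lp p M2"
proof -
  have [measurable]: "g \<in> borel_measurable (M1 \<Otimes>\<^sub>M M2)" using assms(2) by (rule Lp_measurable)
  have m: "(\<lambda>x. g (w, x)) \<in> borel_measurable M2" if "w \<in> space M1" for w using that by measurable
  show ?thesis
  proof (cases "p = \<infinity>")
    case True
    then have "AE z in M1 \<Otimes>\<^sub>M M2. norm (g z) \<le> Lp_norm p (M1 \<Otimes>\<^sub>M M2) g"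
      using assms(2) by (intro Lp_infinity_AE_le)
    then have "AE w in M1. AE x in M2. norm (g (w, x)) \<le> Lp_norm p (M1 \<Otimes>\<^sub>M M2) g" by (rule AE_pair)
    then show ?thesis using AE_space
    proof eventually_elim
      case (elim w)
      then show ?case using Lp_infinityI(1)[OF m elim(1) Lp_norm_nonneg] True by simp
    qed
  next
    case False
    then have "integrable (M1 \<Otimes>\<^sub>M M2) (\<lambda>z. norm (g z) powr enn2real p)" using assms(2) by (simp add: Lp_def)
    from AE_integrable_fst'[OF this] AE_space show ?thesis
      by eventually_elim (use False m in \<open>simp add: Lp_def\<close>)
  qed
qed

text \<open>The form in which an operator bound on one factor is lifted to the product: domination
  is known only between norms of slices. For finite \<open>p\<close> the powers of the slice norms
  are integrated over the parameter by Tonelli; for \<open>p = \<infinity>\<close> almost every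
  slice norm is bounded by the global norm.\<close>

lemma (in pair_sigma_finite) Lp_slice_dominated:
  assumes p: "1 \<le> p" and I: "finite I" and C: "0 \<le> C"
    and h: "h \<in> borel_measurable (M1 \<Otimes>\<^sub>M M2)" and g: "\<And>i. i \<in> I \<Longrightarrow> g i \<in> Lp p (M1 \<Otimes>\<^sub>M M2)"
    and le: "AE w in M1. (\<lambda>x. h (w, x)) \<in> Lp p M2 \<and>
      Lp_norm p M2 (\<lambda>x. h (w, x)) \<le> C * (\<Sum>i\<in>I. Lp_norm p M2 (\<lambda>x. g i (w, x)))"
  shows "h \<in> Lp p (M1 \<Otimes>\<^sub>M M2)"
    "Lp_norm p (M1 \<Otimes>\<^sub>M M2) h \<le> C * real (card I) * real (card I) * (\<Sum>i\<in>I. Lp_norm p (M1 \<Otimes>\<^sub>M M2) (g i))"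
proof -
  let ?M = "M1 \<Otimes>\<^sub>M M2"
  let ?N = "real (card I)" and ?S = "\<Sum>i\<in>I. Lp_norm p ?M (g i)"
  have S: "0 \<le> ?S" by (intro sum_nonneg Lp_norm_nonneg)
  have [measurable]: "h \<in> borel_measurable ?M" by fact
  have gm: "g i \<in> borel_measurable ?M" if "i \<in> I" for i using g[OF that] by (rule Lp_measurable)
  have sl: "AE w in M1. \<forall>i\<in>I. (\<lambda>x. g i (w, x)) \<in> Lp p M2"
    using g p I by (subst AE_ball_countable) (auto simp: AE_Lp_slice countable_finite)
  have "h \<in> Lp p ?M \<and> Lp_norm p ?M h \<le> C * ?N * ?N * ?S"
  proof (cases "p = \<infinity>")
    case True
    have "AE w in M1. \<forall>i\<in>I. AE x in M2. norm (g i (w, x)) \<le> Lp_norm p ?M (g i)"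
      by (subst AE_ball_countable[OF countable_finite[OF I]]) (intro ballI AE_pair Lp_infinity_AE_le g True)
    then have "AE w in M1. AE x in M2. norm (h (w, x)) \<le> C * ?S"
      using le sl AE_space
    proof eventually_elim
      case (elim w)
      have "Lp_norm p M2 (\<lambda>x. g i (w, x)) \<le> Lp_norm p ?M (g i)" if "i \<in> I" for i
        using Lp_infinityI(2)[of "\<lambda>x. g i (w, x)" M2, OF _ _ Lp_norm_nonneg] elim True that Lp_measurable by blast
      then have "Lp_norm p M2 (\<lambda>x. h (w, x)) \<le> C * ?S"
        using elim C by (meson mult_left_mono order_trans sum_mono)
      moreover have "AE x in M2. norm (h (w, x)) \<le> Lp_norm p M2 (\<lambda>x. h (w, x))"
        using elim by (intro Lp_infinity_AE_le True) auto
      ultimately show ?case by (auto elim!: eventually_mono)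
    qed
    then have AE: "AE z in ?M. norm (h z) \<le> C * ?S"
      by (intro AE_pair_measure) auto
    have "C * ?S \<le> C * ?N * ?N * ?S"
    proof (cases "I = {}")
      case False
      then have "1 \<le> ?N" using I by (simp add: Suc_leI card_gt_0_iff)
      then have "C * 1 \<le> C * (?N * ?N)" using C by (intro mult_left_mono) (auto simp: mult_ge1_I)
      then show ?thesis using S by (simp add: mult.assoc[symmetric] mult_right_mono)
    qed simp
    with Lp_infinityI[OF h AE] C S True show ?thesis by auto
  next
    case False
    let ?q = "enn2real p"
    have q: "1 \<le> ?q" using False p by (rule enn2real_ge_1)
    have slice: "(\<integral>\<^sup>+z. ennreal (norm (f z) powr ?q) \<partial>?M) = (\<integral>\<^sup>+w. (\<integral>\<^sup>+x. ennreal (norm (f (w, x)) powr ?q) \<partial>M2) \<partial>M1)"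
      if "f \<in> borel_measurable ?M" for f :: "_ \<Rightarrow> complex"
      using that by (subst M2.nn_integral_fst[symmetric]) auto
    have "(\<integral>\<^sup>+z. ennreal (norm (h z) powr ?q) \<partial>?M) \<le>
        (\<integral>\<^sup>+w. ennreal ((C * ?N) powr ?q) * (\<Sum>i\<in>I. \<integral>\<^sup>+x. ennreal (norm (g i (w, x)) powr ?q) \<partial>M2) \<partial>M1)"
      unfolding slice[OF h]
    proof (intro nn_integral_mono_AE)
      show "AE w in M1. (\<integral>\<^sup>+x. ennreal (norm (h (w, x)) powr ?q) \<partial>M2) \<le>
          ennreal ((C * ?N) powr ?q) * (\<Sum>i\<in>I. \<integral>\<^sup>+x. ennreal (norm (g i (w, x)) powr ?q) \<partial>M2)"
        using le sl
      proof eventually_elim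
        case (elim w)
        let ?n = "\<lambda>i. Lp_norm p M2 (\<lambda>x. g i (w, x))"
        have "Lp_norm p M2 (\<lambda>x. h (w, x)) powr ?q \<le> (C * (\<Sum>i\<in>I. ?n i)) powr ?q"
          using elim q by (intro powr_mono2 Lp_norm_nonneg) auto
        also have "\<dots> = C powr ?q * (\<Sum>i\<in>I. ?n i) powr ?q"
          by (rule powr_mult)
        also have "\<dots> \<le> C powr ?q * (?N powr ?q * (\<Sum>i\<in>I. ?n i powr ?q))"
          by (intro mult_left_mono sum_powr_le I q Lp_norm_nonneg) auto
        finally have "ennreal (Lp_norm p M2 (\<lambda>x. h (w, x)) powr ?q) \<le> ennreal ((C * ?N) powr ?q * (\<Sum>i\<in>I. ?n i powr ?q))"
          using C by (intro ennreal_leI) (simp add: powr_mult mult.assoc)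
        then show ?case using elim False p by (simp add: nn_integral_Lp_norm ennreal_mult sum_nonneg)
      qed
    qed
    also have "\<dots> = ennreal ((C * ?N) powr ?q) * (\<Sum>i\<in>I. \<integral>\<^sup>+w. \<integral>\<^sup>+x. ennreal (norm (g i (w, x)) powr ?q) \<partial>M2 \<partial>M1)"
    proof -
      have gw: "(\<lambda>w. \<integral>\<^sup>+x. ennreal (norm (g i (w, x)) powr ?q) \<partial>M2) \<in> borel_measurable M1" if "i \<in> I" for i
        using gm[OF that] by measurable
      then show ?thesis
        by (simp add: nn_integral_cmult nn_integral_sum borel_measurable_sum del: sum_ennreal)
    qed
    also have "\<dots> = ennreal ((C * ?N) powr ?q) * (\<Sum>i\<in>I. \<integral>\<^sup>+z. ennreal (norm (g i z) powr ?q) \<partial>?M)"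
      using slice[OF gm] by simp
    also have "\<dots> = ennreal ((C * ?N) powr ?q * (\<Sum>i\<in>I. Lp_norm p ?M (g i) powr ?q))"
      using g False p by (simp add: nn_integral_Lp_norm ennreal_mult sum_nonneg)
    also have "\<dots> \<le> ennreal ((C * ?N) powr ?q * (?N * ?S) powr ?q)"
      by (intro ennreal_leI mult_left_mono powr_sum_le I q Lp_norm_nonneg) auto
    also have "\<dots> = ennreal ((C * ?N * ?N * ?S) powr ?q)"
      using C S by (simp add: powr_mult mult.assoc)
    finally show ?thesis
      using Lp_finiteI[OF False p h, of "C * ?N * ?N * ?S"] C S by simp
  qed
  then show "h \<in> Lp p ?M" "Lp_norm p ?M h \<le> C * ?N * ?N * ?S" by auto
qed

section \<open>Measurable parameterwise values of a scalar operator\<close>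

section \<open>Operators on \<open>L\<^sup>p\<close> depending on a parameter\<close>

lemma Lp_dominated_convergence:
  assumes p: "p \<noteq> \<infinity>" "1 \<le> p"
    and s: "\<And>n. s n \<in> borel_measurable M" and g: "g \<in> borel_measurable M" and h: "h \<in> Lp p M"
    and le: "\<And>n. AE x in M. norm (s n x) \<le> norm (h x)" and lim: "AE x in M. (\<lambda>n. s n x) \<longlonglongrightarrow> g x"
  shows "(\<lambda>n. Lp_norm p M (\<lambda>x. s n x - g x)) \<longlonglongrightarrow> 0"
proof -
  let ?q = "enn2real p"
  have q: "1 \<le> ?q" using enn2real_ge_1[OF p] .
  note [measurable] = s g Lp_measurable[OF h]
  have "AE x in M. \<forall>n. norm (s n x) \<le> norm (h x)" using le by (subst AE_all_countable) blast
  then have gh: "AE x in M. norm (g x) \<le> norm (h x)" using lim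
  proof eventually_elim
    case (elim x)
    from tendsto_norm[OF elim(2)] elim(1) show ?case by (auto intro: LIMSEQ_le_const2)
  qed
  have "(\<lambda>n. LINT x|M. norm (s n x - g x) powr ?q) \<longlonglongrightarrow> (LINT x|M. 0)"
  proof (rule integral_dominated_convergence[where w = "\<lambda>x. 2 powr ?q * norm (h x) powr ?q"])
    show "integrable M (\<lambda>x. 2 powr ?q * norm (h x) powr ?q)" using h p by (simp add: Lp_def)
    show "AE x in M. (\<lambda>n. norm (s n x - g x) powr ?q) \<longlonglongrightarrow> 0"
      using lim
    proof eventually_elim
      case (elim x)
      then have "(\<lambda>n. norm (s n x - g x)) \<longlonglongrightarrow> 0" by (simp add: LIM_zero tendsto_norm_zero)
      then have "(\<lambda>n. norm (s n x - g x) powr ?q) \<longlonglongrightarrow> 0 powr ?q"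
        using q by (intro tendsto_powr2) auto
      then show ?case using q by simp
    qed
    show "AE x in M. norm (norm (s n x - g x) powr ?q) \<le> 2 powr ?q * norm (h x) powr ?q" for n
      using le[of n] gh
    proof eventually_elim
      case (elim x)
      have "norm (s n x - g x) \<le> 2 * norm (h x)" using norm_triangle_ineq4[of "s n x" "g x"] elim by linarith
      then have "norm (s n x - g x) powr ?q \<le> (2 * norm (h x)) powr ?q" using q by (intro powr_mono2) auto
      then show ?case by (simp add: powr_mult)
    qed
  qed measurable
  then have "(\<lambda>n. LINT x|M. norm (s n x - g x) powr ?q) \<longlonglongrightarrow> 0" by simp
  then have "(\<lambda>n. (LINT x|M. norm (s n x - g x) powr ?q) powr (1 / ?q)) \<longlonglongrightarrow> 0 powr (1 / ?q)"
    using q by (intro tendsto_powr2) auto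
  then show ?thesis using p q by (simp add: Lp_norm_def)
qed

lemma (in finite_measure) Lp_small_imp_L1_small:
  assumes p: "p \<noteq> \<infinity>" "1 \<le> p" and e: "(0::real) < e"
  obtains \<delta> where "0 < \<delta>" "\<And>f. f \<in> Lp p M \<Longrightarrow> Lp_norm p M f < \<delta> \<Longrightarrow> (LINT x|M. norm (f x)) < e"
proof -
  let ?q = "enn2real p" and ?m = "measure M (space M)"
  have q: "1 \<le> ?q" using enn2real_ge_1[OF p] .
  \<comment> \<open>Less than half of \<open>e\<close> goes to the constant term; the
    \<open>+ 1\<close> covers a space of measure 0.\<close>
  define \<epsilon> where "\<epsilon> = e / (2 * (?m + 1))"
  have m: "0 < ?m + 1" using measure_nonneg[of M "space M"] by linarith
  then have \<epsilon>: "0 < \<epsilon>" "\<epsilon> * ?m < e / 2" using e by (auto simp: \<epsilon>_def field_simps)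
  \<comment> \<open>Chosen so that \<open>\<epsilon> powr (1 - ?q) * \<delta> powr ?q\<close> is the
    other half of \<open>e\<close>.\<close>
  define \<delta> where "\<delta> = (e / 2 * \<epsilon> powr (?q - 1)) powr (1 / ?q)"
  have \<delta>: "0 < \<delta>" "\<delta> powr ?q = e / 2 * \<epsilon> powr (?q - 1)" using e \<epsilon> q by (auto simp: \<delta>_def powr_powr)
  have "(LINT x|M. norm (f x)) < e" if f: "f \<in> Lp p M" "Lp_norm p M f < \<delta>" for f
  proof -
    have int: "integrable M (\<lambda>x. norm (f x) powr ?q)" using f(1) p by (simp add: Lp_def)
    have "(LINT x|M. norm (f x)) \<le> (LINT x|M. \<epsilon> + \<epsilon> powr (1 - ?q) * norm (f x) powr ?q)"
      using Lp_integrable[OF p(2) f(1)] int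
      by (intro integral_mono le_add_powr \<epsilon> q) auto
    also have "\<dots> = \<epsilon> * ?m + \<epsilon> powr (1 - ?q) * Lp_norm p M f powr ?q"
      using int by (simp add: Lp_norm_powr[OF p])
    also have "\<dots> \<le> \<epsilon> * ?m + \<epsilon> powr (1 - ?q) * \<delta> powr ?q"
      using f(2) q by (intro add_left_mono mult_left_mono powr_mono2) (auto simp: Lp_norm_nonneg)
    also have "\<epsilon> powr (1 - ?q) * \<delta> powr ?q = e / 2"
      using \<epsilon>(1) by (simp add: \<delta>(2) powr_add[symmetric] mult.left_commute)
    finally show ?thesis using \<epsilon>(2) by linarith
  qed
  with \<delta>(1) show thesis by (rule that)
qed

text \<open>Operators on scalar functions; an operator on forms is reduced to these by feeding it
  one coefficient at a time.\<close>

locale Lp_operator = finite_measure M for p :: ennreal and M :: "'a measure" +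
  fixes A :: "('a \<Rightarrow> complex) \<Rightarrow> 'a \<Rightarrow> complex" and C :: real
  assumes p_ge_1: "1 \<le> p" and C_nonneg: "0 \<le> C"
    and maps: "f \<in> Lp p M \<Longrightarrow> A f \<in> Lp p M"
    and add: "f \<in> Lp p M \<Longrightarrow> g \<in> Lp p M \<Longrightarrow> AE x in M. A (\<lambda>x. f x + g x) x = A f x + A g x"
    and mult: "f \<in> Lp p M \<Longrightarrow> AE x in M. A (\<lambda>x. c * f x) x = c * A f x"
    and bound: "f \<in> Lp p M \<Longrightarrow> Lp_norm p M (A f) \<le> C * Lp_norm p M f"
begin

lemma diff:
  assumes "f \<in> Lp p M" "g \<in> Lp p M"
  shows "AE x in M. A (\<lambda>x. f x - g x) x = A f x - A g x"
  using add[OF assms(1) Lp_mult(1)[OF p_ge_1 assms(2)], of "-1"] mult[OF assms(2), of "-1"]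
  by eventually_elim simp

definition param_value :: "'b measure \<Rightarrow> ('b \<times> 'a \<Rightarrow> complex) \<Rightarrow> ('b \<times> 'a \<Rightarrow> complex) \<Rightarrow> bool" where
  "param_value N g u \<longleftrightarrow> u \<in> borel_measurable (N \<Otimes>\<^sub>M M) \<and>
     (AE w in N. AE x in M. u (w, x) = A (\<lambda>x. g (w, x)) x)"

lemma param_value_Lp:
  assumes "finite_measure N" "g \<in> Lp p (N \<Otimes>\<^sub>M M)" "param_value N g u"
  shows "u \<in> Lp p (N \<Otimes>\<^sub>M M)" "Lp_norm p (N \<Otimes>\<^sub>M M) u \<le> C * Lp_norm p (N \<Otimes>\<^sub>M M) g"
proof -
  interpret N: finite_measure N by fact
  interpret pair_sigma_finite N M ..
  have u: "u \<in> borel_measurable (N \<Otimes>\<^sub>M M)" "AE w in N. AE x in M. u (w, x) = A (\<lambda>x. g (w, x)) x"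
    using assms(3) by (auto simp: param_value_def)
  have um: "(\<lambda>x. u (w, x)) \<in> borel_measurable M" if "w \<in> space N" for w using u(1) that by measurable
  have "AE w in N. (\<lambda>x. u (w, x)) \<in> Lp p M \<and>
      Lp_norm p M (\<lambda>x. u (w, x)) \<le> C * (\<Sum>i\<in>{()}. Lp_norm p M (\<lambda>x. g (w, x)))"
    using AE_Lp_slice[OF p_ge_1 assms(2)] u(2) AE_space
  proof eventually_elim
    case (elim w)
    have "AE x in M. A (\<lambda>x. g (w, x)) x = u (w, x)" using elim(2) by eventually_elim simp
    from Lp_cong_AE[OF maps[OF elim(1)] um[OF elim(3)] this] bound[OF elim(1)]
    show ?case by simp
  qed
  from Lp_slice_dominated[OF p_ge_1 _ C_nonneg u(1) _ this] assms(2)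
  show "u \<in> Lp p (N \<Otimes>\<^sub>M M)" "Lp_norm p (N \<Otimes>\<^sub>M M) u \<le> C * Lp_norm p (N \<Otimes>\<^sub>M M) g" by simp_all
qed

lemma param_value_add:
  assumes "finite_measure N" "g \<in> Lp p (N \<Otimes>\<^sub>M M)" "param_value N g u" "h \<in> Lp p (N \<Otimes>\<^sub>M M)" "param_value N h v"
  shows "param_value N (\<lambda>z. g z + h z) (\<lambda>z. u z + v z)"
proof -
  interpret N: finite_measure N by fact
  interpret pair_sigma_finite N M ..
  have "AE w in N. AE x in M. u (w, x) + v (w, x) = A (\<lambda>x. g (w, x) + h (w, x)) x"
    using AE_Lp_slice[OF p_ge_1 assms(2)] AE_Lp_slice[OF p_ge_1 assms(4)]
      conjunct2[OF assms(3)[unfolded param_value_def]] conjunct2[OF assms(5)[unfolded param_value_def]]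
  proof eventually_elim
    case (elim w)
    show ?case using elim(3,4) add[OF elim(1,2)] by eventually_elim simp
  qed
  then show ?thesis using assms(3,5) by (auto simp: param_value_def)
qed

lemma param_value_mult:
  assumes "finite_measure N" "g \<in> Lp p (N \<Otimes>\<^sub>M M)" "param_value N g u"
  shows "param_value N (\<lambda>z. c * g z) (\<lambda>z. c * u z)"
proof -
  interpret N: finite_measure N by fact
  interpret pair_sigma_finite N M ..
  have "AE w in N. AE x in M. c * u (w, x) = A (\<lambda>x. c * g (w, x)) x"
    using AE_Lp_slice[OF p_ge_1 assms(2)] conjunct2[OF assms(3)[unfolded param_value_def]]
  proof eventually_elim
    case (elim w)
    show ?case using elim(2) mult[OF elim(1), of c] by eventually_elim simp
  qed
  then show ?thesis using assms(3) by (auto simp: param_value_def)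
qed

lemma param_value_diff:
  assumes "finite_measure N" "g \<in> Lp p (N \<Otimes>\<^sub>M M)" "param_value N g u" "h \<in> Lp p (N \<Otimes>\<^sub>M M)" "param_value N h v"
  shows "param_value N (\<lambda>z. g z - h z) (\<lambda>z. u z - v z)"
  using param_value_add[OF assms(1-3) Lp_mult(1)[OF p_ge_1 assms(4)] param_value_mult[OF assms(1,4,5)], of "-1"]
  by simp

text \<open>By the operator bound the values \<open>u n\<close> form a Cauchy sequence in
  \<open>L\<^sup>p\<close>, hence in \<open>L\<^sup>1\<close>, and a subsequence converges a.e. to a
  measurable \<open>v\<close>. On almost every slice the operator applied to \<open>s n\<close> also
  converges in norm to the operator applied to \<open>g\<close>, which identifies \<open>v\<close>
  as a value for \<open>g\<close>.\<close>

lemma param_value_limit: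
  assumes N: "finite_measure N" and p: "p \<noteq> \<infinity>"
    and s: "\<And>n. s n \<in> Lp p (N \<Otimes>\<^sub>M M)" "\<And>n. param_value N (s n) (u n)"
    and g: "g \<in> borel_measurable (N \<Otimes>\<^sub>M M)" and h: "h \<in> Lp p (N \<Otimes>\<^sub>M M)"
    and le: "\<And>n. AE z in N \<Otimes>\<^sub>M M. norm (s n z) \<le> norm (h z)"
    and lim: "AE z in N \<Otimes>\<^sub>M M. (\<lambda>n. s n z) \<longlonglongrightarrow> g z"
  shows "g \<in> Lp p (N \<Otimes>\<^sub>M M)" "\<exists>v. param_value N g v"
proof -
  interpret N: finite_measure N by fact
  interpret P: pair_sigma_finite N M ..
  interpret NM: finite_measure "N \<Otimes>\<^sub>M M" using finite_measure_axioms N by (rule finite_measure_pair_measure)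
  have leA: "AE z in N \<Otimes>\<^sub>M M. \<forall>n. norm (s n z) \<le> norm (h z)" using le by (subst AE_all_countable) blast
  then have "AE z in N \<Otimes>\<^sub>M M. norm (g z) \<le> 1 * (\<Sum>i\<in>{()}. norm (h z))" using lim
  proof eventually_elim
    case (elim z)
    from tendsto_norm[OF elim(2)] elim(1) show ?case by (auto intro: LIMSEQ_le_const2)
  qed
  from Lp_dominated(1)[OF p_ge_1 _ _ g _ this] h show gL: "g \<in> Lp p (N \<Otimes>\<^sub>M M)" by simp
  have uL: "u n \<in> Lp p (N \<Otimes>\<^sub>M M)" for n by (rule param_value_Lp[OF N s])
  have conv: "(\<lambda>n. Lp_norm p (N \<Otimes>\<^sub>M M) (\<lambda>z. s n z - g z)) \<longlonglongrightarrow> 0"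
    by (rule Lp_dominated_convergence[OF p p_ge_1 Lp_measurable[OF s(1)] g h le lim])
  have "\<exists>K. \<forall>i\<ge>K. \<forall>j\<ge>K. (LINT z|(N \<Otimes>\<^sub>M M). norm (u i z - u j z)) < e" if e: "e > 0" for e
  proof -
    obtain \<delta> where \<delta>: "0 < \<delta>" "\<And>f. f \<in> Lp p (N \<Otimes>\<^sub>M M) \<Longrightarrow> Lp_norm p (N \<Otimes>\<^sub>M M) f < \<delta> \<Longrightarrow>
        (LINT z|(N \<Otimes>\<^sub>M M). norm (f z)) < e"
      using NM.Lp_small_imp_L1_small[OF p p_ge_1 e] by blast
    define c where "c = C + 1"
    have c: "0 < c" "C < c" using C_nonneg by (auto simp: c_def)
    \<comment> \<open>Two errors below \<open>\<eta>\<close> and the factor 4 of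
      \<open>Lp_diff\<close> account for the 8; dividing by \<open>C + 1\<close> rather than
      \<open>C\<close> admits \<open>C = 0\<close> and leaves a strict inequality.\<close>
    define \<eta> where "\<eta> = \<delta> / c / 8"
    have "C / c < 1" using c by simp
    then have "C / c * \<delta> < 1 * \<delta>" using \<delta>(1) by (rule mult_strict_right_mono)
    moreover have "C * (4 * (\<eta> + \<eta>)) = C / c * \<delta>" by (simp add: \<eta>_def)
    ultimately have \<eta>: "0 < \<eta>" "C * (4 * (\<eta> + \<eta>)) < \<delta>"
      using \<delta>(1) c by (auto simp: \<eta>_def)
    obtain K where K: "\<And>n. n \<ge> K \<Longrightarrow> Lp_norm p (N \<Otimes>\<^sub>M M) (\<lambda>z. s n z - g z) < \<eta>"
      using LIMSEQ_D[OF conv \<eta>(1)] by (auto simp: Lp_norm_nonneg)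
    have "(LINT z|(N \<Otimes>\<^sub>M M). norm (u i z - u j z)) < e" if "i \<ge> K" "j \<ge> K" for i j
    proof (rule \<delta>(2))
      show "(\<lambda>z. u i z - u j z) \<in> Lp p (N \<Otimes>\<^sub>M M)" by (intro Lp_diff p_ge_1 uL)
      have "Lp_norm p (N \<Otimes>\<^sub>M M) (\<lambda>z. u i z - u j z) \<le> C * Lp_norm p (N \<Otimes>\<^sub>M M) (\<lambda>z. s i z - s j z)"
        by (intro param_value_Lp(2) N Lp_diff p_ge_1 s param_value_diff)
      also have "Lp_norm p (N \<Otimes>\<^sub>M M) (\<lambda>z. s i z - s j z) =
          Lp_norm p (N \<Otimes>\<^sub>M M) (\<lambda>z. (s i z - g z) - (s j z - g z))" by simp
      also have "C * \<dots> \<le> C * (4 * (Lp_norm p (N \<Otimes>\<^sub>M M) (\<lambda>z. s i z - g z) + Lp_norm p (N \<Otimes>\<^sub>M M) (\<lambda>z. s j z - g z)))"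
        by (intro mult_left_mono Lp_diff p_ge_1 s gL C_nonneg)
      also have "\<dots> \<le> C * (4 * (\<eta> + \<eta>))"
        using K[OF that(1)] K[OF that(2)] by (intro mult_left_mono add_mono C_nonneg) auto
      finally show "Lp_norm p (N \<Otimes>\<^sub>M M) (\<lambda>z. u i z - u j z) < \<delta>" using \<eta>(2) by linarith
    qed
    then show ?thesis by blast
  qed
  then obtain r where r: "strict_mono r" "AE z in N \<Otimes>\<^sub>M M. Cauchy (\<lambda>i. u (r i) z)"
    by (rule cauchy_L1_AE_cauchy_subseq[OF NM.Lp_integrable[OF p_ge_1 uL]])
  define v where "v z = lim (\<lambda>i. u (r i) z)" for z
  have um: "u n \<in> borel_measurable (N \<Otimes>\<^sub>M M)" for n by (rule Lp_measurable[OF uL])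
  have v: "v \<in> borel_measurable (N \<Otimes>\<^sub>M M)" unfolding v_def by (intro borel_measurable_lim_metric um)
  have "AE z in N \<Otimes>\<^sub>M M. (\<lambda>i. u (r i) z) \<longlonglongrightarrow> v z"
    using r(2) by eventually_elim (simp add: v_def Cauchy_convergent convergent_LIMSEQ_iff[symmetric])
  from P.AE_pair[OF this] have vlim: "AE w in N. AE x in M. (\<lambda>i. u (r i) (w, x)) \<longlonglongrightarrow> v (w, x)" .
  have sA: "AE w in N. \<forall>n. (\<lambda>x. s n (w, x)) \<in> Lp p M"
    using P.AE_Lp_slice[OF p_ge_1 s(1)] by (subst AE_all_countable) blast
  have uA: "AE w in N. \<forall>n. AE x in M. u n (w, x) = A (\<lambda>x. s n (w, x)) x"
    using s(2) by (subst AE_all_countable) (auto simp: param_value_def)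
  have "AE w in N. AE x in M. v (w, x) = A (\<lambda>x. g (w, x)) x"
    using vlim sA uA P.AE_Lp_slice[OF p_ge_1 gL] P.AE_Lp_slice[OF p_ge_1 h] P.AE_pair[OF leA] P.AE_pair[OF lim]
  proof eventually_elim
    case (elim w)
    have sL: "(\<lambda>x. s n (w, x)) \<in> Lp p M" for n using elim(2) by blast
    let ?d = "\<lambda>n x. s (r n) (w, x) - g (w, x)"
    let ?D = "\<lambda>n x. A (\<lambda>x. s (r n) (w, x)) x - A (\<lambda>x. g (w, x)) x"
    have dL: "?d n \<in> Lp p M" for n by (intro Lp_diff p_ge_1 sL elim(4))
    have DL: "?D n \<in> Lp p M" for n by (intro Lp_diff p_ge_1 maps sL elim(4))
    have "(\<lambda>n. Lp_norm p M (\<lambda>x. s n (w, x) - g (w, x))) \<longlonglongrightarrow> 0"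
      by (rule Lp_dominated_convergence[OF p p_ge_1 Lp_measurable[OF sL] Lp_measurable[OF elim(4)] elim(5) _ elim(7)])
        (use elim(6) in \<open>auto elim: eventually_mono\<close>)
    from LIMSEQ_subseq_LIMSEQ[OF this r(1)] have dlim: "(\<lambda>n. Lp_norm p M (?d n)) \<longlonglongrightarrow> 0" by (simp add: o_def)
    have DD: "Lp_norm p M (?D n) = Lp_norm p M (A (?d n))" for n
      by (rule Lp_cong_AE(2)[OF maps[OF dL] Lp_measurable[OF DL] diff[OF sL elim(4)]])
    have Dlim: "(\<lambda>n. Lp_norm p M (?D n)) \<longlonglongrightarrow> 0"
    proof (rule tendsto_sandwich[OF _ _ tendsto_const tendsto_mult_right_zero[OF dlim, of C]])
      show "\<forall>\<^sub>F n in sequentially. Lp_norm p M (?D n) \<le> C * Lp_norm p M (?d n)"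
        unfolding DD by (intro always_eventually allI bound dL)
    qed (simp add: Lp_norm_nonneg)
    have "(\<lambda>n. LINT x|M. norm (?D n x)) \<longlonglongrightarrow> 0"
    proof (rule LIMSEQ_I)
      fix e :: real assume "e > 0"
      then obtain \<delta> where \<delta>: "0 < \<delta>" "\<And>f. f \<in> Lp p M \<Longrightarrow> Lp_norm p M f < \<delta> \<Longrightarrow> (LINT x|M. norm (f x)) < e"
        using Lp_small_imp_L1_small[OF p p_ge_1] by blast
      obtain K where "\<And>n. n \<ge> K \<Longrightarrow> Lp_norm p M (?D n) < \<delta>"
        using LIMSEQ_D[OF Dlim \<delta>(1)] by (auto simp: Lp_norm_nonneg)
      then have "\<forall>n\<ge>K. norm ((LINT x|M. norm (?D n x)) - 0) < e" using \<delta>(2)[OF DL] by simp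
      then show "\<exists>K. \<forall>n\<ge>K. norm ((LINT x|M. norm (?D n x)) - 0) < e" by blast
    qed
    \<comment> \<open>This subsequence may depend on \<open>w\<close>; that does no harm, because
      \<open>v\<close> has already been fixed as the limit along \<open>r\<close>.\<close>
    then obtain r' where r': "strict_mono r'" "AE x in M. (\<lambda>n. ?D (r' n) x) \<longlonglongrightarrow> 0"
      using tendsto_L1_AE_subseq[where u = ?D, OF Lp_integrable[OF p_ge_1 DL]] by blast
    have "AE x in M. \<forall>n. u n (w, x) = A (\<lambda>x. s n (w, x)) x" using elim(3) by (simp add: AE_all_countable)
    then show ?case using elim(1) r'(2)
    proof eventually_elim
      case (elim x)
      have "(\<lambda>n. u (r (r' n)) (w, x)) \<longlonglongrightarrow> v (w, x)"
        using LIMSEQ_subseq_LIMSEQ[OF elim(2) r'(1)] by (simp add: o_def)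
      moreover have "(\<lambda>n. u (r (r' n)) (w, x)) \<longlonglongrightarrow> A (\<lambda>x. g (w, x)) x"
        using elim(1,3) by (simp add: LIM_zero_iff)
      ultimately show ?case by (rule LIMSEQ_unique)
    qed
  qed
  with v show "\<exists>v. param_value N g v" by (auto simp: param_value_def)
qed

lemma indicator_Lp:
  assumes "finite_measure N" "1 \<le> q" "E \<in> sets N" shows "(indicator E :: _ \<Rightarrow> complex) \<in> Lp q N"
proof -
  interpret N: finite_measure N by fact
  have 1: "(\<lambda>_. 1 :: complex) \<in> Lp q N"
  proof (cases "q = \<infinity>")
    case True
    then show ?thesis using Lp_infinityI(1)[of "\<lambda>_. 1 :: complex" N 1] by simp
  next
    case False
    then show ?thesis by (simp add: Lp_def)
  qed
  show ?thesis
    by (rule Lp_dominated(1)[OF assms(2), of "{()}" 1 _ _ "\<lambda>_ _. 1"]) (use assms(3) 1 in \<open>auto simp: indicator_def\<close>)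
qed

text \<open>On a rectangle the value is explicit: \<open>indicator X w * A (indicator Y) x\<close>.
  Sets that admit a measurable value are closed under complements by linearity and under countable
  disjoint unions by \<open>param_value_limit\<close>, so induction over the product sigma-algebra
  applies.\<close>

lemma param_value_indicator:
  assumes N: "finite_measure N" and p: "p \<noteq> \<infinity>" and E: "E \<in> sets (N \<Otimes>\<^sub>M M)"
  shows "\<exists>v. param_value N (indicator E) v"
proof -
  interpret N: finite_measure N by fact
  interpret P: pair_sigma_finite N M ..
  have NM: "finite_measure (N \<Otimes>\<^sub>M M)" using finite_measure_axioms N by (rule finite_measure_pair_measure)
  have rect: "\<exists>v. param_value N (indicator (X \<times> Y)) v" if X: "X \<in> sets N" and Y: "Y \<in> sets M" for X Y
  proof -
    have iY: "(indicator Y :: _ \<Rightarrow> complex) \<in> Lp p M" using finite_measure_axioms p_ge_1 Y by (rule indicator_Lp)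
    have [measurable]: "A (indicator Y) \<in> borel_measurable M" using maps[OF iY] by (rule Lp_measurable)
    have "AE x in M. indicator X w * A (indicator Y) x = A (\<lambda>x. indicator (X \<times> Y) (w, x)) x" for w
      using mult[OF iY, of "indicator X w"] by (simp add: indicator_times eq_commute)
    moreover have "(\<lambda>z. indicator X (fst z) * A (indicator Y) (snd z)) \<in> borel_measurable (N \<Otimes>\<^sub>M M)"
      using X by measurable
    ultimately have "param_value N (indicator (X \<times> Y)) (\<lambda>z. indicator X (fst z) * A (indicator Y) (snd z))"
      unfolding param_value_def by simp
    then show ?thesis by blast
  qed
  let ?G = "{X \<times> Y | X Y. X \<in> sets N \<and> Y \<in> sets M}"
  have ss: "sigma_sets (space N \<times> space M) ?G = sets (N \<Otimes>\<^sub>M M)" by (simp add: sets_pair_measure)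
  have "E \<in> sigma_sets (space N \<times> space M) ?G" using E ss by simp
  with Int_stable_pair_measure_generator pair_measure_closed show ?thesis
  proof (induction rule: sigma_sets_induct_disjoint)
    case (basic E)
    then show ?case using rect by blast
  next
    case empty
    show ?case using rect[of "{}" "{}"] unfolding Sigma_empty1 by blast
  next
    case (compl E)
    then obtain v where v: "param_value N (indicator E) v" by blast
    obtain v' where v': "param_value N (indicator (space N \<times> space M)) v'" using rect[of "space N" "space M"] by blast
    have E: "E \<in> sets (N \<Otimes>\<^sub>M M)" using compl ss by blast
    have sp: "space N \<times> space M \<in> sets (N \<Otimes>\<^sub>M M)" by simp
    note L = indicator_Lp[OF NM p_ge_1]
    have "param_value N (\<lambda>z. indicator (space N \<times> space M) z - indicator E z) (\<lambda>z. v' z - v z)"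
      by (rule param_value_diff[OF N L[OF sp] v' L[OF E] v])
    moreover have "(\<lambda>z. indicator (space N \<times> space M) z - indicator E z :: complex) = indicator (space N \<times> space M - E)"
      using sets.sets_into_space[OF E] by (auto simp: fun_eq_iff indicator_def space_pair_measure)
    ultimately show ?case by auto
  next
    case (union E)
    have E: "E i \<in> sets (N \<Otimes>\<^sub>M M)" for i using union ss by blast
    note L = indicator_Lp[OF NM p_ge_1]
    \<comment> \<open>Disjointness makes the indicator of a finite union a sum of indicators; the
      countable union is then a limit dominated by its own indicator.\<close>
    have fin: "\<exists>v. param_value N (indicator (\<Union>i<n. E i)) v" for n :: nat
    proof (induction n)
      case 0
      have "(\<Union>i<0::nat. E i) = {} \<times> {}" by simp
      then show ?case using rect[of "{}" "{}"] by (simp only:) blast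
    next
      case (Suc n)
      then obtain v where v: "param_value N (indicator (\<Union>i<n. E i)) v" by blast
      obtain v' where v': "param_value N (indicator (E n)) v'" using union(3) by blast
      have "param_value N (\<lambda>z. indicator (\<Union>i<n. E i) z + indicator (E n) z) (\<lambda>z. v z + v' z)"
        by (rule param_value_add[OF N L v L[OF E] v']) (use E in auto)
      moreover have "(\<lambda>z. indicator (\<Union>i<n. E i) z + indicator (E n) z :: complex) = indicator (\<Union>i<Suc n. E i)"
      proof -
        have "E i \<inter> E n = {}" if "i < n" for i
          using union(1) that unfolding disjoint_family_on_def by (metis UNIV_I less_irrefl)
        then have "(\<Union>i<n. E i) \<inter> E n = {}" by blast
        moreover have "(\<Union>i<Suc n. E i) = (\<Union>i<n. E i) \<union> E n" by (auto simp: less_Suc_eq)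
        ultimately show ?thesis by (auto simp: fun_eq_iff indicator_def)
      qed
      ultimately show ?case by auto
    qed
    then have "\<forall>n. \<exists>v. param_value N (indicator (\<Union>i<n. E i)) v" by blast
    from choice[OF this] obtain u where u: "\<And>n. param_value N (indicator (\<Union>i<n. E i)) (u n)" by blast
    show ?case
    proof (rule param_value_limit(2)[OF N p L u])
      show "(\<Union>i<n. E i) \<in> sets (N \<Otimes>\<^sub>M M)" for n :: nat using E by auto
      show "(indicator (\<Union>i. E i) :: _ \<Rightarrow> complex) \<in> borel_measurable (N \<Otimes>\<^sub>M M)" using E by measurable
      show "(indicator (\<Union>i. E i) :: _ \<Rightarrow> complex) \<in> Lp p (N \<Otimes>\<^sub>M M)" using E by (intro L) auto
      show "AE z in N \<Otimes>\<^sub>M M. norm (indicator (\<Union>i<n. E i) z :: complex) \<le> norm (indicator (\<Union>i. E i) z :: complex)" for n :: nat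
        by (intro AE_I2) (auto simp: indicator_def)
      show "AE z in N \<Otimes>\<^sub>M M. (\<lambda>n. indicator (\<Union>i<n. E i) z :: complex) \<longlonglongrightarrow> indicator (\<Union>i. E i) z"
        by (intro AE_I2 LIMSEQ_indicator_UN)
    qed
  qed
qed

theorem param_value_exists:
  assumes N: "finite_measure N" and p: "p \<noteq> \<infinity>" and g: "g \<in> Lp p (N \<Otimes>\<^sub>M M)"
  shows "\<exists>v. param_value N g v"
proof -
  have NM: "finite_measure (N \<Otimes>\<^sub>M M)" using finite_measure_axioms N by (rule finite_measure_pair_measure)
  note L = indicator_Lp[OF NM p_ge_1]
  note gm = Lp_measurable[OF g]
  have ex_sum: "(\<lambda>z. \<Sum>y\<in>Y. y * indicator (E y) z) \<in> Lp p (N \<Otimes>\<^sub>M M) \<and> (\<exists>v. param_value N (\<lambda>z. \<Sum>y\<in>Y. y * indicator (E y) z) v)"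
    if "finite Y" "\<And>y. y \<in> Y \<Longrightarrow> E y \<in> sets (N \<Otimes>\<^sub>M M)" for Y :: "complex set" and E
    using that
  proof (induction Y rule: finite_induct)
    case empty
    have "(\<lambda>z::'b \<times> 'a. \<Sum>y\<in>{}. y * indicator (E y) z) = (indicator {} :: _ \<Rightarrow> complex)" by (simp add: fun_eq_iff)
    then show ?case using param_value_indicator[OF N p, of "{}"] L[of "{}"] by (simp only:) blast
  next
    case (insert y Y)
    obtain v where v: "param_value N (indicator (E y)) v" using param_value_indicator[OF N p] insert by blast
    have EL: "(indicator (E y) :: _ \<Rightarrow> complex) \<in> Lp p (N \<Otimes>\<^sub>M M)" using insert by (intro L) auto
    obtain v' where v': "param_value N (\<lambda>z. \<Sum>y\<in>Y. y * indicator (E y) z) v'"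
      and S: "(\<lambda>z. \<Sum>y\<in>Y. y * indicator (E y) z) \<in> Lp p (N \<Otimes>\<^sub>M M)" using insert by auto
    from param_value_add[OF N Lp_mult(1)[OF p_ge_1 EL] param_value_mult[OF N EL v] S v', of y]
      Lp_add(1)[OF p_ge_1 Lp_mult(1)[OF p_ge_1 EL] S, of y]
    show ?case unfolding sum.insert[OF insert(1,2)] by blast
  qed
  \<comment> \<open>The approximating simple functions satisfy |s n| \<le> 2 |g|, so
    \<open>2 * g\<close> will serve as the dominating function.\<close>
  obtain s where s: "\<And>n. simple_function (N \<Otimes>\<^sub>M M) (s n)"
    "\<And>z. z \<in> space (N \<Otimes>\<^sub>M M) \<Longrightarrow> (\<lambda>n. s n z) \<longlonglongrightarrow> g z"
    "\<And>n z. z \<in> space (N \<Otimes>\<^sub>M M) \<Longrightarrow> dist (s n z) 0 \<le> 2 * dist (g z) 0"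
    using borel_measurable_implies_sequence_metric[OF gm, of 0] by blast
  let ?E = "\<lambda>n y. s n -` {y} \<inter> space (N \<Otimes>\<^sub>M M)" and ?Y = "\<lambda>n. s n ` space (N \<Otimes>\<^sub>M M)"
  let ?s = "\<lambda>n z. \<Sum>y\<in>?Y n. y * indicator (?E n y) z"
  have fin: "finite (?Y n)" for n using s(1) by (simp add: simple_function_def)
  have E: "?E n y \<in> sets (N \<Otimes>\<^sub>M M)" for n y using s(1) by (rule simple_functionD(2))
  have eq: "?s n z = s n z" if "z \<in> space (N \<Otimes>\<^sub>M M)" for n z
  proof -
    have "?s n z = (\<Sum>y\<in>?Y n. if s n z = y then y else 0)"
      using that by (intro sum.cong) (auto simp: indicator_def)
    also have "\<dots> = s n z" using that fin by (subst sum.delta') auto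
    finally show ?thesis .
  qed
  have ex: "?s n \<in> Lp p (N \<Otimes>\<^sub>M M) \<and> (\<exists>v. param_value N (?s n) v)" for n
    by (rule ex_sum[OF fin E])
  then have "\<forall>n. \<exists>v. param_value N (?s n) v" by blast
  from choice[OF this] obtain u where u: "\<And>n. param_value N (?s n) (u n)" by blast
  show ?thesis
  proof (rule param_value_limit(2)[OF N p _ u gm])
    show "?s n \<in> Lp p (N \<Otimes>\<^sub>M M)" for n using ex by blast
    show "(\<lambda>z. 2 * g z) \<in> Lp p (N \<Otimes>\<^sub>M M)" by (intro Lp_mult p_ge_1 g)
    show "AE z in N \<Otimes>\<^sub>M M. norm (?s n z) \<le> norm (2 * g z)" for n
      using s(3) by (intro AE_I2) (simp add: eq norm_mult)
    show "AE z in N \<Otimes>\<^sub>M M. (\<lambda>n. ?s n z) \<longlonglongrightarrow> g z"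
      using s(2) by (intro AE_I2) (simp add: eq)
  qed
qed

end

section \<open>Fubini on a product of two open sets\<close>

section \<open>Products of two domains\<close>

lemma finite_measure_cvol_on:
  assumes "finite I" "V \<in> sets (cvol I)" "\<And>z i. z \<in> V \<Longrightarrow> i \<in> I \<Longrightarrow> norm (z i) \<le> R"
  shows "finite_measure (cvol_on I V)"
proof (rule finite_measureI)
  interpret product_sigma_finite "\<lambda>_. lborel :: complex measure" ..
  let ?B = "\<Pi>\<^sub>E i\<in>I. cball 0 R :: complex set"
  have "V \<subseteq> space (cvol I)" using assms(2) by (rule sets.sets_into_space)
  then have "V \<subseteq> I \<rightarrow>\<^sub>E UNIV" by (simp add: space_PiM)
  then have "V \<subseteq> ?B" using assms(3) by (intro subsetI PiE_I) auto
  moreover have "?B \<in> sets (cvol I)" using assms(1) by (intro sets_PiM_I_finite) auto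
  ultimately have "emeasure (cvol I) V \<le> emeasure (cvol I) ?B" by (rule emeasure_mono)
  also have "\<dots> = (\<Prod>i\<in>I. emeasure lborel (cball (0 :: complex) R))"
    by (rule emeasure_PiM[OF assms(1)]) simp
  also have "\<dots> < \<infinity>"
    using emeasure_lborel_cball_finite[of "0 :: complex" R] by (simp add: power_less_top_ennreal)
  finally show "emeasure (cvol_on I V) (space (cvol_on I V)) \<noteq> \<infinity>"
    using assms(2) by (simp add: emeasure_restrict_space)
qed

lemma integral_cvol_on:
  fixes f :: "'i point \<Rightarrow> complex"
  assumes "finite I" "openin (ctop I) U"
  shows "(LINT z:U|cvol I. f z) = (LINT z|cvol_on I U. f z)"
  using openin_measurable[OF assms] by (subst integral_restrict_space) (auto simp: set_lebesgue_integral_def)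

lemma integrable_cvol_on:
  fixes f :: "'i point \<Rightarrow> complex"
  assumes "finite I" "openin (ctop I) U"
  shows "set_integrable (cvol I) U f \<longleftrightarrow> integrable (cvol_on I U) f"
  using openin_measurable[OF assms] by (subst integrable_restrict_space) (auto simp: set_integrable_def)

lemma AE_cvol_on:
  assumes "finite I" "openin (ctop I) U"
  shows "(AE z in cvol_on I U. P z) \<longleftrightarrow> (AE z in cvol I. z \<in> U \<longrightarrow> P z)"
  using openin_measurable[OF assms] by (intro AE_restrict_space_iff) auto

lemma integrable_imp_loc_integrable:
  assumes "finite I" "openin (ctop I) U" "integrable (cvol_on I U) u"
  shows "loc_integrable I U u"
  unfolding loc_integrable_def
proof (intro allI impI)
  fix K assume "compactin (ctop I) K \<and> K \<subseteq> U"
  then show "set_integrable (cvol I) K u"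
    using assms(3) compactin_measurable[OF assms(1)] unfolding integrable_cvol_on[OF assms(1,2), symmetric]
    by (auto intro: set_integrable_subset)
qed

lemma measurable_cvol_on: "f \<in> measurable (cvol I) N \<Longrightarrow> f \<in> measurable (cvol_on I U) N"
  by (rule measurable_restrict_space1)

lemma integrable_bounded_mult:
  fixes f g :: "'a \<Rightarrow> complex"
  assumes "integrable M f" "g \<in> borel_measurable M" "\<And>x. x \<in> space M \<Longrightarrow> norm (g x) \<le> B"
  shows "integrable M (\<lambda>x. f x * g x)"
proof (rule Bochner_Integration.integrable_bound[where f = "\<lambda>x. B * norm (f x)"])
  show "integrable M (\<lambda>x. B * norm (f x))" using assms(1) by simp
  show "AE x in M. norm (f x * g x) \<le> norm (B * norm (f x))"
  proof (rule AE_I2)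
    fix x assume x: "x \<in> space M"
    have "0 \<le> B" using assms(3)[OF x] norm_ge_zero order_trans by blast
    then show "norm (f x * g x) \<le> norm (B * norm (f x))"
      using assms(3)[OF x] by (simp add: norm_mult mult.commute[of B] mult_left_mono)
  qed
qed (use assms in auto)

locale product_pair =
  fixes I J :: "'i set" and V W U :: "'i point set"
  assumes finite: "finite I" "finite J" and disjoint: "I \<inter> J = {}"
    and open_V: "openin (ctop I) V" and open_W: "openin (ctop J) W"
    and U_eq: "U = {z \<in> I \<union> J \<rightarrow>\<^sub>E UNIV. restrict z I \<in> V \<and> restrict z J \<in> W}"
    and finite_measure_V: "finite_measure (cvol_on I V)" and finite_measure_W: "finite_measure (cvol_on J W)"
begin

abbreviation MV :: "'i point measure" where "MV \<equiv> cvol_on I V"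
abbreviation MW :: "'i point measure" where "MW \<equiv> cvol_on J W"
abbreviation MU :: "'i point measure" where "MU \<equiv> cvol_on (I \<union> J) U"

text \<open>The parameter comes first in the pair, the reverse of the order in \<open>merge\<close>,
  because slices of the product measure freeze the first component.\<close>

definition glue :: "'i point \<times> 'i point \<Rightarrow> 'i point" where
  "glue p = merge I J (snd p, fst p)"

lemma glue_Pair: "glue (w, x) = merge I J (x, w)"
  by (simp add: glue_def)

lemma V_subset: "V \<subseteq> I \<rightarrow>\<^sub>E UNIV" using openin_subset[OF open_V] by simp
lemma W_subset: "W \<subseteq> J \<rightarrow>\<^sub>E UNIV" using openin_subset[OF open_W] by simp
lemma U_subset: "U \<subseteq> I \<union> J \<rightarrow>\<^sub>E UNIV" by (auto simp: U_eq)

lemma restrict_glue: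
  assumes "x \<in> I \<rightarrow>\<^sub>E UNIV" "w \<in> J \<rightarrow>\<^sub>E UNIV"
  shows "restrict (merge I J (x, w)) I = x" "restrict (merge I J (x, w)) J = w"
    "merge I J (x, w) \<in> I \<union> J \<rightarrow>\<^sub>E UNIV"
  using assms disjoint by (auto simp: fun_eq_iff merge_def PiE_iff extensional_def)

lemma glue_in_U_iff:
  assumes "x \<in> I \<rightarrow>\<^sub>E UNIV" "w \<in> J \<rightarrow>\<^sub>E UNIV"
  shows "merge I J (x, w) \<in> U \<longleftrightarrow> x \<in> V \<and> w \<in> W"
  using restrict_glue[OF assms] by (auto simp: U_eq)

lemma open_U: "openin (ctop (I \<union> J)) U"
proof -
  have 1: "openin (ctop (I \<union> J)) {z \<in> topspace (ctop (I \<union> J)). restrict z I \<in> V}"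
    by (rule openin_continuous_map_preimage[OF continuous_map_restrict_ctop open_V]) simp
  have 2: "openin (ctop (I \<union> J)) {z \<in> topspace (ctop (I \<union> J)). restrict z J \<in> W}"
    by (rule openin_continuous_map_preimage[OF continuous_map_restrict_ctop open_W]) simp
  have 3: "U = {z \<in> topspace (ctop (I \<union> J)). restrict z I \<in> V} \<inter> {z \<in> topspace (ctop (I \<union> J)). restrict z J \<in> W}"
    by (auto simp: U_eq)
  show ?thesis unfolding 3 by (rule openin_Int[OF 1 2])
qed

lemma finite_IJ: "finite (I \<union> J)" using finite by simp

lemma space_MV: "space MV = V" and space_MW: "space MW = W" and space_MU: "space MU = U"
  using V_subset W_subset U_subset by (auto simp: space_restrict_space space_PiM)

sublocale V: finite_measure MV by (rule finite_measure_V)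
sublocale W: finite_measure MW by (rule finite_measure_W)
sublocale P: pair_sigma_finite MW MV ..

lemma measurable_glue: "glue \<in> measurable (MW \<Otimes>\<^sub>M MV) MU"
proof (rule measurable_restrict_space2)
  show "glue \<in> space (MW \<Otimes>\<^sub>M MV) \<rightarrow> U"
    using V_subset W_subset by (auto simp: space_pair_measure space_MV space_MW glue_Pair glue_in_U_iff subset_iff)
  have 1: "fst \<in> measurable (MW \<Otimes>\<^sub>M MV) (cvol J)" "snd \<in> measurable (MW \<Otimes>\<^sub>M MV) (cvol I)"
    using measurable_compose[OF measurable_fst measurable_cvol_on[OF measurable_ident]]
      measurable_compose[OF measurable_snd measurable_cvol_on[OF measurable_ident]] by (auto simp: id_def)
  show "glue \<in> measurable (MW \<Otimes>\<^sub>M MV) (cvol (I \<union> J))"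
    unfolding glue_def by (rule measurable_compose[OF measurable_Pair[OF 1(2,1)] measurable_merge])
qed

text \<open>Fubini on \<open>U\<close> is obtained by pulling everything back along
  \<open>glue\<close>. The measure of a set is an iterated integral of its indicator, which vanishes
  unless \<open>x \<in> V\<close> and \<open>w \<in> W\<close>; so both integrals may be
  restricted.\<close>

lemma MU_eq_distr: "MU = distr (MW \<Otimes>\<^sub>M MV) MU glue"
proof (rule measure_eqI)
  fix A assume A: "A \<in> sets MU"
  interpret product_sigma_finite "\<lambda>_. lborel :: complex measure" ..
  have Um: "U \<in> sets (cvol (I \<union> J))" using finite_IJ open_U by (rule openin_measurable)
  have Vm: "V \<in> sets (cvol I)" and Wm: "W \<in> sets (cvol J)"
    using openin_measurable finite open_V open_W by auto
  have A': "A \<in> sets (cvol (I \<union> J))" "A \<subseteq> U"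
    using A Um by (auto simp: sets_restrict_space_iff)
  \<comment> \<open>The integral over \<open>cvol J\<close> must be the outer one, so
    \<open>J \<union> I\<close> is split with the two parts of \<open>merge\<close> exchanged; on
    disjoint label sets this gives the same point.\<close>
  have sw: "merge J I (w, x) = merge I J (x, w)" for x w :: "'i point"
    using disjoint by (auto simp: merge_def fun_eq_iff)
  have "emeasure MU A = emeasure (cvol (J \<union> I)) A"
    using A' Um by (subst emeasure_restrict_space) (auto simp: Un_commute)
  also have "\<dots> = (\<integral>\<^sup>+z. indicator A z \<partial>cvol (J \<union> I))" using A'(1) by (simp add: Un_commute)
  also have "\<dots> = (\<integral>\<^sup>+w. (\<integral>\<^sup>+x. indicator A (merge J I (w, x)) \<partial>cvol I) \<partial>cvol J)"
    using A'(1) finite disjoint by (intro product_nn_integral_fold) (auto simp: Un_commute)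
  also have "\<dots> = (\<integral>\<^sup>+w. (\<integral>\<^sup>+x. indicator A (merge I J (x, w)) * indicator V x \<partial>cvol I) * indicator W w \<partial>cvol J)"
  proof (rule nn_integral_cong)
    fix w :: "'i point" assume "w \<in> space (cvol J)"
    then have w: "w \<in> J \<rightarrow>\<^sub>E UNIV" by (simp add: space_PiM)
    have *: "indicator A (merge J I (w, x)) = (indicator A (merge I J (x, w)) * indicator V x :: ennreal)"
      and **: "w \<notin> W \<Longrightarrow> indicator A (merge J I (w, x)) = (0 :: ennreal)" if "x \<in> space (cvol I)" for x
      using glue_in_U_iff[of x w] that w A'(2) by (auto simp: space_PiM sw indicator_def)
    show "(\<integral>\<^sup>+x. indicator A (merge J I (w, x)) \<partial>cvol I) =
        (\<integral>\<^sup>+x. indicator A (merge I J (x, w)) * indicator V x \<partial>cvol I) * indicator W w"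
    proof (cases "w \<in> W")
      case True
      then show ?thesis using * by (auto intro!: nn_integral_cong)
    next
      case False
      then have "(\<integral>\<^sup>+x. indicator A (merge J I (w, x)) \<partial>cvol I) = (\<integral>\<^sup>+x. 0 \<partial>cvol I)"
        using ** by (intro nn_integral_cong) auto
      then show ?thesis using False by simp
    qed
  qed
  also have "\<dots> = (\<integral>\<^sup>+w. (\<integral>\<^sup>+x. indicator A (glue (w, x)) \<partial>MV) \<partial>MW)"
    using Vm Wm by (simp add: nn_integral_restrict_space glue_Pair)
  also have "\<dots> = (\<integral>\<^sup>+p. indicator A (glue p) \<partial>(MW \<Otimes>\<^sub>M MV))"
    by (rule V.nn_integral_fst[OF measurable_compose[OF measurable_glue borel_measurable_indicator[OF A]]])
  also have "\<dots> = (\<integral>\<^sup>+z. indicator A z \<partial>distr (MW \<Otimes>\<^sub>M MV) MU glue)"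
    using A measurable_glue by (subst nn_integral_distr) auto
  also have "\<dots> = emeasure (distr (MW \<Otimes>\<^sub>M MV) MU glue) A" using A by simp
  finally show "emeasure MU A = emeasure (distr (MW \<Otimes>\<^sub>M MV) MU glue) A" .
qed simp

lemma AE_slice:
  assumes "AE z in MU. P z"
  shows "AE w in MW. AE x in MV. P (merge I J (x, w))"
proof -
  have "AE z in distr (MW \<Otimes>\<^sub>M MV) MU glue. P z" using assms by (simp only: MU_eq_distr[symmetric])
  from AE_distrD[OF measurable_glue this] have "AE p in MW \<Otimes>\<^sub>M MV. P (glue p)" .
  from P.AE_pair[OF this] show ?thesis by (simp add: glue_Pair)
qed

lemma AE_unslice:
  fixes u v :: "'i point \<Rightarrow> complex"
  assumes [measurable]: "u \<in> borel_measurable MU" "v \<in> borel_measurable MU"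
    and "AE w in MW. AE x in MV. u (merge I J (x, w)) = v (merge I J (x, w))"
  shows "AE z in MU. u z = v z"
proof -
  note [measurable] = measurable_glue
  have "AE p in MW \<Otimes>\<^sub>M MV. u (glue p) = v (glue p)"
    by (rule P.AE_pair_measure) (use assms(3) in \<open>auto simp: glue_Pair\<close>)
  then have "AE z in distr (MW \<Otimes>\<^sub>M MV) MU glue. u z = v z"
    by (subst AE_distr_iff) auto
  then show ?thesis by (simp only: MU_eq_distr[symmetric])
qed

lemma integrable_glue:
  fixes u :: "'i point \<Rightarrow> complex"
  assumes "integrable MU u"
  shows "integrable (MW \<Otimes>\<^sub>M MV) (\<lambda>p. u (glue p))"
proof -
  have "integrable (distr (MW \<Otimes>\<^sub>M MV) MU glue) u" using assms by (simp only: MU_eq_distr[symmetric])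
  from integrable_distr[OF measurable_glue this] show ?thesis .
qed

lemma integral_slice:
  fixes u :: "'i point \<Rightarrow> complex"
  assumes "integrable MU u"
  shows "(LINT z|MU. u z) = (LINT w|MW. (LINT x|MV. u (merge I J (x, w))))"
    and "integrable MW (\<lambda>w. LINT x|MV. u (merge I J (x, w)))"
    and "AE w in MW. integrable MV (\<lambda>x. u (merge I J (x, w)))"
proof -
  note int = integrable_glue[OF assms]
  have "(LINT z|MU. u z) = (LINT z|distr (MW \<Otimes>\<^sub>M MV) MU glue. u z)" by (simp only: MU_eq_distr[symmetric])
  also have "\<dots> = (LINT p|(MW \<Otimes>\<^sub>M MV). u (glue p))"
    by (intro integral_distr measurable_glue borel_measurable_integrable[OF assms])
  also have "\<dots> = (LINT w|MW. (LINT x|MV. u (merge I J (x, w))))"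
    using P.integral_fst'[OF int] by (simp add: glue_Pair)
  finally show "(LINT z|MU. u z) = (LINT w|MW. (LINT x|MV. u (merge I J (x, w))))" .
  show "integrable MW (\<lambda>w. LINT x|MV. u (merge I J (x, w)))"
    using P.integrable_fst'[OF int] by (simp add: glue_Pair)
  show "AE w in MW. integrable MV (\<lambda>x. u (merge I J (x, w)))"
    using P.AE_integrable_fst'[OF int] by (simp add: glue_Pair)
qed

lemma Lp_glue:
  assumes "u \<in> borel_measurable MU"
  shows "u \<in> Lp p MU \<longleftrightarrow> (\<lambda>q. u (glue q)) \<in> Lp p (MW \<Otimes>\<^sub>M MV)"
    "Lp_norm p MU u = Lp_norm p (MW \<Otimes>\<^sub>M MV) (\<lambda>q. u (glue q))"
  using Lp_distr[OF measurable_glue assms, of p] by (simp_all only: MU_eq_distr[symmetric])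

lemma restrict_in_V: "z \<in> U \<Longrightarrow> restrict z I \<in> V" and restrict_in_W: "z \<in> U \<Longrightarrow> restrict z J \<in> W"
  by (auto simp: U_eq)

lemma integrable_test_mult:
  assumes "integrable MU u" "\<phi> \<in> test_functions (I \<union> J) U"
  shows "integrable MU (\<lambda>z. u z * \<phi> z)"
proof -
  obtain B where "\<And>z. z \<in> I \<union> J \<rightarrow>\<^sub>E UNIV \<Longrightarrow> norm (\<phi> z) \<le> B" using test_function_bounded[OF assms(2)] by blast
  then show ?thesis
    using U_subset by (intro integrable_bounded_mult[OF assms(1), of _ B] measurable_cvol_on
        test_function_measurable[OF finite_IJ assms(2)]) (auto simp: space_MU)
qed

text \<open>A derivative in a variable of \<open>I\<close> acts within the slices, and slices of
  test functions are test functions on \<open>V\<close>. Integrating the slice identities over the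
  parameter gives the identity on \<open>U\<close>.\<close>

lemma has_weak_dbar_of_slices:
  assumes u: "integrable MU u" and g: "integrable MU g" and i: "i \<in> I"
    and sl: "AE w in MW. has_weak_dbar I V [i] (\<lambda>x. u (merge I J (x, w))) (\<lambda>x. g (merge I J (x, w)))"
  shows "has_weak_dbar (I \<union> J) U [i] u g"
  unfolding has_weak_dbar_def
proof (intro conjI ballI)
  show "loc_integrable (I \<union> J) U u" "loc_integrable (I \<union> J) U g"
    by (rule integrable_imp_loc_integrable[OF finite_IJ open_U], rule u g)+
  fix \<phi> assume \<phi>: "\<phi> \<in> test_functions (I \<union> J) U"
  have d\<phi>: "dbar i \<phi> \<in> test_functions (I \<union> J) U" using \<phi> i by (intro dbar_test_function) auto
  have "(LINT z:U|cvol (I \<union> J). u z * dbar i \<phi> z) =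
      (LINT w|MW. (LINT x|MV. u (merge I J (x, w)) * dbar i \<phi> (merge I J (x, w))))"
    unfolding integral_cvol_on[OF finite_IJ open_U] by (rule integral_slice(1)[OF integrable_test_mult[OF u d\<phi>]])
  also have "\<dots> = (LINT w|MW. - (LINT x|MV. g (merge I J (x, w)) * \<phi> (merge I J (x, w))))"
  proof (rule integral_cong_AE)
    show "(\<lambda>w. LINT x|MV. u (merge I J (x, w)) * dbar i \<phi> (merge I J (x, w))) \<in> borel_measurable MW"
      using integral_slice(2)[OF integrable_test_mult[OF u d\<phi>]] by (rule borel_measurable_integrable)
    show "(\<lambda>w. - (LINT x|MV. g (merge I J (x, w)) * \<phi> (merge I J (x, w)))) \<in> borel_measurable MW"
      using integral_slice(2)[OF integrable_test_mult[OF g \<phi>]]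
      by (intro borel_measurable_uminus) (rule borel_measurable_integrable)
    show "AE w in MW. (LINT x|MV. u (merge I J (x, w)) * dbar i \<phi> (merge I J (x, w))) =
        - (LINT x|MV. g (merge I J (x, w)) * \<phi> (merge I J (x, w)))"
      using sl AE_space
    proof eventually_elim
      case (elim w)
      then have w: "w \<in> J \<rightarrow>\<^sub>E UNIV" using W_subset by (auto simp: space_MW)
      have "(\<lambda>x. \<phi> (merge I J (x, w))) \<in> test_functions I V"
        by (rule test_function_slice[OF \<phi> w restrict_in_V])
      from has_weak_dbarD(3)[OF elim(1) this] show ?case
        by (simp add: integral_cvol_on[OF finite(1) open_V] dbar_merge[OF i])
    qed
  qed
  also have "\<dots> = - (LINT z:U|cvol (I \<union> J). g z * \<phi> z)"
    unfolding integral_cvol_on[OF finite_IJ open_U] integral_slice(1)[OF integrable_test_mult[OF g \<phi>]] by simp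
  finally show "(LINT z:U|cvol (I \<union> J). u z * foldr dbar [i] \<phi> z) =
      (-1) ^ length [i] * (LINT z:U|cvol (I \<union> J). g z * \<phi> z)" by simp
qed

end

section \<open>A countable family of test functions\<close>

text \<open>Closedness on almost every slice has to be checked against all test functions simultaneously,
  for which a countable family suffices that is dense with respect to uniform convergence of the
  \<open>\<partial>\<close>-bar derivatives.\<close>

definition first_match :: "'i set \<Rightarrow> (('i point \<times> 'i point) \<times> complex) list \<Rightarrow> 'i point \<Rightarrow> complex" where
  "first_match I L x =
     (case find (\<lambda>q. x \<in> open_box I (fst (fst q)) (snd (fst q))) L of None \<Rightarrow> 0 | Some q \<Rightarrow> snd q)"

text \<open>Compactness of the support yields finitely many rational boxes, each with a value that
  is accurate on the whole box, also at its points off the support. A point met by no box lies off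
  the support, where the default 0 is exact.\<close>

lemma countable_uniform_approximation:
  assumes "finite I"
  obtains S :: "('i point \<Rightarrow> complex) set" where "countable S"
    "\<And>\<psi> V \<epsilon>. \<psi> \<in> test_functions I V \<Longrightarrow> 0 < \<epsilon> \<Longrightarrow>
      \<exists>s\<in>S. \<forall>x\<in>I \<rightarrow>\<^sub>E UNIV. norm (\<psi> x - s x) < \<epsilon>"
proof -
  obtain D :: "complex set" where D: "countable D" "\<And>X. open X \<Longrightarrow> X \<noteq> {} \<Longrightarrow> \<exists>d\<in>D. d \<in> X"
    using countable_dense_setE by blast
  let ?X = "(rational_points I \<times> rational_points I) \<times> D"
  have X: "countable ?X" using countable_rational_points[OF assms] D(1) by blast
  have "\<exists>s\<in>first_match I ` lists ?X. \<forall>x\<in>I \<rightarrow>\<^sub>E UNIV. norm (\<psi> x - s x) < \<epsilon>"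
    if \<psi>: "\<psi> \<in> test_functions I V" and \<epsilon>: "0 < \<epsilon>" for \<psi> V \<epsilon>
  proof -
    have cont: "continuous_map (ctop I) euclidean \<psi>" using C_diff_continuous[OF test_functionsD[OF \<psi>, of 0]] .
    obtain K where K: "compactin (ctop I) K" "\<And>z. z \<in> (I \<rightarrow>\<^sub>E UNIV) - K \<Longrightarrow> \<psi> z = 0"
      using \<psi> by (auto simp: test_functions_def)
    let ?box = "\<lambda>q :: ('i point \<times> 'i point) \<times> complex. open_box I (fst (fst q)) (snd (fst q))"
    let ?P = "{q \<in> ?X. \<forall>y\<in>?box q. norm (\<psi> y - snd q) < \<epsilon>}"
    have "K \<subseteq> \<Union>(?box ` ?P)"
    proof
      fix z assume "z \<in> K"
      then have z: "z \<in> topspace (ctop I)" using compactin_subset_topspace[OF K(1)] by blast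
      obtain c where c: "c \<in> D" "c \<in> ball (\<psi> z) (\<epsilon> / 2)" using D(2)[of "ball (\<psi> z) (\<epsilon> / 2)"] \<epsilon> by auto
      have "openin (ctop I) {y \<in> topspace (ctop I). \<psi> y \<in> ball (\<psi> z) (\<epsilon> / 2)}"
        by (rule openin_continuous_map_preimage[OF cont]) simp
      moreover have "z \<in> {y \<in> topspace (ctop I). \<psi> y \<in> ball (\<psi> z) (\<epsilon> / 2)}" using z \<epsilon> by simp
      ultimately obtain \<alpha> \<beta> where ab: "\<alpha> \<in> rational_points I" "\<beta> \<in> rational_points I" "z \<in> open_box I \<alpha> \<beta>"
        "closed_box I \<alpha> \<beta> \<subseteq> {y \<in> topspace (ctop I). \<psi> y \<in> ball (\<psi> z) (\<epsilon> / 2)}"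
        by (rule rational_box_in_open[OF assms])
      have "norm (\<psi> y - c) < \<epsilon>" if "y \<in> open_box I \<alpha> \<beta>" for y
      proof -
        have "\<psi> y \<in> ball (\<psi> z) (\<epsilon> / 2)" using that ab(4) open_box_subset_closed_box by blast
        then have "dist (\<psi> z) (\<psi> y) < \<epsilon> / 2" "dist (\<psi> z) c < \<epsilon> / 2" using c(2) by auto
        then have "dist (\<psi> y) c < \<epsilon>" by (rule dist_triangle_half_r)
        then show ?thesis by (simp add: dist_norm)
      qed
      then have "((\<alpha>, \<beta>), c) \<in> ?P" using ab c by simp
      then show "z \<in> \<Union>(?box ` ?P)" using ab(3) by (intro UN_I[of "((\<alpha>, \<beta>), c)"]) simp_all
    qed
    moreover have "openin (ctop I) X" if "X \<in> ?box ` ?P" for X using that openin_open_box[OF assms] by blast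
    ultimately have "\<exists>\<F>. finite \<F> \<and> \<F> \<subseteq> ?box ` ?P \<and> K \<subseteq> \<Union>\<F>"
      using compactinD[OF K(1), of "?box ` ?P"] by blast
    then obtain \<F> where \<F>: "finite \<F>" "\<F> \<subseteq> ?box ` ?P" "K \<subseteq> \<Union>\<F>" by blast
    obtain C where C: "C \<subseteq> ?P" "finite C" "\<F> = ?box ` C"
      using finite_subset_image[OF \<F>(1,2)] by blast
    have KC: "K \<subseteq> \<Union>(?box ` C)" using \<F>(3) unfolding C(3) .
    obtain L where L: "set L = C" using finite_list[OF C(2)] by blast
    have "norm (\<psi> x - first_match I L x) < \<epsilon>" if x: "x \<in> I \<rightarrow>\<^sub>E UNIV" for x
    proof (cases "find (\<lambda>q. x \<in> ?box q) L")
      case None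
      then have "\<not> (\<exists>q. q \<in> set L \<and> x \<in> ?box q)" by (simp add: find_None_iff)
      then have "x \<notin> K" using KC L by blast
      then have "\<psi> x = 0" using K(2) x by blast
      then show ?thesis using None \<epsilon> by (simp add: first_match_def)
    next
      case (Some q)
      then obtain m where "m < length L" "x \<in> ?box (L ! m)" "q = L ! m" unfolding find_Some_iff by blast
      then have "q \<in> ?P" "x \<in> ?box q" using C(1) L nth_mem by blast+
      then show ?thesis using Some by (simp add: first_match_def)
    qed
    moreover have "L \<in> lists ?X" using C(1) L by auto
    ultimately show ?thesis by blast
  qed
  moreover have "countable (first_match I ` lists ?X)" using X by (intro countable_image countable_lists)
  ultimately show thesis by (rule that[rotated])
qed

text \<open>Step functions are not smooth. For each tuple of them and each accuracy reached by some
  test function, one such test function is selected, and the triangle inequality accounts for the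
  factor 2. Only first \<open>dbar\<close> derivatives are approximated, as nothing else enters a
  test of closedness.\<close>

lemma countable_dense_test_functions:
  fixes I :: "'i set"
  assumes "finite I"
  obtains \<D> where "countable \<D>" "\<D> \<subseteq> test_functions I V"
    "\<And>\<phi>. \<phi> \<in> test_functions I V \<Longrightarrow>
      \<exists>s. \<forall>m. s m \<in> \<D> \<and> (\<forall>i\<in>I. \<forall>x\<in>I \<rightarrow>\<^sub>E UNIV. norm (dbar i (s m) x - dbar i \<phi> x) < 2 * inverse (real (Suc m)))"
proof -
  obtain S :: "('i point \<Rightarrow> complex) set" where S: "countable S"
    "\<And>\<psi> V \<epsilon>. \<psi> \<in> test_functions I V \<Longrightarrow> 0 < \<epsilon> \<Longrightarrow> \<exists>s\<in>S. \<forall>x\<in>I \<rightarrow>\<^sub>E UNIV. norm (\<psi> x - s x) < \<epsilon>"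
    using countable_uniform_approximation[OF assms] by blast
  define near where "near \<phi> \<sigma> m \<longleftrightarrow> \<phi> \<in> test_functions I V \<and>
    (\<forall>i\<in>I. \<forall>x\<in>I \<rightarrow>\<^sub>E UNIV. norm (dbar i \<phi> x - \<sigma> i x) < inverse (real (Suc m)))" for \<phi> \<sigma> m
  define pick where "pick = (\<lambda>(\<sigma>, m). SOME \<phi>. near \<phi> \<sigma> m)"
  \<comment> \<open>Tuples near which there is no test function are left out, so that every selected
    function is a genuine test function.\<close>
  let ?X = "{q \<in> (I \<rightarrow>\<^sub>E S) \<times> UNIV. \<exists>\<phi>. near \<phi> (fst q) (snd q)}"
  have pick: "near (pick (\<sigma>, m)) \<sigma> m" if "near \<phi> \<sigma> m" for \<phi> \<sigma> m
    unfolding pick_def using someI[of "\<lambda>\<phi>. near \<phi> \<sigma> m", OF that] by simp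
  have "countable ((I \<rightarrow>\<^sub>E S) \<times> (UNIV :: nat set))"
    using countable_PiE[OF assms, of "\<lambda>_. S"] S(1) by blast
  then have "countable ?X" by (rule countable_subset[rotated]) blast
  then have 1: "countable (pick ` ?X)" by (rule countable_image)
  have 2: "pick ` ?X \<subseteq> test_functions I V"
    using pick by (auto simp: near_def)
  have 3: "\<exists>s. \<forall>m. s m \<in> pick ` ?X \<and>
      (\<forall>i\<in>I. \<forall>x\<in>I \<rightarrow>\<^sub>E UNIV. norm (dbar i (s m) x - dbar i \<phi> x) < 2 * inverse (real (Suc m)))"
    if \<phi>: "\<phi> \<in> test_functions I V" for \<phi>
  proof (intro choice allI)
    fix m :: nat
    have "\<forall>i\<in>I. \<exists>s. s \<in> S \<and> (\<forall>x\<in>I \<rightarrow>\<^sub>E UNIV. norm (dbar i \<phi> x - s x) < inverse (real (Suc m)))"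
    proof
      fix i assume "i \<in> I"
      from S(2)[OF dbar_test_function[OF \<phi> this], of "inverse (real (Suc m))"]
      show "\<exists>s. s \<in> S \<and> (\<forall>x\<in>I \<rightarrow>\<^sub>E UNIV. norm (dbar i \<phi> x - s x) < inverse (real (Suc m)))" by auto
    qed
    from bchoice[OF this] obtain \<sigma>' where
      \<sigma>': "\<forall>i\<in>I. \<sigma>' i \<in> S \<and> (\<forall>x\<in>I \<rightarrow>\<^sub>E UNIV. norm (dbar i \<phi> x - \<sigma>' i x) < inverse (real (Suc m)))" ..
    define \<sigma> where "\<sigma> = restrict \<sigma>' I"
    have \<sigma>: "\<sigma> \<in> I \<rightarrow>\<^sub>E S" "near \<phi> \<sigma> m" using \<sigma>' \<phi> by (auto simp: \<sigma>_def near_def)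
    let ?\<psi> = "pick (\<sigma>, m)"
    have "?\<psi> \<in> pick ` ?X" using \<sigma> by (intro imageI) auto
    moreover have "norm (dbar i ?\<psi> x - dbar i \<phi> x) < 2 * inverse (real (Suc m))" if "i \<in> I" "x \<in> I \<rightarrow>\<^sub>E UNIV" for i x
    proof -
      have "dist (\<sigma> i x) (dbar i ?\<psi> x) < 2 * inverse (real (Suc m)) / 2" "dist (\<sigma> i x) (dbar i \<phi> x) < 2 * inverse (real (Suc m)) / 2"
        using pick[OF \<sigma>(2)] \<sigma>(2) that by (simp_all add: near_def dist_norm norm_minus_commute)
      then have "dist (dbar i ?\<psi> x) (dbar i \<phi> x) < 2 * inverse (real (Suc m))" by (rule dist_triangle_half_r)
      then show ?thesis by (simp add: dist_norm)
    qed
    ultimately show "\<exists>y. y \<in> pick ` ?X \<and>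
      (\<forall>i\<in>I. \<forall>x\<in>I \<rightarrow>\<^sub>E UNIV. norm (dbar i y x - dbar i \<phi> x) < 2 * inverse (real (Suc m)))" by blast
  qed
  from that[OF 1 2 3] show thesis .
qed

context product_pair begin

text \<open>\<open>F w\<close> is the defect of closedness on the slice at \<open>w\<close>, tested
  with \<open>\<phi>\<close>. Testing the form with the product of \<open>\<phi>\<close> and an
  arbitrary \<open>\<psi>\<close> in the parameters shows that \<open>F\<close> integrates to 0
  against every \<open>\<psi>\<close>, so \<open>F = 0\<close> a.e.; the null set still depends on
  \<open>\<phi>\<close>.\<close>

lemma closed_tested_slices:
  assumes \<alpha>: "\<And>i. i \<in> I \<Longrightarrow> integrable MU (\<alpha> i)" and closed: "dbar_closed (I \<union> J) U \<alpha>"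
    and \<phi>: "\<phi> \<in> test_functions I V" and il: "i \<in> I" "l \<in> I"
  shows "AE w in MW. (LINT x|MV. \<alpha> l (merge I J (x, w)) * dbar i \<phi> x) = (LINT x|MV. \<alpha> i (merge I J (x, w)) * dbar l \<phi> x)"
proof -
  have mult: "integrable MU (\<lambda>z. \<alpha> a z * dbar b \<phi> (restrict z I))" if ab: "a \<in> I" "b \<in> I" for a b
  proof -
    note d = dbar_test_function[OF \<phi> ab(2)]
    obtain B where "\<And>z. z \<in> I \<rightarrow>\<^sub>E UNIV \<Longrightarrow> norm (dbar b \<phi> z) \<le> B" using test_function_bounded[OF d] by blast
    moreover have "(\<lambda>z. dbar b \<phi> (restrict z I)) \<in> borel_measurable MU"
      by (intro measurable_cvol_on measurable_compose[OF measurable_restrict_subset test_function_measurable[OF finite(1) d]]) auto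
    ultimately show ?thesis
      using U_subset by (intro integrable_bounded_mult[OF \<alpha>[OF ab(1)], of _ B]) (auto simp: space_MU PiE_iff)
  qed
  define H where "H z = \<alpha> l z * dbar i \<phi> (restrict z I) - \<alpha> i z * dbar l \<phi> (restrict z I)" for z
  have H: "integrable MU H" unfolding H_def using mult il by (intro Bochner_Integration.integrable_diff)
  define F where "F w = (LINT x|MV. H (merge I J (x, w)))" for w
  have F: "integrable MW F" unfolding F_def by (rule integral_slice(2)[OF H])
  have "AE w in cvol J. w \<in> W \<longrightarrow> F w = 0"
  proof (rule fundamental_lemma[OF finite(2) open_W])
    show "loc_integrable J W F" by (rule integrable_imp_loc_integrable[OF finite(2) open_W F])
    fix \<psi> assume \<psi>: "\<psi> \<in> test_functions J W"
    define \<Phi> where "\<Phi> z = \<phi> (restrict z I) * \<psi> (restrict z J)" for z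
    have \<Phi>: "\<Phi> \<in> test_functions (I \<union> J) U"
      unfolding \<Phi>_def by (rule test_function_product[OF \<phi> \<psi> disjoint]) (simp add: U_eq)
    have d\<Phi>: "dbar a \<Phi> \<in> test_functions (I \<union> J) U" if "a \<in> I" for a using \<Phi> that by (intro dbar_test_function) auto
    have eq: "dbar a \<Phi> z = dbar a \<phi> (restrict z I) * \<psi> (restrict z J)" if "a \<in> I" "z \<in> U" for a z
      unfolding \<Phi>_def using test_functionsD[OF \<phi>, of 1] U_subset that by (intro dbar_product disjoint) auto
    obtain B where B: "\<And>z. z \<in> J \<rightarrow>\<^sub>E UNIV \<Longrightarrow> norm (\<psi> z) \<le> B" using test_function_bounded[OF \<psi>] by blast
    have "(\<lambda>z. \<psi> (restrict z J)) \<in> borel_measurable MU"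
      by (intro measurable_cvol_on measurable_compose[OF measurable_restrict_subset test_function_measurable[OF finite(2) \<psi>]]) auto
    then have H\<psi>: "integrable MU (\<lambda>z. H z * \<psi> (restrict z J))"
      using U_subset by (intro integrable_bounded_mult[OF H, of _ B] B) (auto simp: space_MU PiE_iff)
    have "(LINT w:W|cvol J. F w * \<psi> w) = (LINT w|MW. (LINT x|MV. H (merge I J (x, w)) * \<psi> (restrict (merge I J (x, w)) J)))"
      unfolding integral_cvol_on[OF finite(2) open_W]
    proof (rule Bochner_Integration.integral_cong[OF refl])
      fix w assume "w \<in> space MW"
      then have w: "w \<in> J \<rightarrow>\<^sub>E UNIV" using W_subset by (auto simp: space_MW)
      have "(LINT x|MV. H (merge I J (x, w)) * \<psi> (restrict (merge I J (x, w)) J)) = (LINT x|MV. H (merge I J (x, w)) * \<psi> w)"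
      proof (rule Bochner_Integration.integral_cong[OF refl])
        fix x assume "x \<in> space MV"
        then have "x \<in> I \<rightarrow>\<^sub>E UNIV" using V_subset by (auto simp: space_MV)
        then show "H (merge I J (x, w)) * \<psi> (restrict (merge I J (x, w)) J) = H (merge I J (x, w)) * \<psi> w"
          using restrict_glue(2)[OF _ w] by simp
      qed
      then show "F w * \<psi> w = (LINT x|MV. H (merge I J (x, w)) * \<psi> (restrict (merge I J (x, w)) J))"
        by (simp add: F_def)
    qed
    also have "\<dots> = (LINT z|MU. H z * \<psi> (restrict z J))"
      by (rule integral_slice(1)[OF H\<psi>, symmetric])
    also have "\<dots> = (LINT z|MU. \<alpha> l z * dbar i \<Phi> z - \<alpha> i z * dbar l \<Phi> z)"
      by (rule Bochner_Integration.integral_cong[OF refl]) (simp add: H_def eq il space_MU algebra_simps)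
    also have "\<dots> = (LINT z|MU. \<alpha> l z * dbar i \<Phi> z) - (LINT z|MU. \<alpha> i z * dbar l \<Phi> z)"
      by (intro Bochner_Integration.integral_diff integrable_test_mult \<alpha> il d\<Phi>)
    also have "\<dots> = 0"
      using closed il \<Phi> by (simp add: dbar_closed_def integral_cvol_on[OF finite_IJ open_U, symmetric])
    finally show "(LINT w:W|cvol J. F w * \<psi> w) = 0" .
  qed
  then have "AE w in MW. F w = 0" by (simp add: AE_cvol_on[OF finite(2) open_W])
  then show ?thesis
    using integral_slice(3)[OF mult[OF il(2,1)]] integral_slice(3)[OF mult[OF il]] AE_space
  proof eventually_elim
    case (elim w)
    then have w: "w \<in> J \<rightarrow>\<^sub>E UNIV" using W_subset by (auto simp: space_MW)
    have r: "(LINT x|MV. \<alpha> a (merge I J (x, w)) * dbar b \<phi> (restrict (merge I J (x, w)) I)) =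
        (LINT x|MV. \<alpha> a (merge I J (x, w)) * dbar b \<phi> x)" for a b
    proof (rule Bochner_Integration.integral_cong[OF refl])
      fix x assume "x \<in> space MV"
      then have "x \<in> I \<rightarrow>\<^sub>E UNIV" using V_subset by (auto simp: space_MV)
      then show "\<alpha> a (merge I J (x, w)) * dbar b \<phi> (restrict (merge I J (x, w)) I) = \<alpha> a (merge I J (x, w)) * dbar b \<phi> x"
        using restrict_glue(1)[OF _ w] by simp
    qed
    have "F w = (LINT x|MV. \<alpha> l (merge I J (x, w)) * dbar i \<phi> (restrict (merge I J (x, w)) I)) -
        (LINT x|MV. \<alpha> i (merge I J (x, w)) * dbar l \<phi> (restrict (merge I J (x, w)) I))"
      unfolding F_def H_def by (rule Bochner_Integration.integral_diff[OF elim(2,3)])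
    then show ?case using elim(1) by (simp only: r) simp
  qed
qed

text \<open>Countably many test functions share one null set of parameters. Outside it an arbitrary
  test function is reached by dominated convergence, its \<open>dbar\<close> derivatives being
  uniform limits.\<close>

lemma dbar_closed_slices:
  assumes \<alpha>: "\<And>i. i \<in> I \<Longrightarrow> integrable MU (\<alpha> i)" and closed: "dbar_closed (I \<union> J) U \<alpha>"
  shows "AE w in MW. dbar_closed I V (\<lambda>i x. \<alpha> i (merge I J (x, w)))"
proof -
  obtain \<D> where \<D>: "countable \<D>" "\<D> \<subseteq> test_functions I V"
    "\<And>\<phi>. \<phi> \<in> test_functions I V \<Longrightarrow>
      \<exists>s. \<forall>m. s m \<in> \<D> \<and> (\<forall>i\<in>I. \<forall>x\<in>I \<rightarrow>\<^sub>E UNIV. norm (dbar i (s m) x - dbar i \<phi> x) < 2 * inverse (real (Suc m)))"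
    using countable_dense_test_functions[OF finite(1)] by blast
  have "AE w in MW. \<forall>q\<in>\<D> \<times> I \<times> I.
      (LINT x|MV. \<alpha> (snd (snd q)) (merge I J (x, w)) * dbar (fst (snd q)) (fst q) x) =
      (LINT x|MV. \<alpha> (fst (snd q)) (merge I J (x, w)) * dbar (snd (snd q)) (fst q) x)"
  proof (subst AE_ball_countable)
    show "countable (\<D> \<times> I \<times> I)" by (intro countable_SIGMA \<D>(1) countable_finite finite)
  next
    show "\<forall>q\<in>\<D> \<times> I \<times> I. AE w in MW.
      (LINT x|MV. \<alpha> (snd (snd q)) (merge I J (x, w)) * dbar (fst (snd q)) (fst q) x) =
      (LINT x|MV. \<alpha> (fst (snd q)) (merge I J (x, w)) * dbar (snd (snd q)) (fst q) x)"
    proof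
      fix q assume "q \<in> \<D> \<times> I \<times> I"
      then have "fst q \<in> test_functions I V" "fst (snd q) \<in> I" "snd (snd q) \<in> I" using \<D>(2) by auto
      from closed_tested_slices[OF \<alpha> closed this]
      show "AE w in MW. (LINT x|MV. \<alpha> (snd (snd q)) (merge I J (x, w)) * dbar (fst (snd q)) (fst q) x) =
        (LINT x|MV. \<alpha> (fst (snd q)) (merge I J (x, w)) * dbar (snd (snd q)) (fst q) x)" .
    qed
  qed
  moreover have "AE w in MW. \<forall>i\<in>I. integrable MV (\<lambda>x. \<alpha> i (merge I J (x, w)))"
    using integral_slice(3)[OF \<alpha>] by (subst AE_ball_countable[OF countable_finite[OF finite(1)]]) blast
  ultimately show ?thesis
  proof eventually_elim
    case (elim w)
    have int: "integrable MV (\<lambda>x. \<alpha> i (merge I J (x, w)))" if "i \<in> I" for i using elim(2) that by blast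
    have lim: "(\<lambda>m. LINT x|MV. \<alpha> a (merge I J (x, w)) * dbar b (s m) x) \<longlonglongrightarrow> (LINT x|MV. \<alpha> a (merge I J (x, w)) * dbar b \<phi> x)"
      if ab: "a \<in> I" "b \<in> I" and \<phi>: "\<phi> \<in> test_functions I V" and s: "\<And>m. s m \<in> test_functions I V"
        "\<And>m x. x \<in> I \<rightarrow>\<^sub>E UNIV \<Longrightarrow> norm (dbar b (s m) x - dbar b \<phi> x) < 2 * inverse (real (Suc m))" for a b \<phi> s
    proof -
      have meas: "dbar b \<psi> \<in> borel_measurable MV" if "\<psi> \<in> test_functions I V" for \<psi>
        by (rule measurable_cvol_on[OF test_function_measurable[OF finite(1) dbar_test_function[OF that ab(2)]]])
      note [measurable] = meas[OF \<phi>] meas[OF s(1)] borel_measurable_integrable[OF int[OF ab(1)]]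
      obtain B where B: "\<And>z. z \<in> I \<rightarrow>\<^sub>E UNIV \<Longrightarrow> norm (dbar b \<phi> z) \<le> B"
        using test_function_bounded[OF dbar_test_function[OF \<phi> ab(2)]] by blast
      have inI: "x \<in> I \<rightarrow>\<^sub>E UNIV" if "x \<in> space MV" for x using that V_subset by (auto simp: space_MV)
      show ?thesis
      \<comment> \<open>\<open>B\<close> bounds the limit \<open>dbar b \<phi>\<close>, and the
        distance to it is below 2/(m+1), hence at most 2.\<close>
      proof (rule integral_dominated_convergence[where w = "\<lambda>x. (B + 2) * norm (\<alpha> a (merge I J (x, w)))"])
        show "integrable MV (\<lambda>x. (B + 2) * norm (\<alpha> a (merge I J (x, w))))" using int[OF ab(1)] by simp
        show "AE x in MV. (\<lambda>m. \<alpha> a (merge I J (x, w)) * dbar b (s m) x) \<longlonglongrightarrow> \<alpha> a (merge I J (x, w)) * dbar b \<phi> x"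
        proof (intro AE_I2 tendsto_mult_left)
          fix x assume x: "x \<in> space MV"
          have "(\<lambda>m. norm (dbar b (s m) x - dbar b \<phi> x)) \<longlonglongrightarrow> 0"
          proof (rule tendsto_sandwich[OF _ _ tendsto_const])
            show "(\<lambda>m. 2 * inverse (real (Suc m))) \<longlonglongrightarrow> 0"
              using tendsto_mult_right_zero[OF LIMSEQ_inverse_real_of_nat, of 2] by simp
            show "\<forall>\<^sub>F m in sequentially. norm (dbar b (s m) x - dbar b \<phi> x) \<le> 2 * inverse (real (Suc m))"
              using s(2)[OF inI[OF x]] by (intro always_eventually allI less_imp_le)
          qed simp
          then show "(\<lambda>m. dbar b (s m) x) \<longlonglongrightarrow> dbar b \<phi> x"
            by (simp add: tendsto_norm_zero_iff LIM_zero_iff)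
        qed
        show "AE x in MV. norm (\<alpha> a (merge I J (x, w)) * dbar b (s m) x) \<le> (B + 2) * norm (\<alpha> a (merge I J (x, w)))" for m
        proof (rule AE_I2)
          fix x assume x: "x \<in> space MV"
          have "inverse (real (Suc m)) \<le> 1" by (simp add: inverse_le_1_iff)
          then have "norm (dbar b (s m) x - dbar b \<phi> x) \<le> 2" using s(2)[OF inI[OF x], of m] by linarith
          then have "norm (dbar b (s m) x) \<le> B + 2"
            using B[OF inI[OF x]] norm_triangle_sub[of "dbar b (s m) x" "dbar b \<phi> x"] by linarith
          then show "norm (\<alpha> a (merge I J (x, w)) * dbar b (s m) x) \<le> (B + 2) * norm (\<alpha> a (merge I J (x, w)))"
            by (simp add: norm_mult mult.commute mult_right_mono)
        qed
      qed measurable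
    qed
    show ?case
      unfolding dbar_closed_def
    proof (intro conjI ballI)
      show "loc_integrable I V (\<lambda>x. \<alpha> i (merge I J (x, w)))" if "i \<in> I" for i
        by (rule integrable_imp_loc_integrable[OF finite(1) open_V int[OF that]])
      fix i l \<phi> assume il: "i \<in> I" "l \<in> I" and \<phi>: "\<phi> \<in> test_functions I V"
      obtain s where s: "\<And>m. s m \<in> \<D>"
        "\<And>m a x. a \<in> I \<Longrightarrow> x \<in> I \<rightarrow>\<^sub>E UNIV \<Longrightarrow> norm (dbar a (s m) x - dbar a \<phi> x) < 2 * inverse (real (Suc m))"
        using \<D>(3)[OF \<phi>] by blast
      have st: "s m \<in> test_functions I V" for m using s(1) \<D>(2) by blast
      have "(LINT x|MV. \<alpha> l (merge I J (x, w)) * dbar i (s m) x) = (LINT x|MV. \<alpha> i (merge I J (x, w)) * dbar l (s m) x)" for m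
        using elim(1) s(1)[of m] il by force
      with lim[OF il(2,1) \<phi> st s(2)[OF il(1)]] lim[OF il \<phi> st s(2)[OF il(2)]]
      have "(LINT x|MV. \<alpha> l (merge I J (x, w)) * dbar i \<phi> x) = (LINT x|MV. \<alpha> i (merge I J (x, w)) * dbar l \<phi> x)"
        by (simp add: LIMSEQ_unique)
      then show "(LINT x:V|cvol I. \<alpha> l (merge I J (x, w)) * dbar i \<phi> x) = (LINT x:V|cvol I. \<alpha> i (merge I J (x, w)) * dbar l \<phi> x)"
        by (simp add: integral_cvol_on[OF finite(1) open_V])
    qed
  qed
qed

end

section \<open>Operators on forms, applied to the slices of a product\<close>

section \<open>Solution operators with parameters\<close>

lemma (in product_pair) finite_measure_U: "finite_measure MU"
proof (rule finite_measureI)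
  have "emeasure (distr (MW \<Otimes>\<^sub>M MV) MU glue) (space MU) = emeasure (MW \<Otimes>\<^sub>M MV) (space (MW \<Otimes>\<^sub>M MV))"
    using measurable_space[OF measurable_glue]
    by (subst emeasure_distr[OF measurable_glue]) (auto intro!: arg_cong[where f = "emeasure _"])
  also have "\<dots> < \<infinity>"
    using finite_measure.emeasure_finite[OF finite_measure_pair_measure[OF finite_measure_V finite_measure_W]]
    by (simp add: less_top)
  finally show "emeasure MU (space MU) \<noteq> \<infinity>" by (simp only: MU_eq_distr[symmetric])
qed

locale form_operator = product_pair I J V W U
  for I J :: "'i set" and V W U :: "'i point set" +
  fixes p :: ennreal and T :: "'i form01 \<Rightarrow> 'i point \<Rightarrow> complex"
  assumes p_ge_1: "1 \<le> p" and bounded_linear: "bounded_linear_Lp p I V T"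
begin

definition pvalue :: "'i form01 \<Rightarrow> ('i point \<Rightarrow> complex) \<Rightarrow> bool" where
  "pvalue g u \<longleftrightarrow> u \<in> borel_measurable MU \<and>
     (AE w in MW. AE x in MV. u (merge I J (x, w)) = T (\<lambda>i y. g i (merge I J (y, w))) x)"

lemma T_Lp: "\<alpha> \<in> Lp_forms p I MV \<Longrightarrow> T \<alpha> \<in> Lp p MV"
  and T_add: "\<alpha> \<in> Lp_forms p I MV \<Longrightarrow> \<beta> \<in> Lp_forms p I MV \<Longrightarrow>
    AE x in MV. T (\<lambda>i x. \<alpha> i x + \<beta> i x) x = T \<alpha> x + T \<beta> x"
  and T_mult: "\<alpha> \<in> Lp_forms p I MV \<Longrightarrow> AE x in MV. T (\<lambda>i x. c * \<alpha> i x) x = c * T \<alpha> x"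
  using bounded_linear by (auto simp: bounded_linear_Lp_def linear_into_Lp_def)

lemma Lp_formsD: "\<alpha> \<in> Lp_forms p I M \<Longrightarrow> i \<in> I \<Longrightarrow> \<alpha> i \<in> Lp p M"
  by (simp add: Lp_forms_def)

lemma Lp_formsI: "(\<And>i. i \<in> I \<Longrightarrow> \<alpha> i \<in> Lp p M) \<Longrightarrow> \<alpha> \<in> Lp_forms p I M"
  by (simp add: Lp_forms_def)

lemma form_norm_nonneg: "0 \<le> Lp_form_norm p I M \<alpha>"
  unfolding Lp_form_norm_def by (intro sum_nonneg Lp_norm_nonneg)

lemma T_bound_ex: "\<exists>C. 0 \<le> C \<and> (\<forall>\<alpha>\<in>Lp_forms p I MV. Lp_norm p MV (T \<alpha>) \<le> C * Lp_form_norm p I MV \<alpha>)"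
proof -
  obtain C where C: "\<And>\<alpha>. \<alpha> \<in> Lp_forms p I MV \<Longrightarrow> Lp_norm p MV (T \<alpha>) \<le> C * Lp_form_norm p I MV \<alpha>"
    using bounded_linear by (auto simp: bounded_linear_Lp_def)
  have "Lp_norm p MV (T \<alpha>) \<le> \<bar>C\<bar> * Lp_form_norm p I MV \<alpha>" if "\<alpha> \<in> Lp_forms p I MV" for \<alpha>
    using C[OF that] mult_right_mono[OF abs_ge_self form_norm_nonneg, of C MV \<alpha>] by linarith
  then show ?thesis by (intro exI[of _ "\<bar>C\<bar>"]) auto
qed

definition bound :: real where
  "bound = (SOME C. 0 \<le> C \<and> (\<forall>\<alpha>\<in>Lp_forms p I MV. Lp_norm p MV (T \<alpha>) \<le> C * Lp_form_norm p I MV \<alpha>))"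

lemma bound_nonneg: "0 \<le> bound"
  and T_bound: "\<alpha> \<in> Lp_forms p I MV \<Longrightarrow> Lp_norm p MV (T \<alpha>) \<le> bound * Lp_form_norm p I MV \<alpha>"
  using someI_ex[OF T_bound_ex] by (auto simp: bound_def)

text \<open>Linearity and the norm bound force the operator to send the difference of two a.e. equal
  forms to a function of norm 0.\<close>

lemma T_cong:
  assumes \<alpha>: "\<alpha> \<in> Lp_forms p I MV" and \<beta>: "\<beta> \<in> Lp_forms p I MV"
    and eq: "\<And>i. i \<in> I \<Longrightarrow> AE x in MV. \<alpha> i x = \<beta> i x"
  shows "AE x in MV. T \<alpha> x = T \<beta> x"
proof -
  let ?m = "\<lambda>i x. (-1) * \<beta> i x" and ?d = "\<lambda>i x. \<alpha> i x + (-1) * \<beta> i x"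
  have m: "?m \<in> Lp_forms p I MV" by (intro Lp_formsI Lp_mult p_ge_1 Lp_formsD[OF \<beta>])
  have d: "?d \<in> Lp_forms p I MV" by (intro Lp_formsI Lp_add Lp_mult p_ge_1 Lp_formsD[OF \<alpha>] Lp_formsD[OF \<beta>])
  have "Lp_norm p MV (?d i) = 0" if "i \<in> I" for i
  proof -
    have "AE x in MV. 0 = ?d i x" using eq[OF that] by eventually_elim simp
    from Lp_cong_AE(2)[OF Lp_0[OF p_ge_1] Lp_measurable[OF Lp_formsD[OF d that]] this]
    show ?thesis by (simp add: Lp_norm_0[OF p_ge_1])
  qed
  then have "Lp_form_norm p I MV ?d = 0" by (simp add: Lp_form_norm_def)
  then have "Lp_norm p MV (T ?d) \<le> 0" using T_bound[OF d] by simp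
  from Lp_norm_eq_0_AE[OF p_ge_1 T_Lp[OF d] this] T_add[OF \<alpha> m] T_mult[OF \<beta>, of "-1"]
  show ?thesis by eventually_elim simp
qed

lemma AE_slice_form:
  assumes "g \<in> Lp_forms p I MU"
  shows "AE w in MW. (\<lambda>i y. g i (merge I J (y, w))) \<in> Lp_forms p I MV"
proof -
  have "AE w in MW. (\<lambda>y. g i (merge I J (y, w))) \<in> Lp p MV" if "i \<in> I" for i
  proof -
    have "(\<lambda>q. g i (glue q)) \<in> Lp p (MW \<Otimes>\<^sub>M MV)"
      using Lp_formsD[OF assms that] Lp_glue(1)[OF Lp_measurable] by blast
    from P.AE_Lp_slice[OF p_ge_1 this] show ?thesis by (simp add: glue_Pair)
  qed
  then have "AE w in MW. \<forall>i\<in>I. (\<lambda>y. g i (merge I J (y, w))) \<in> Lp p MV"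
    by (subst AE_ball_countable[OF countable_finite[OF finite(1)]]) blast
  then show ?thesis by (simp add: Lp_forms_def)
qed

lemma pvalue_measurable: "pvalue g u \<Longrightarrow> u \<in> borel_measurable MU"
  by (simp add: pvalue_def)

lemma slice_measurable:
  fixes u :: "'i point \<Rightarrow> complex"
  assumes "u \<in> borel_measurable MU" "w \<in> space MW"
  shows "(\<lambda>x. u (merge I J (x, w))) \<in> borel_measurable MV"
proof -
  have "(\<lambda>q. u (glue q)) \<in> borel_measurable (MW \<Otimes>\<^sub>M MV)" using measurable_compose[OF measurable_glue assms(1)] .
  from measurable_Pair2[OF this assms(2)] show ?thesis by (simp add: glue_Pair)
qed

lemma pvalue_Lp:
  assumes g: "g \<in> Lp_forms p I MU" and u: "pvalue g u"
  shows "u \<in> Lp p MU" "Lp_norm p MU u \<le> bound * real (card I) * real (card I) * (\<Sum>i\<in>I. Lp_norm p MU (g i))"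
proof -
  have um: "u \<in> borel_measurable MU" using u by (rule pvalue_measurable)
  have gm: "g i \<in> borel_measurable MU" if "i \<in> I" for i using Lp_measurable[OF Lp_formsD[OF g that]] .
  have "AE w in MW. AE x in MV. u (merge I J (x, w)) = T (\<lambda>i y. g i (merge I J (y, w))) x"
    using u by (simp add: pvalue_def)
  then have sl: "AE w in MW. (\<lambda>x. u (glue (w, x))) \<in> Lp p MV \<and>
      Lp_norm p MV (\<lambda>x. u (glue (w, x))) \<le> bound * (\<Sum>i\<in>I. Lp_norm p MV (\<lambda>x. g i (glue (w, x))))"
    using AE_slice_form[OF g] AE_space
  proof eventually_elim
    case (elim w)
    have "AE x in MV. T (\<lambda>i y. g i (merge I J (y, w))) x = u (merge I J (x, w))" using elim(1) by eventually_elim simp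
    from Lp_cong_AE[OF T_Lp[OF elim(2)] slice_measurable[OF um elim(3)] this] T_bound[OF elim(2)]
    show ?case by (simp add: glue_Pair Lp_form_norm_def)
  qed
  have "(\<lambda>q. g i (glue q)) \<in> Lp p (MW \<Otimes>\<^sub>M MV)" if "i \<in> I" for i
    using Lp_formsD[OF g that] Lp_glue(1)[OF gm[OF that]] by simp
  note P.Lp_slice_dominated[OF p_ge_1 finite(1) bound_nonneg measurable_compose[OF measurable_glue um] this sl]
  with Lp_glue[OF um, of p] show "u \<in> Lp p MU"
    "Lp_norm p MU u \<le> bound * real (card I) * real (card I) * (\<Sum>i\<in>I. Lp_norm p MU (g i))"
    using Lp_glue(2)[OF gm, of _ p] by simp_all
qed

lemma pvalue_cong:
  assumes g: "g \<in> Lp_forms p I MU" and h: "h \<in> Lp_forms p I MU"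
    and eq: "\<And>i. i \<in> I \<Longrightarrow> AE z in MU. g i z = h i z"
    and u: "pvalue g u"
  shows "pvalue h u"
proof -
  have "AE w in MW. \<forall>i\<in>I. AE x in MV. g i (merge I J (x, w)) = h i (merge I J (x, w))"
    by (subst AE_ball_countable[OF countable_finite[OF finite(1)]]) (intro ballI AE_slice eq)
  moreover have "AE w in MW. AE x in MV. u (merge I J (x, w)) = T (\<lambda>i y. g i (merge I J (y, w))) x"
    using u by (simp add: pvalue_def)
  ultimately have "AE w in MW. AE x in MV. u (merge I J (x, w)) = T (\<lambda>i y. h i (merge I J (y, w))) x"
    using AE_slice_form[OF g] AE_slice_form[OF h]
  proof eventually_elim
    case (elim w)
    have "AE x in MV. T (\<lambda>i y. g i (merge I J (y, w))) x = T (\<lambda>i y. h i (merge I J (y, w))) x"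
      by (rule T_cong[OF elim(3,4)]) (use elim(1) in blast)
    with elim(2) show ?case by eventually_elim simp
  qed
  with u show ?thesis by (simp add: pvalue_def)
qed

lemma pvalue_unique:
  assumes "g \<in> Lp_forms p I MU" "h \<in> Lp_forms p I MU"
    and "\<And>i. i \<in> I \<Longrightarrow> AE z in MU. g i z = h i z"
    and "pvalue g u" and v: "pvalue h v"
  shows "AE z in MU. u z = v z"
proof -
  have u: "pvalue h u" using assms(1-4) by (rule pvalue_cong)
  have "AE w in MW. AE x in MV. u (merge I J (x, w)) = T (\<lambda>i y. h i (merge I J (y, w))) x"
    "AE w in MW. AE x in MV. v (merge I J (x, w)) = T (\<lambda>i y. h i (merge I J (y, w))) x"
    using u v by (simp_all add: pvalue_def)
  then have "AE w in MW. AE x in MV. u (merge I J (x, w)) = v (merge I J (x, w))"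
  proof eventually_elim
    case (elim w)
    then show ?case by eventually_elim simp
  qed
  then show ?thesis by (rule AE_unslice[OF pvalue_measurable[OF u] pvalue_measurable[OF v]])
qed

lemma pvalue_add:
  assumes g: "g \<in> Lp_forms p I MU" and h: "h \<in> Lp_forms p I MU" and u: "pvalue g u" and v: "pvalue h v"
  shows "pvalue (\<lambda>i z. g i z + h i z) (\<lambda>z. u z + v z)"
proof -
  have "AE w in MW. AE x in MV. u (merge I J (x, w)) = T (\<lambda>i y. g i (merge I J (y, w))) x"
    "AE w in MW. AE x in MV. v (merge I J (x, w)) = T (\<lambda>i y. h i (merge I J (y, w))) x"
    using u v by (simp_all add: pvalue_def)
  then have "AE w in MW. AE x in MV. u (merge I J (x, w)) + v (merge I J (x, w)) =
      T (\<lambda>i y. g i (merge I J (y, w)) + h i (merge I J (y, w))) x"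
    using AE_slice_form[OF g] AE_slice_form[OF h]
  proof eventually_elim
    case (elim w)
    show ?case using elim(1,2) T_add[OF elim(3,4)] by eventually_elim simp
  qed
  with u v show ?thesis by (auto simp: pvalue_def)
qed

lemma pvalue_mult:
  assumes g: "g \<in> Lp_forms p I MU" and u: "pvalue g u"
  shows "pvalue (\<lambda>i z. c * g i z) (\<lambda>z. c * u z)"
proof -
  have "AE w in MW. AE x in MV. u (merge I J (x, w)) = T (\<lambda>i y. g i (merge I J (y, w))) x"
    using u by (simp add: pvalue_def)
  then have "AE w in MW. AE x in MV. c * u (merge I J (x, w)) = T (\<lambda>i y. c * g i (merge I J (y, w))) x"
    using AE_slice_form[OF g]
  proof eventually_elim
    case (elim w)
    show ?case using elim(1) T_mult[OF elim(2), of c] by eventually_elim simp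
  qed
  with u show ?thesis by (auto simp: pvalue_def)
qed

text \<open>On almost every slice the form is closed, its image under \<open>T\<close> solves the
  equation, and \<open>u\<close> agrees with that image a.e.; \<open>has_weak_dbar_of_slices\<close>
  then reassembles the slices.\<close>

lemma pvalue_solves:
  assumes g: "g \<in> Lp_forms p I MU" and u: "pvalue g u"
    and closed: "dbar_closed (I \<union> J) U g" and T: "solves_dbar p I V T" and i: "i \<in> I"
  shows "has_weak_dbar (I \<union> J) U [i] u (g i)"
proof -
  interpret U: finite_measure MU by (rule finite_measure_U)
  have gi: "integrable MU (g a)" if "a \<in> I" for a by (rule U.Lp_integrable[OF p_ge_1 Lp_formsD[OF g that]])
  have cl: "AE w in MW. dbar_closed I V (\<lambda>i x. g i (merge I J (x, w)))"
    by (rule dbar_closed_slices[OF _ closed]) (rule gi)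
  have uL: "u \<in> Lp p MU" by (rule pvalue_Lp[OF g u])
  have ui: "integrable MU u" by (rule U.Lp_integrable[OF p_ge_1 uL])
  have "AE w in MW. AE x in MV. u (merge I J (x, w)) = T (\<lambda>i y. g i (merge I J (y, w))) x"
    using u by (simp add: pvalue_def)
  then have "AE w in MW. has_weak_dbar I V [i] (\<lambda>x. u (merge I J (x, w))) (\<lambda>x. g i (merge I J (x, w)))"
    using AE_slice_form[OF g] cl integral_slice(3)[OF ui] integral_slice(3)[OF gi[OF i]]
  proof eventually_elim
    case (elim w)
    have "dbar_equation I V (T (\<lambda>i y. g i (merge I J (y, w)))) (\<lambda>i y. g i (merge I J (y, w)))"
      using T elim(2,3) by (simp add: solves_dbar_def)
    then have h: "has_weak_dbar I V [i] (T (\<lambda>i y. g i (merge I J (y, w)))) (\<lambda>x. g i (merge I J (x, w)))"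
      using i by (simp add: dbar_equation_def)
    have "AE x in cvol I. x \<in> V \<longrightarrow> T (\<lambda>i y. g i (merge I J (y, w))) x = u (merge I J (x, w))"
      using elim(1) unfolding AE_cvol_on[OF finite(1) open_V] by eventually_elim simp
    then show ?case
      by (intro has_weak_dbar_cong[OF finite(1) _ h] integrable_imp_loc_integrable[OF finite(1) open_V] elim) (use i in auto)
  qed
  then show ?thesis by (rule has_weak_dbar_of_slices[OF ui gi[OF i] i])
qed

definition single :: "'i \<Rightarrow> ('i point \<Rightarrow> complex) \<Rightarrow> 'i form01" where
  "single i f = (\<lambda>l x. if l = i then f x else 0)"

lemma single_Lp: "f \<in> Lp p M \<Longrightarrow> single i f \<in> Lp_forms p I M"
proof (rule Lp_formsI)
  fix l assume "f \<in> Lp p M"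
  then show "single i f l \<in> Lp p M" unfolding single_def by (cases "l = i") (simp_all add: Lp_0[OF p_ge_1])
qed

lemma Lp_operator_single:
  assumes i: "i \<in> I"
  shows "Lp_operator p MV (\<lambda>f. T (single i f)) bound"
proof
  show "1 \<le> p" "0 \<le> bound" by (rule p_ge_1 bound_nonneg)+
  fix f assume f: "f \<in> Lp p MV"
  show "T (single i f) \<in> Lp p MV" by (rule T_Lp[OF single_Lp[OF f]])
  have "Lp_form_norm p I MV (single i f) = (\<Sum>l\<in>I. if l = i then Lp_norm p MV f else 0)"
    unfolding Lp_form_norm_def single_def by (intro sum.cong) (auto simp: Lp_norm_0[OF p_ge_1])
  also have "\<dots> = Lp_norm p MV f" using finite(1) i by simp
  finally show "Lp_norm p MV (T (single i f)) \<le> bound * Lp_norm p MV f" using T_bound[OF single_Lp[OF f, of i]] by simp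
  show "AE x in MV. T (single i (\<lambda>x. c * f x)) x = c * T (single i f) x" for c
  proof -
    have "single i (\<lambda>x. c * f x) = (\<lambda>l x. c * single i f l x)" by (simp add: single_def fun_eq_iff)
    then show ?thesis using T_mult[OF single_Lp[OF f, of i], of c] by simp
  qed
  fix g assume g: "g \<in> Lp p MV"
  have "single i (\<lambda>x. f x + g x) = (\<lambda>l x. single i f l x + single i g l x)" by (simp add: single_def fun_eq_iff)
  then show "AE x in MV. T (single i (\<lambda>x. f x + g x)) x = T (single i f) x + T (single i g) x"
    using T_add[OF single_Lp[OF f, of i] single_Lp[OF g, of i]] by simp
qed

lemma T_eq_sum_single:
  assumes \<alpha>: "\<alpha> \<in> Lp_forms p I MV"
  shows "AE x in MV. T \<alpha> x = (\<Sum>i\<in>I. T (single i (\<alpha> i)) x)"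
proof -
  have cut: "(\<lambda>l x. if l \<in> F then \<alpha> l x else 0) \<in> Lp_forms p I MV" for F
  proof (rule Lp_formsI)
    fix l assume "l \<in> I"
    then show "(\<lambda>x. if l \<in> F then \<alpha> l x else 0) \<in> Lp p MV"
      using Lp_formsD[OF \<alpha>] Lp_0[OF p_ge_1] by (cases "l \<in> F") auto
  qed
  have "AE x in MV. T (\<lambda>l x. if l \<in> F then \<alpha> l x else 0) x = (\<Sum>i\<in>F. T (single i (\<alpha> i)) x)"
    if "finite F" "F \<subseteq> I" for F
    using that
  proof (induction F rule: finite_induct)
    case empty
    \<comment> \<open>The form here is zero, which is 0 times \<open>\<alpha>\<close>; homogeneity
      is what yields the value 0.\<close>
    show ?case using T_mult[OF \<alpha>, of 0] by simp
  next
    case (insert i F)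
    have eq: "(\<lambda>l x. if l \<in> insert i F then \<alpha> l x else 0) = (\<lambda>l x. single i (\<alpha> i) l x + (if l \<in> F then \<alpha> l x else 0))"
      using insert(2) by (auto simp: single_def fun_eq_iff)
    have si: "single i (\<alpha> i) \<in> Lp_forms p I MV" using insert.prems by (intro single_Lp Lp_formsD[OF \<alpha>]) auto
    have "AE x in MV. T (\<lambda>l x. if l \<in> F then \<alpha> l x else 0) x = (\<Sum>i\<in>F. T (single i (\<alpha> i)) x)"
      using insert by blast
    with T_add[OF si cut[of F]] show ?case
      unfolding eq by eventually_elim (use insert in simp)
  qed
  from this[OF finite(1)] have "AE x in MV. T (\<lambda>l x. if l \<in> I then \<alpha> l x else 0) x = (\<Sum>i\<in>I. T (single i (\<alpha> i)) x)"
    by simp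
  \<comment> \<open>\<open>\<alpha>\<close> may be nonzero at labels outside \<open>I\<close>, so
    the truncated form is a different argument for \<open>T\<close>.\<close>
  moreover have "AE x in MV. T \<alpha> x = T (\<lambda>l x. if l \<in> I then \<alpha> l x else 0) x"
    by (rule T_cong[OF \<alpha> cut]) simp
  ultimately show ?thesis by eventually_elim simp
qed

lemma measurable_unglue: "(\<lambda>z. (restrict z J, restrict z I)) \<in> measurable MU (MW \<Otimes>\<^sub>M MV)"
proof (rule measurable_Pair)
  show "(\<lambda>z. restrict z J) \<in> measurable MU MW"
    by (intro measurable_restrict_space2 measurable_cvol_on measurable_restrict_subset)
      (auto simp: space_MU restrict_in_W)
  show "(\<lambda>z. restrict z I) \<in> measurable MU MV"
    by (intro measurable_restrict_space2 measurable_cvol_on measurable_restrict_subset)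
      (auto simp: space_MU restrict_in_V)
qed

text \<open>Feeding \<open>T\<close> one coefficient at a time gives scalar operators with
  measurable values; their sum is a value for the form because \<open>T\<close> is additive a.e. on
  almost every slice.\<close>

lemma pvalue_exists:
  assumes p: "p \<noteq> \<infinity>" and g: "g \<in> Lp_forms p I MU"
  shows "\<exists>u. pvalue g u"
proof -
  have "\<exists>v. v \<in> borel_measurable (MW \<Otimes>\<^sub>M MV) \<and>
      (AE w in MW. AE x in MV. v (w, x) = T (single i (\<lambda>x. g i (glue (w, x)))) x)" if i: "i \<in> I" for i
  proof -
    interpret A: Lp_operator p MV "\<lambda>f. T (single i f)" bound by (rule Lp_operator_single[OF i])
    have "(\<lambda>q. g i (glue q)) \<in> Lp p (MW \<Otimes>\<^sub>M MV)"
      using Lp_formsD[OF g i] Lp_glue(1)[OF Lp_measurable] by blast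
    from A.param_value_exists[OF finite_measure_W p this] show ?thesis by (simp add: A.param_value_def)
  qed
  then have "\<forall>i\<in>I. \<exists>v. v \<in> borel_measurable (MW \<Otimes>\<^sub>M MV) \<and>
      (AE w in MW. AE x in MV. v (w, x) = T (single i (\<lambda>x. g i (glue (w, x)))) x)" by blast
  from bchoice[OF this] obtain v where v: "\<And>i. i \<in> I \<Longrightarrow> v i \<in> borel_measurable (MW \<Otimes>\<^sub>M MV)"
    "\<And>i. i \<in> I \<Longrightarrow> AE w in MW. AE x in MV. v i (w, x) = T (single i (\<lambda>x. g i (glue (w, x)))) x" by blast
  define u where "u z = (\<Sum>i\<in>I. v i (restrict z J, restrict z I))" for z
  have "u \<in> borel_measurable MU"
    unfolding u_def by (intro borel_measurable_sum measurable_compose[OF measurable_unglue] v(1))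
  moreover have "AE w in MW. \<forall>i\<in>I. AE x in MV. v i (w, x) = T (single i (\<lambda>x. g i (glue (w, x)))) x"
    using v(2) by (subst AE_ball_countable[OF countable_finite[OF finite(1)]]) blast
  then have "AE w in MW. AE x in MV. u (merge I J (x, w)) = T (\<lambda>i y. g i (merge I J (y, w))) x"
    using AE_slice_form[OF g] AE_space
  proof eventually_elim
    case (elim w)
    then have w: "w \<in> J \<rightarrow>\<^sub>E UNIV" using W_subset by (auto simp: space_MW)
    have "AE x in MV. \<forall>i\<in>I. v i (w, x) = T (single i (\<lambda>x. g i (glue (w, x)))) x"
      using elim(1) by (subst AE_ball_countable[OF countable_finite[OF finite(1)]]) blast
    then show ?case using T_eq_sum_single[OF elim(2)] AE_space
    proof eventually_elim
      case (elim x)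
      then have "x \<in> I \<rightarrow>\<^sub>E UNIV" using V_subset by (auto simp: space_MV)
      from restrict_glue[OF this w] elim show ?case by (simp add: u_def glue_Pair)
    qed
  qed
  ultimately show ?thesis by (auto simp: pvalue_def)
qed

end

section \<open>From two factors to \<open>k\<close> groups of variables\<close>

section \<open>The product domain\<close>

lemma finite_labels: "finite J \<Longrightarrow> finite (labels n J)"
  by (simp add: labels_def)

lemma labels_disjoint: "J \<inter> K = {} \<Longrightarrow> labels n J \<inter> labels n K = {}"
  by (auto simp: labels_def)

lemma labels_mono: "J \<subseteq> K \<Longrightarrow> labels n J \<subseteq> labels n K"
  by (auto simp: labels_def)

lemma openin_prod_domain:
  assumes "finite J" "\<And>j. j \<in> J \<Longrightarrow> openin (ctop (labels n {j})) (D j)"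
  shows "openin (ctop (labels n J)) (prod_domain n D J)"
proof -
  let ?X = "ctop (labels n J)"
  have "openin ?X {z \<in> topspace ?X. \<forall>j\<in>F. restrict z (labels n {j}) \<in> D j}" if "finite F" "F \<subseteq> J" for F
    using that
  proof (induction F rule: finite_induct)
    case empty
    then show ?case using openin_topspace[of ?X] by (simp del: topspace_product_topology)
  next
    case (insert j F)
    have "openin ?X {z \<in> topspace ?X. restrict z (labels n {j}) \<in> D j}"
      by (rule openin_continuous_map_preimage[OF continuous_map_restrict_ctop assms(2)])
        (use insert.prems in \<open>auto intro!: labels_mono\<close>)
    moreover have "openin ?X {z \<in> topspace ?X. \<forall>j\<in>F. restrict z (labels n {j}) \<in> D j}"
      using insert by blast
    moreover have "{z \<in> topspace ?X. \<forall>j\<in>insert j F. restrict z (labels n {j}) \<in> D j} =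
      {z \<in> topspace ?X. restrict z (labels n {j}) \<in> D j} \<inter> {z \<in> topspace ?X. \<forall>j\<in>F. restrict z (labels n {j}) \<in> D j}"
      by blast
    ultimately show ?case by (metis (no_types, lifting) openin_Int)
  qed
  from this[OF assms(1) order_refl] show ?thesis by (simp add: prod_domain_def)
qed

lemma prod_domain_bounded:
  assumes "finite J" "\<And>j. j \<in> J \<Longrightarrow> \<exists>R. \<forall>z\<in>D j. \<forall>i\<in>labels n {j}. norm (z i) \<le> R"
  shows "\<exists>R. \<forall>z\<in>prod_domain n D J. \<forall>i\<in>labels n J. norm (z i) \<le> R"
proof -
  have "\<forall>j\<in>J. \<exists>R. \<forall>z\<in>D j. \<forall>i\<in>labels n {j}. norm (z i) \<le> R" using assms(2) by blast
  from bchoice[OF this] obtain R where R: "\<And>j z i. j \<in> J \<Longrightarrow> z \<in> D j \<Longrightarrow> i \<in> labels n {j} \<Longrightarrow> norm (z i) \<le> R j"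
    by blast
  have "norm (z i) \<le> (\<Sum>j\<in>J. \<bar>R j\<bar>)" if z: "z \<in> prod_domain n D J" and i: "i \<in> labels n J" for z i
  proof -
    have j: "fst i \<in> J" "i \<in> labels n {fst i}" using i by (auto simp: labels_def)
    then have "restrict z (labels n {fst i}) \<in> D (fst i)" using z by (auto simp: prod_domain_def)
    from R[OF j(1) this j(2)] have "norm (z i) \<le> R (fst i)" using j by simp
    also have "\<dots> \<le> \<bar>R (fst i)\<bar>" by simp
    also have "\<dots> \<le> (\<Sum>j\<in>J. \<bar>R j\<bar>)" using assms(1) j(1) by (intro member_le_sum) auto
    finally show ?thesis .
  qed
  then show ?thesis by blast
qed

lemma prod_domain_single:
  assumes "D j \<subseteq> labels n {j} \<rightarrow>\<^sub>E UNIV"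
  shows "prod_domain n D {j} = D j"
proof -
  have "restrict z (labels n {j}) = z" if "z \<in> labels n {j} \<rightarrow>\<^sub>E UNIV" for z :: "label point"
    using that by (simp add: PiE_restrict)
  then show ?thesis using assms by (auto simp: prod_domain_def)
qed

text \<open>A weak derivative selected by \<open>SOME\<close> is only known to be locally
  integrable, yet membership in \<open>Lp\<close> asks for measurability on the whole domain.
  Countably many boxes, on each of which it is integrable, provide it.\<close>

lemma loc_integrable_measurable:
  fixes u :: "'i point \<Rightarrow> complex"
  assumes "finite I" "openin (ctop I) U" "loc_integrable I U u"
  shows "u \<in> borel_measurable (cvol_on I U)"
proof -
  let ?P = "{(\<alpha>, \<beta>). \<alpha> \<in> rational_points I \<and> \<beta> \<in> rational_points I \<and> closed_box I \<alpha> \<beta> \<subseteq> U}"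
  have Um: "U \<in> sets (cvol I)" by (rule openin_measurable[OF assms(1,2)])
  show ?thesis
  proof (rule measurable_piecewise_restrict)
    show "countable ((\<lambda>p. open_box I (fst p) (snd p)) ` ?P)"
      by (intro countable_image countable_box_pairs assms(1))
    show "space (cvol_on I U) \<subseteq> \<Union>((\<lambda>p. open_box I (fst p) (snd p)) ` ?P)"
    proof
      fix z assume "z \<in> space (cvol_on I U)"
      then have "z \<in> U" by (simp add: space_restrict_space)
      then obtain \<alpha> \<beta> where "\<alpha> \<in> rational_points I" "\<beta> \<in> rational_points I"
        "z \<in> open_box I \<alpha> \<beta>" "closed_box I \<alpha> \<beta> \<subseteq> U" by (rule rational_box_in_open[OF assms(1,2)])
      then show "z \<in> \<Union>((\<lambda>p. open_box I (fst p) (snd p)) ` ?P)" by (intro UN_I[of "(\<alpha>, \<beta>)"]) auto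
    qed
    fix \<Omega> assume "\<Omega> \<in> (\<lambda>p. open_box I (fst p) (snd p)) ` ?P"
    then obtain p where p: "closed_box I (fst p) (snd p) \<subseteq> U" "\<Omega> = open_box I (fst p) (snd p)" by auto
    have \<Omega>: "\<Omega> \<in> sets (cvol I)" "\<Omega> \<subseteq> U"
      using p open_box_measurable[OF assms(1), of "fst p" "snd p"] open_box_subset_closed_box[of I "fst p" "snd p"]
      by blast+
    then show "\<Omega> \<inter> space (cvol_on I U) \<in> sets (cvol_on I U)"
      using Um by (auto simp: sets_restrict_space_iff space_restrict_space Int_absorb2)
    have "set_integrable (cvol I) \<Omega> u"
      using assms(3) p compactin_closed_box[of I "fst p" "snd p"] \<Omega>(1) open_box_subset_closed_box
      unfolding loc_integrable_def by (meson set_integrable_subset)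
    then have "u \<in> borel_measurable (restrict_space (cvol I) \<Omega>)"
      using \<Omega>(1) unfolding set_integrable_def
      by (subst borel_measurable_restrict_space_iff) (auto intro: borel_measurable_integrable)
    then show "u \<in> borel_measurable (restrict_space (cvol_on I U) \<Omega>)"
      using \<Omega>(2) by (simp add: restrict_restrict_space Um \<Omega>(1) Int_absorb1)
  qed
qed

locale product_setting =
  fixes k :: nat and n :: "nat \<Rightarrow> nat" and D :: "nat \<Rightarrow> label point set"
    and p :: ennreal and T :: "nat \<Rightarrow> label form01 \<Rightarrow> label point \<Rightarrow> complex"
  assumes domain: "\<And>j. j \<in> {1..k} \<Longrightarrow> bounded_domain (labels n {j}) (D j)"
    and p_ge_1: "1 \<le> p"
    and bounded_linear: "\<And>j. j \<in> {1..k} \<Longrightarrow> bounded_linear_Lp p (labels n {j}) (D j) (T j)"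
    and solves: "\<And>j. j \<in> {1..k} \<Longrightarrow> solves_dbar p (labels n {j}) (D j) (T j)"
    and parametrically: "\<And>j. j \<in> {1..k} \<Longrightarrow> p = \<infinity> \<Longrightarrow> acts_parametrically p k n D j (T j)"
    and commutes: "\<And>j i m. j \<in> {1..k} \<Longrightarrow> i \<in> {1..k} - {j} \<Longrightarrow> m \<in> {1..n i} \<Longrightarrow>
           commutes_with_dbar p k n D j (T j) (i, m)"
begin

abbreviation N :: "label set" where "N \<equiv> labels n {1..k}"
abbreviation \<Omega> :: "label point set" where "\<Omega> \<equiv> prod_domain n D {1..k}"
abbreviation M :: "label point measure" where "M \<equiv> prod_vol n D {1..k}"

lemma finite_N: "finite N" by (simp add: finite_labels)

lemma open_D: "j \<in> {1..k} \<Longrightarrow> openin (ctop (labels n {j})) (D j)"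
  using domain by (simp add: bounded_domain_def)

lemma D_subset: "j \<in> {1..k} \<Longrightarrow> D j \<subseteq> labels n {j} \<rightarrow>\<^sub>E UNIV"
  using openin_subset[OF open_D] by simp

lemma open_\<Omega>: "openin (ctop N) \<Omega>"
  by (rule openin_prod_domain) (auto intro: open_D)

lemma finite_measure_prod_vol:
  assumes "J \<subseteq> {1..k}" shows "finite_measure (prod_vol n D J)"
proof -
  have J: "finite J" using assms finite_subset by blast
  have "\<exists>R. \<forall>z\<in>prod_domain n D J. \<forall>i\<in>labels n J. norm (z i) \<le> R"
    by (rule prod_domain_bounded[OF J]) (use domain assms in \<open>auto simp: bounded_domain_def\<close>)
  then obtain R where "\<And>z i. z \<in> prod_domain n D J \<Longrightarrow> i \<in> labels n J \<Longrightarrow> norm (z i) \<le> R" by blast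
  moreover have "prod_domain n D J \<in> sets (cvol (labels n J))"
    using assms by (intro openin_measurable openin_prod_domain finite_labels J open_D) auto
  ultimately show ?thesis by (intro finite_measure_cvol_on finite_labels J)
qed

lemma labels_split: "j \<in> {1..k} \<Longrightarrow> labels n {j} \<union> labels n ({1..k} - {j}) = N"
  by (auto simp: labels_def)

lemma prod_domain_eq_D: "j \<in> {1..k} \<Longrightarrow> prod_domain n D {j} = D j"
  using prod_domain_single[where n = n and D = D and j = j] D_subset by blast

text \<open>Group \<open>j\<close> plays the part of \<open>I\<close>; all other groups together
  form the parameter.\<close>

lemma form_operator:
  assumes j: "j \<in> {1..k}"
  shows "form_operator (labels n {j}) (labels n ({1..k} - {j})) (D j) (prod_domain n D ({1..k} - {j})) \<Omega> p (T j)"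
proof (intro form_operator.intro product_pair.intro form_operator_axioms.intro)
  show "finite (labels n {j})" "finite (labels n ({1..k} - {j}))" by (simp_all add: finite_labels)
  show "labels n {j} \<inter> labels n ({1..k} - {j}) = {}" by (rule labels_disjoint) auto
  show "openin (ctop (labels n {j})) (D j)" by (rule open_D[OF j])
  show "openin (ctop (labels n ({1..k} - {j}))) (prod_domain n D ({1..k} - {j}))"
    by (rule openin_prod_domain) (auto intro: open_D)
  show "finite_measure (cvol_on (labels n {j}) (D j))"
    using finite_measure_prod_vol[of "{j}"] j by (simp add: prod_domain_eq_D)
  show "finite_measure (prod_vol n D ({1..k} - {j}))" by (rule finite_measure_prod_vol) auto
  show "1 \<le> p" by (rule p_ge_1)
  show "bounded_linear_Lp p (labels n {j}) (D j) (T j)" by (rule bounded_linear[OF j])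
  have "restrict (restrict z (labels n ({1..k} - {j}))) (labels n {i}) = restrict z (labels n {i})"
    if "i \<in> {1..k} - {j}" for z :: "label point" and i
    using labels_mono[of "{i}" "{1..k} - {j}" n] that by (auto simp: fun_eq_iff)
  moreover have "restrict z (labels n ({1..k} - {j})) \<in> labels n ({1..k} - {j}) \<rightarrow>\<^sub>E UNIV" for z :: "label point" by auto
  ultimately show "\<Omega> = {z \<in> labels n {j} \<union> labels n ({1..k} - {j}) \<rightarrow>\<^sub>E UNIV. restrict z (labels n {j}) \<in> D j \<and>
      restrict z (labels n ({1..k} - {j})) \<in> prod_domain n D ({1..k} - {j})}"
    unfolding labels_split[OF j] using j by (auto simp: prod_domain_def)
qed

lemma parametric_value_iff:
  assumes j: "j \<in> {1..k}"
  shows "parametric_value k n D j (T j) g u \<longleftrightarrow>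
    form_operator.pvalue (labels n {j}) (labels n ({1..k} - {j})) (D j) (prod_domain n D ({1..k} - {j})) \<Omega> (T j) g u"
  unfolding parametric_value_def form_operator.pvalue_def[OF form_operator[OF j]] labels_split[OF j] Let_def
    prod_domain_eq_D[OF j] by simp

lemma parametric_value_Lp:
  assumes j: "j \<in> {1..k}" and "g \<in> Lp_forms p (labels n {j}) M" "parametric_value k n D j (T j) g u"
  shows "u \<in> Lp p M"
  using form_operator.pvalue_Lp(1)[OF form_operator[OF j]] assms(2,3)
  unfolding labels_split[OF j] parametric_value_iff[OF j] by blast

lemma parametric_value_bound:
  assumes j: "j \<in> {1..k}"
  shows "\<exists>C\<ge>0. \<forall>g\<in>Lp_forms p (labels n {j}) M. \<forall>u. parametric_value k n D j (T j) g u \<longrightarrow>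
    Lp_norm p M u \<le> C * (\<Sum>i\<in>labels n {j}. Lp_norm p M (g i))"
proof -
  interpret form_operator "labels n {j}" "labels n ({1..k} - {j})" "D j" "prod_domain n D ({1..k} - {j})" \<Omega> p "T j"
    by (rule form_operator[OF j])
  show ?thesis
    using pvalue_Lp(2) bound_nonneg unfolding labels_split[OF j] parametric_value_iff[OF j]
    by (intro exI[of _ "bound * real (card (labels n {j})) * real (card (labels n {j}))"]) auto
qed

lemma parametric_value_unique:
  assumes j: "j \<in> {1..k}" and "g \<in> Lp_forms p (labels n {j}) M" "h \<in> Lp_forms p (labels n {j}) M"
    and "\<And>i. i \<in> labels n {j} \<Longrightarrow> AE z in M. g i z = h i z"
    and "parametric_value k n D j (T j) g u" "parametric_value k n D j (T j) h v"
  shows "AE z in M. u z = v z"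
  using form_operator.pvalue_unique[OF form_operator[OF j], of g h u v] assms(2-)
  unfolding labels_split[OF j] parametric_value_iff[OF j] by blast

lemma parametric_value_add:
  assumes j: "j \<in> {1..k}" and "g \<in> Lp_forms p (labels n {j}) M" "h \<in> Lp_forms p (labels n {j}) M"
    and "parametric_value k n D j (T j) g u" "parametric_value k n D j (T j) h v"
  shows "parametric_value k n D j (T j) (\<lambda>i z. g i z + h i z) (\<lambda>z. u z + v z)"
  using form_operator.pvalue_add[OF form_operator[OF j], of g h u v] assms(2-)
  unfolding labels_split[OF j] parametric_value_iff[OF j] by blast

lemma parametric_value_mult:
  assumes j: "j \<in> {1..k}" and "g \<in> Lp_forms p (labels n {j}) M" and "parametric_value k n D j (T j) g u"
  shows "parametric_value k n D j (T j) (\<lambda>i z. c * g i z) (\<lambda>z. c * u z)"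
  using form_operator.pvalue_mult[OF form_operator[OF j], of g u c] assms(2-)
  unfolding labels_split[OF j] parametric_value_iff[OF j] by blast

text \<open>\<open>T j\<close> sees only the coefficients of group \<open>j\<close>, while
  closedness concerns a form with coefficients in all groups; \<open>h\<close> is a closed form that
  agrees with \<open>g\<close> in group \<open>j\<close>.\<close>

lemma parametric_value_solves:
  assumes j: "j \<in> {1..k}" and g: "g \<in> Lp_forms p (labels n {j}) M" and u: "parametric_value k n D j (T j) g u"
    and h: "dbar_closed N \<Omega> h" "\<And>i. i \<in> labels n {j} \<Longrightarrow> h i = g i" and i: "i \<in> labels n {j}"
  shows "has_weak_dbar N \<Omega> [i] u (g i)"
proof -
  interpret form_operator "labels n {j}" "labels n ({1..k} - {j})" "D j" "prod_domain n D ({1..k} - {j})" \<Omega> p "T j"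
    by (rule form_operator[OF j])
  have h': "h \<in> Lp_forms p (labels n {j}) M" using g h(2) by (simp add: Lp_forms_def)
  have "pvalue h u"
    using pvalue_cong[unfolded labels_split[OF j], OF g h'] h(2) u unfolding parametric_value_iff[OF j] by simp
  from pvalue_solves[unfolded labels_split[OF j], OF h' this h(1) solves[OF j] i] h(2)[OF i] show ?thesis by simp
qed

lemma parametric_value_exists:
  assumes j: "j \<in> {1..k}" and g: "g \<in> Lp_forms p (labels n {j}) M"
  shows "\<exists>u. parametric_value k n D j (T j) g u"
proof (cases "p = \<infinity>")
  case True
  then show ?thesis using parametrically[OF j True] g by (simp add: acts_parametrically_def)
next
  case False
  then show ?thesis
    using form_operator.pvalue_exists[OF form_operator[OF j] False, of g] g
    unfolding labels_split[OF j] parametric_value_iff[OF j] by blast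
qed

definition Tval :: "nat \<Rightarrow> label form01 \<Rightarrow> label point \<Rightarrow> complex" where
  "Tval j g = (SOME u. parametric_value k n D j (T j) g u)"

lemma Tval:
  "j \<in> {1..k} \<Longrightarrow> g \<in> Lp_forms p (labels n {j}) M \<Longrightarrow> parametric_value k n D j (T j) g (Tval j g)"
  unfolding Tval_def by (rule someI_ex[OF parametric_value_exists])

lemma finite_measure_M: "finite_measure M"
  by (rule finite_measure_prod_vol) simp

lemma Lp_loc_integrable: "u \<in> Lp p M \<Longrightarrow> loc_integrable N \<Omega> u"
  by (rule integrable_imp_loc_integrable[OF finite_N open_\<Omega> finite_measure.Lp_integrable[OF finite_measure_M p_ge_1]])

lemma weak_dbar_AE_unique:
  "has_weak_dbar N \<Omega> is u g \<Longrightarrow> has_weak_dbar N \<Omega> is u h \<Longrightarrow> AE z in M. g z = h z"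
  unfolding AE_cvol_on[OF finite_N open_\<Omega>] by (rule has_weak_dbar_unique[OF finite_N open_\<Omega>])

end

section \<open>Solving group after group: bounds, linearity and invariants\<close>

section \<open>The solution operator\<close>

context product_setting begin

text \<open>\<open>stage j f [i\<^sub>1, \<dots>, i\<^sub>r]\<close> is the derivative of the \<open>i\<^sub>1\<close>-coefficient with respect to
  \<open>z\<^sub>i\<^sub>2-bar, \<dots>, z\<^sub>i\<^sub>r-bar\<close> of the closed form that remains of \<open>f\<close> after the groups \<open>1, \<dots>, j\<close> of
  variables have been solved for; \<open>stage j f []\<close> accumulates minus the solution.\<close>

primrec stage :: "nat \<Rightarrow> label form01 \<Rightarrow> label list \<Rightarrow> label point \<Rightarrow> complex" where
  "stage 0 f L = (case L of [] \<Rightarrow> (\<lambda>_. 0) | i # is \<Rightarrow> weak_dbar N \<Omega> is (f i))"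
| "stage (Suc j) f L = (\<lambda>z. stage j f L z - Tval (Suc j) (\<lambda>i. stage j f (i # L)) z)"

text \<open>The lists that stage \<open>j\<close> may still be asked for: at most one label from
  each unsolved group, in the increasing order in which the classes \<open>f\<^sub>I\<close>
  enumerate their members.\<close>

definition relevant :: "nat \<Rightarrow> label list \<Rightarrow> bool" where
  "relevant j L \<longleftrightarrow> sorted_wrt (<) (map fst L) \<and> set L \<subseteq> labels n {Suc j..k}"

lemma relevant_Suc: "relevant (Suc j) L \<Longrightarrow> relevant j L"
  by (auto simp: relevant_def labels_def)

text \<open>The label consumed in step \<open>Suc j\<close> goes to the front, because its group is
  smaller than those still unsolved.\<close>

lemma relevant_Cons: "relevant (Suc j) L \<Longrightarrow> i \<in> labels n {Suc j} \<Longrightarrow> Suc j \<le> k \<Longrightarrow> relevant j (i # L)"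
  by (fastforce simp: relevant_def labels_def)

lemma relevant_appendD: "relevant j (L @ L') \<Longrightarrow> relevant j L"
  by (auto simp: relevant_def sorted_wrt_append)

lemma relevant_snocD: "relevant j (L @ [i]) \<Longrightarrow> i \<in> labels n {Suc j..k}"
  by (auto simp: relevant_def)

lemma relevant_Nil: "relevant j []"
  by (simp add: relevant_def)

lemma relevant_single: "i \<in> labels n {Suc j..k} \<Longrightarrow> relevant j [i]"
  by (simp add: relevant_def)

text \<open>\<open>I\<close> collects the groups of \<open>L\<close>, and \<open>m\<close> reads off
  the second components, which is unambiguous because the groups are distinct. So each nonempty list
  names a member of some class and is covered by the hypothesis on \<open>f\<close>.\<close>

lemma relevant_enumerates_class:
  assumes "relevant 0 L" "L \<noteq> []"
  obtains I m where "I \<in> Pow {1..k} - {{}}" "m \<in> (\<Pi>\<^sub>E i\<in>I. {1..n i})"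
    "lead_label I m = hd L" "deriv_labels I m = tl L"
proof -
  define I where "I = fst ` set L"
  define m where "m = restrict (\<lambda>i. the (map_of L i)) I"
  have s: "sorted (map fst L)" "distinct (map fst L)"
    using assms(1) by (simp_all add: relevant_def strict_sorted_iff)
  have I: "sorted_list_of_set I = map fst L"
    using sorted_list_of_set.idem_if_sorted_distinct[OF s] by (simp add: I_def)
  have m: "m (fst x) = snd x" if "x \<in> set L" for x
    using that map_of_is_SomeI[OF s(2), of "fst x" "snd x"] by (auto simp: m_def I_def)
  have L: "map (\<lambda>i. (i, m i)) (map fst L) = L"
    using m by (simp add: map_idI)
  show thesis
  proof (rule that)
    show "I \<in> Pow {1..k} - {{}}" using assms by (auto simp: I_def relevant_def labels_def)
    show "m \<in> (\<Pi>\<^sub>E i\<in>I. {1..n i})"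
    proof (rule PiE_I)
      fix i assume "i \<in> I"
      then obtain x where "x \<in> set L" "i = fst x" by (auto simp: I_def)
      then show "m i \<in> {1..n i}" using m assms(1) by (auto simp: relevant_def labels_def)
    qed (simp add: m_def)
    have "lead_label I m = hd (map (\<lambda>i. (i, m i)) (map fst L))"
      unfolding lead_label_def I Let_def using assms(2) by (simp add: hd_map)
    then show "lead_label I m = hd L" by (simp only: L)
    have "deriv_labels I m = tl (map (\<lambda>i. (i, m i)) (map fst L))"
      unfolding deriv_labels_def I by (simp only: map_tl)
    then show "deriv_labels I m = tl L" by (simp only: L)
  qed
qed

lemma relevant_subset: "relevant j L \<Longrightarrow> set L \<subseteq> N"
  by (auto simp: relevant_def labels_def)

text \<open>The integrability half of \<open>B_space\<close>; the norm bounds and the linearity of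
  the stages rest on it.\<close>

definition regular :: "label form01 \<Rightarrow> bool" where
  "regular f \<longleftrightarrow> (\<forall>I. I \<subseteq> {1..k} \<and> I \<noteq> {} \<longrightarrow> class_in_Lp p k n D I f)"

definition total_norm :: "label form01 \<Rightarrow> real" where
  "total_norm f = (\<Sum>I\<in>Pow {1..k} - {{}}. class_norm p k n D I f)"

lemma total_norm_nonneg: "0 \<le> total_norm f"
  unfolding total_norm_def class_norm_def by (intro sum_nonneg Lp_norm_nonneg)

text \<open>\<open>weak_dbar\<close> selects some representative; uniqueness of weak derivatives
  transfers membership in \<open>Lp\<close> to it from the function supplied by the class. Its norm
  is literally one of the summands of \<open>class_norm\<close>.\<close>

lemma stage_0:
  assumes f: "regular f" and L: "relevant 0 L" "L \<noteq> []"
  shows "has_weak_dbar N \<Omega> (tl L) (f (hd L)) (stage 0 f L)" "stage 0 f L \<in> Lp p M"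
    "Lp_norm p M (stage 0 f L) \<le> total_norm f"
proof -
  obtain I m where I: "I \<in> Pow {1..k} - {{}}" "m \<in> (\<Pi>\<^sub>E i\<in>I. {1..n i})"
    "lead_label I m = hd L" "deriv_labels I m = tl L" using relevant_enumerates_class[OF L] .
  have st: "stage 0 f L = weak_dbar N \<Omega> (tl L) (f (hd L))" using L(2) by (cases L) auto
  have "class_in_Lp p k n D I f" using f I(1) by (simp add: regular_def)
  then have "\<exists>g\<in>Lp p M. has_weak_dbar N \<Omega> (deriv_labels I m) (f (lead_label I m)) g"
    using I(2) unfolding class_in_Lp_def by blast
  then obtain g where g: "g \<in> Lp p M" "has_weak_dbar N \<Omega> (tl L) (f (hd L)) g"
    unfolding I(3,4) by blast
  show w: "has_weak_dbar N \<Omega> (tl L) (f (hd L)) (stage 0 f L)"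
    unfolding st weak_dbar_def by (rule someI[of _ g]) (rule g(2))
  have "stage 0 f L \<in> borel_measurable M"
    by (rule loc_integrable_measurable[OF finite_N open_\<Omega> has_weak_dbarD(2)[OF w]])
  from Lp_cong_AE(1)[OF g(1) this weak_dbar_AE_unique[OF g(2) w]] show "stage 0 f L \<in> Lp p M" .
  have "Lp_norm p M (stage 0 f L) \<le> class_norm p k n D I f"
    unfolding class_norm_def st
    using member_le_sum[OF I(2), of "\<lambda>m. Lp_norm p M (weak_dbar N \<Omega> (deriv_labels I m) (f (lead_label I m)))"]
      I(1) finite_subset[of I "{1..k}"] by (simp add: I(3,4) Lp_norm_nonneg finite_PiE)
  also have "\<dots> \<le> total_norm f"
    unfolding total_norm_def
    by (rule member_le_sum[OF I(1)]) (auto simp: class_norm_def intro!: sum_nonneg Lp_norm_nonneg)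
  finally show "Lp_norm p M (stage 0 f L) \<le> total_norm f" .
qed

text \<open>One constant serves all \<open>f\<close> and all lists. A step replaces \<open>C\<close>
  by \<open>4 * (C + K * (c * C))\<close>: the subtracted value is bounded by \<open>K\<close> times
  the sum of the norms of \<open>c\<close> coefficients, \<open>c\<close> being the number of labels
  in the group, and the 4 comes from \<open>Lp_diff\<close>.\<close>

lemma stage_bound:
  assumes "j \<le> k"
  shows "\<exists>C\<ge>0. \<forall>f L. regular f \<longrightarrow> relevant j L \<longrightarrow>
    stage j f L \<in> Lp p M \<and> Lp_norm p M (stage j f L) \<le> C * total_norm f"
  using assms
proof (induction j)
  case 0
  have "stage 0 f L \<in> Lp p M \<and> Lp_norm p M (stage 0 f L) \<le> 1 * total_norm f"
    if "regular f" "relevant 0 L" for f L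
    using stage_0[OF that] Lp_0[OF p_ge_1] total_norm_nonneg[of f]
    by (cases "L = []") (simp_all add: Lp_norm_0[OF p_ge_1])
  then show ?case by (intro exI[of _ 1] conjI[OF zero_le_one]) blast
next
  case (Suc j)
  have "j \<le> k" using Suc.prems by simp
  from Suc.IH[OF this] obtain C where C: "0 \<le> C" "\<And>f L. regular f \<Longrightarrow> relevant j L \<Longrightarrow>
    stage j f L \<in> Lp p M \<and> Lp_norm p M (stage j f L) \<le> C * total_norm f" by blast
  have j: "Suc j \<in> {1..k}" using Suc.prems by simp
  obtain K where K: "0 \<le> K" "\<And>g u. g \<in> Lp_forms p (labels n {Suc j}) M \<Longrightarrow>
      parametric_value k n D (Suc j) (T (Suc j)) g u \<Longrightarrow>
      Lp_norm p M u \<le> K * (\<Sum>i\<in>labels n {Suc j}. Lp_norm p M (g i))"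
    using parametric_value_bound[OF j] by blast
  let ?c = "real (card (labels n {Suc j}))"
  have "stage (Suc j) f L \<in> Lp p M \<and>
      Lp_norm p M (stage (Suc j) f L) \<le> (4 * (C + K * (?c * C))) * total_norm f"
    if f: "regular f" and L: "relevant (Suc j) L" for f L
  proof -
    let ?g = "\<lambda>i. stage j f (i # L)" and ?u = "Tval (Suc j) (\<lambda>i. stage j f (i # L))"
    have gi: "?g i \<in> Lp p M \<and> Lp_norm p M (?g i) \<le> C * total_norm f" if "i \<in> labels n {Suc j}" for i
      by (rule C(2)[OF f relevant_Cons[OF L that Suc.prems]])
    then have g: "?g \<in> Lp_forms p (labels n {Suc j}) M" by (simp add: Lp_forms_def)
    note u = Tval[OF j g]
    have uL: "?u \<in> Lp p M" by (rule parametric_value_Lp[OF j g u])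
    note sL = C(2)[OF f relevant_Suc[OF L]]
    have "(\<Sum>i\<in>labels n {Suc j}. Lp_norm p M (?g i)) \<le> ?c * (C * total_norm f)"
      using gi by (intro sum_bounded_above) blast
    then have "Lp_norm p M ?u \<le> K * (?c * (C * total_norm f))"
      using K(2)[OF g u] K(1) by (meson mult_left_mono order_trans)
    with sL Lp_diff(2)[OF p_ge_1 _ uL, of "stage j f L"]
    have "Lp_norm p M (stage (Suc j) f L) \<le> 4 * (C * total_norm f + K * (?c * (C * total_norm f)))" by simp
    with Lp_diff(1)[OF p_ge_1 conjunct1[OF sL] uL] show ?thesis by (simp add: algebra_simps)
  qed
  then show ?case using C(1) K(1) by (intro exI[of _ "4 * (C + K * (?c * C))"]) auto
qed

lemma stage_Lp:
  assumes "j \<le> k" "regular f" "relevant j L"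
  shows "stage j f L \<in> Lp p M"
proof -
  obtain C where "\<And>f L. regular f \<Longrightarrow> relevant j L \<Longrightarrow>
    stage j f L \<in> Lp p M \<and> Lp_norm p M (stage j f L) \<le> C * total_norm f"
    using stage_bound[OF assms(1)] by blast
  from conjunct1[OF this[OF assms(2,3)]] show ?thesis .
qed

lemma stage_form:
  assumes "Suc j \<le> k" "regular f" "relevant (Suc j) L"
  shows "(\<lambda>i. stage j f (i # L)) \<in> Lp_forms p (labels n {Suc j}) M"
    "parametric_value k n D (Suc j) (T (Suc j)) (\<lambda>i. stage j f (i # L)) (Tval (Suc j) (\<lambda>i. stage j f (i # L)))"
proof -
  show g: "(\<lambda>i. stage j f (i # L)) \<in> Lp_forms p (labels n {Suc j}) M"
    using stage_Lp[OF _ assms(2) relevant_Cons[OF assms(3) _ assms(1)]] assms(1) by (simp add: Lp_forms_def)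
  show "parametric_value k n D (Suc j) (T (Suc j)) (\<lambda>i. stage j f (i # L)) (Tval (Suc j) (\<lambda>i. stage j f (i # L)))"
    by (rule Tval[OF _ g]) (use assms in simp)
qed

lemma hd_tl_subset: "relevant 0 L \<Longrightarrow> L \<noteq> [] \<Longrightarrow> set (tl L) \<subseteq> N"
  by (cases L) (auto dest!: relevant_subset)

lemma regular_add:
  assumes "regular f" "regular g" shows "regular (\<lambda>i x. f i x + g i x)"
  unfolding regular_def class_in_Lp_def
proof (intro allI impI ballI)
  fix I m assume I: "I \<subseteq> {1..k} \<and> I \<noteq> {}" and m: "m \<in> (\<Pi>\<^sub>E i\<in>I. {1..n i})"
  have "class_in_Lp p k n D I f" "class_in_Lp p k n D I g" using assms I by (simp_all add: regular_def)
  then obtain a b where "a \<in> Lp p M" "has_weak_dbar N \<Omega> (deriv_labels I m) (f (lead_label I m)) a"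
    "b \<in> Lp p M" "has_weak_dbar N \<Omega> (deriv_labels I m) (g (lead_label I m)) b"
    using m unfolding class_in_Lp_def by blast
  moreover have "set (deriv_labels I m) \<subseteq> N"
  proof -
    have "finite I" using I finite_subset by blast
    moreover have "set (tl (sorted_list_of_set I)) \<subseteq> set (sorted_list_of_set I)"
      by (cases "sorted_list_of_set I") auto
    ultimately have "set (tl (sorted_list_of_set I)) \<subseteq> I" by simp
    then show ?thesis using I m by (auto simp: deriv_labels_def labels_def PiE_iff)
  qed
  ultimately show "\<exists>h\<in>Lp p M. has_weak_dbar N \<Omega> (deriv_labels I m) (\<lambda>x. f (lead_label I m) x + g (lead_label I m) x) h"
    by (intro bexI[of _ "\<lambda>x. a x + b x"] has_weak_dbar_add finite_N Lp_add p_ge_1)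
qed

lemma regular_mult:
  assumes "regular f" shows "regular (\<lambda>i x. c * f i x)"
  unfolding regular_def class_in_Lp_def
proof (intro allI impI ballI)
  fix I m assume I: "I \<subseteq> {1..k} \<and> I \<noteq> {}" and m: "m \<in> (\<Pi>\<^sub>E i\<in>I. {1..n i})"
  have "class_in_Lp p k n D I f" using assms I by (simp add: regular_def)
  then obtain a where "a \<in> Lp p M" "has_weak_dbar N \<Omega> (deriv_labels I m) (f (lead_label I m)) a"
    using m unfolding class_in_Lp_def by blast
  then show "\<exists>h\<in>Lp p M. has_weak_dbar N \<Omega> (deriv_labels I m) (\<lambda>x. c * f (lead_label I m) x) h"
    by (intro bexI[of _ "\<lambda>x. c * a x"] has_weak_dbar_mult Lp_mult p_ge_1)
qed

text \<open>\<open>weak_dbar\<close> and \<open>Tval\<close> are arbitrary choices, so additivity is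
  recovered from the a.e. uniqueness of weak derivatives at the start and of parameterwise values at
  each step.\<close>

lemma stage_add:
  assumes f: "regular f" and g: "regular g" and "j \<le> k" "relevant j L"
  shows "AE z in M. stage j (\<lambda>i x. f i x + g i x) L z = stage j f L z + stage j g L z"
  using assms(3,4)
proof (induction j arbitrary: L)
  case 0
  note h = regular_add[OF f g]
  show ?case
  proof (cases "L = []")
    case False
    have "has_weak_dbar N \<Omega> (tl L) (\<lambda>x. f (hd L) x + g (hd L) x) (\<lambda>z. stage 0 f L z + stage 0 g L z)"
      by (intro has_weak_dbar_add finite_N hd_tl_subset stage_0(1) f g 0 False)
    from weak_dbar_AE_unique[OF stage_0(1)[OF h 0(2) False] this] show ?thesis .
  qed simp
next
  case (Suc j)
  have j: "Suc j \<in> {1..k}" using Suc.prems by simp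
  let ?h = "\<lambda>i x. f i x + g i x"
  note h = regular_add[OF f g]
  note F = stage_form[OF Suc.prems(1) f Suc.prems(2)] and G = stage_form[OF Suc.prems(1) g Suc.prems(2)]
    and H = stage_form[OF Suc.prems(1) h Suc.prems(2)]
  have S: "(\<lambda>i z. stage j f (i # L) z + stage j g (i # L) z) \<in> Lp_forms p (labels n {Suc j}) M"
    using F(1) G(1) by (auto simp: Lp_forms_def intro: Lp_add p_ge_1)
  have "AE z in M. Tval (Suc j) (\<lambda>i. stage j ?h (i # L)) z =
      Tval (Suc j) (\<lambda>i. stage j f (i # L)) z + Tval (Suc j) (\<lambda>i. stage j g (i # L)) z"
  proof (rule parametric_value_unique[OF j H(1) S _ H(2) parametric_value_add[OF j F(1) G(1) F(2) G(2)]])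
    fix i assume "i \<in> labels n {Suc j}"
    from Suc.IH[OF _ relevant_Cons[OF Suc.prems(2) this Suc.prems(1)]] Suc.prems(1)
    show "AE z in M. stage j ?h (i # L) z = stage j f (i # L) z + stage j g (i # L) z" by simp
  qed
  moreover have "AE z in M. stage j ?h L z = stage j f L z + stage j g L z"
    using Suc.IH[OF _ relevant_Suc[OF Suc.prems(2)]] Suc.prems(1) by simp
  ultimately show ?case by eventually_elim simp
qed

lemma stage_mult:
  assumes f: "regular f" and "j \<le> k" "relevant j L"
  shows "AE z in M. stage j (\<lambda>i x. c * f i x) L z = c * stage j f L z"
  using assms(2,3)
proof (induction j arbitrary: L)
  case 0
  note h = regular_mult[OF f, of c]
  show ?case
  proof (cases "L = []")
    case False
    have "has_weak_dbar N \<Omega> (tl L) (\<lambda>x. c * f (hd L) x) (\<lambda>z. c * stage 0 f L z)"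
      by (intro has_weak_dbar_mult stage_0(1) f 0 False)
    from weak_dbar_AE_unique[OF stage_0(1)[OF h 0(2) False] this] show ?thesis .
  qed simp
next
  case (Suc j)
  have j: "Suc j \<in> {1..k}" using Suc.prems by simp
  let ?h = "\<lambda>i x. c * f i x"
  note h = regular_mult[OF f, of c]
  note F = stage_form[OF Suc.prems(1) f Suc.prems(2)] and H = stage_form[OF Suc.prems(1) h Suc.prems(2)]
  have S: "(\<lambda>i z. c * stage j f (i # L) z) \<in> Lp_forms p (labels n {Suc j}) M"
    using F(1) by (auto simp: Lp_forms_def intro: Lp_mult p_ge_1)
  have "AE z in M. Tval (Suc j) (\<lambda>i. stage j ?h (i # L)) z = c * Tval (Suc j) (\<lambda>i. stage j f (i # L)) z"
  proof (rule parametric_value_unique[OF j H(1) S _ H(2) parametric_value_mult[OF j F]])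
    fix i assume "i \<in> labels n {Suc j}"
    from Suc.IH[OF _ relevant_Cons[OF Suc.prems(2) this Suc.prems(1)]] Suc.prems(1)
    show "AE z in M. stage j ?h (i # L) z = c * stage j f (i # L) z" by simp
  qed
  moreover have "AE z in M. stage j ?h L z = c * stage j f L z"
    using Suc.IH[OF _ relevant_Suc[OF Suc.prems(2)]] Suc.prems(1) by simp
  ultimately show ?case by eventually_elim (simp add: right_diff_distrib)
qed

text \<open>Coefficients in solved groups are set to 0 outright, since the lists considered at stage
  \<open>j\<close> contain labels of unsolved groups only.\<close>

definition remainder :: "nat \<Rightarrow> label form01 \<Rightarrow> label form01" where
  "remainder j f i = (if fst i \<le> j then (\<lambda>_. 0) else stage j f [i])"

text \<open>Even the derivative along the empty list passes through \<open>SOME\<close>, so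
  \<open>stage 0 f [i]\<close> is merely a representative of \<open>f i\<close>.\<close>

lemma stage_0_AE:
  assumes "regular f" "i \<in> N" "loc_integrable N \<Omega> (f i)"
  shows "AE z in M. f i z = stage 0 f [i] z"
proof -
  have i: "relevant 0 [i]" using assms(2) by (intro relevant_single) simp
  have "has_weak_dbar N \<Omega> [] (f i) (f i)" using assms(3) by (simp add: has_weak_dbar_def)
  from weak_dbar_AE_unique[OF this] stage_0(1)[OF assms(1) i] show ?thesis by simp
qed

lemma stage_commutes:
  assumes "Suc j \<le> k" "i \<in> labels n {Suc (Suc j)..k} \<union> labels n {1..j}"
    and "g \<in> Lp_forms p (labels n {Suc j}) M" "h \<in> Lp_forms p (labels n {Suc j}) M"
    and "\<And>l. l \<in> labels n {Suc j} \<Longrightarrow> has_weak_dbar N \<Omega> [i] (g l) (h l)"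
    and "parametric_value k n D (Suc j) (T (Suc j)) g u" "parametric_value k n D (Suc j) (T (Suc j)) h v"
  shows "has_weak_dbar N \<Omega> [i] u v"
proof -
  have "commutes_with_dbar p k n D (Suc j) (T (Suc j)) (fst i, snd i)"
    using assms(1,2) by (intro commutes) (auto simp: labels_def)
  then have c: "commutes_with_dbar p k n D (Suc j) (T (Suc j)) i" by simp
  show ?thesis
    by (rule c[unfolded commutes_with_dbar_def, rule_format, OF assms(3,4)]) (use assms(5-7) in blast)
qed

text \<open>The three statements must travel together. The first gives, through commutation, the
  derivatives in later groups. Closedness is what \<open>T (Suc j)\<close> requires, and it also
  kills the derivatives in solved groups. The third telescopes: the accumulated function has as
  \<open>dbar\<close> the remainder minus the representatives of \<open>f\<close>.\<close>

lemma stage_invariants: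
  assumes f: "f \<in> B_space p k n D" and "j \<le> k"
  shows "(\<forall>L i. L \<noteq> [] \<longrightarrow> relevant j (L @ [i]) \<longrightarrow> has_weak_dbar N \<Omega> [i] (stage j f L) (stage j f (L @ [i]))) \<and>
    dbar_closed N \<Omega> (remainder j f) \<and>
    (\<forall>i\<in>N. has_weak_dbar N \<Omega> [i] (stage j f []) (\<lambda>z. remainder j f i z - stage 0 f [i] z))"
  using assms(2)
proof (induction j)
  case 0
  have reg: "regular f" and closed: "dbar_closed N \<Omega> f" using f by (auto simp: B_space_def regular_def)
  have rem: "remainder 0 f i = stage 0 f [i]" if "i \<in> N" for i
    using that by (auto simp: remainder_def labels_def)
  have lp: "stage 0 f [i] \<in> Lp p M" if "i \<in> N" for i
    using that by (intro stage_Lp reg relevant_single) auto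
  have "has_weak_dbar N \<Omega> [i] (stage 0 f L) (stage 0 f (L @ [i]))" if L: "L \<noteq> []" "relevant 0 (L @ [i])" for L i
  proof (rule has_weak_dbar_append)
    show "i \<in> N" using relevant_snocD[OF L(2)] by simp
    show "has_weak_dbar N \<Omega> (tl L) (f (hd L)) (stage 0 f L)"
      by (rule stage_0(1)[OF reg relevant_appendD[OF L(2)] L(1)])
    show "has_weak_dbar N \<Omega> (tl L @ [i]) (f (hd L)) (stage 0 f (L @ [i]))"
      using stage_0(1)[OF reg L(2)] L(1) by simp
  qed
  moreover have "dbar_closed N \<Omega> (remainder 0 f)"
  proof (rule dbar_closed_cong[OF finite_N closed])
    fix i assume i: "i \<in> N"
    show "loc_integrable N \<Omega> (remainder 0 f i)" unfolding rem[OF i] by (rule Lp_loc_integrable[OF lp[OF i]])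
    have "loc_integrable N \<Omega> (f i)" using closed i by (simp add: dbar_closed_def)
    from stage_0_AE[OF reg i this] show "AE z in cvol N. z \<in> \<Omega> \<longrightarrow> f i z = remainder 0 f i z"
      unfolding rem[OF i] AE_cvol_on[OF finite_N open_\<Omega>] .
  qed
  moreover have "has_weak_dbar N \<Omega> [i] (stage 0 f []) (\<lambda>z. remainder 0 f i z - stage 0 f [i] z)" if "i \<in> N" for i
    unfolding rem[OF that] using has_weak_dbar_0 by simp
  ultimately show ?case by blast
next
  case (Suc j)
  have reg: "regular f" using f by (auto simp: B_space_def regular_def)
  have j: "Suc j \<in> {1..k}" and jk: "j \<le> k" using Suc.prems by auto
  have IH1: "\<And>L i. L \<noteq> [] \<Longrightarrow> relevant j (L @ [i]) \<Longrightarrow> has_weak_dbar N \<Omega> [i] (stage j f L) (stage j f (L @ [i]))"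
    and IH2: "dbar_closed N \<Omega> (remainder j f)"
    and IH3: "\<And>i. i \<in> N \<Longrightarrow> has_weak_dbar N \<Omega> [i] (stage j f []) (\<lambda>z. remainder j f i z - stage 0 f [i] z)"
    using Suc.IH[OF jk] by blast+
  let ?u = "\<lambda>L. Tval (Suc j) (\<lambda>l. stage j f (l # L))"
  note form = stage_form[OF Suc.prems reg]
  have setN: "set [i] \<subseteq> N" if "i \<in> N" for i using that by simp
  have gt: "has_weak_dbar N \<Omega> [i] (?u L) (?u (L @ [i]))" if L: "relevant (Suc j) (L @ [i])" for L i
  proof (rule stage_commutes[OF Suc.prems _ form(1)[OF relevant_appendD[OF L]] form(1)[OF L] _
        form(2)[OF relevant_appendD[OF L]] form(2)[OF L]])
    show "i \<in> labels n {Suc (Suc j)..k} \<union> labels n {1..j}" using relevant_snocD[OF L] by simp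
    show "has_weak_dbar N \<Omega> [i] (stage j f (l # L)) (stage j f (l # L @ [i]))" if "l \<in> labels n {Suc j}" for l
      using IH1[of "l # L" i] relevant_Cons[OF L that Suc.prems] by simp
  qed
  have 1: "has_weak_dbar N \<Omega> [i] (stage (Suc j) f L) (stage (Suc j) f (L @ [i]))"
    if L: "L \<noteq> []" "relevant (Suc j) (L @ [i])" for L i
  proof -
    have "i \<in> N" using relevant_snocD[OF L(2)] by (auto simp: labels_def)
    from has_weak_dbar_diff[OF finite_N setN[OF this] IH1[OF L(1) relevant_Suc[OF L(2)]] gt[OF L(2)]]
    show ?thesis by simp
  qed
  \<comment> \<open>The derivatives that the newly found function is going to have: 0 in solved
    groups, the given coefficients in group \<open>Suc j\<close>, and in later groups the operator
    applied to one more derivative.\<close>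
  define a where "a i = (if fst i \<le> j then (\<lambda>_. 0) else if fst i = Suc j then stage j f [i] else ?u [i])" for i
  have rem: "remainder j f l = stage j f [l]" if "l \<in> labels n {Suc j}" for l
    using that by (auto simp: remainder_def labels_def)
  have a: "has_weak_dbar N \<Omega> [i] (?u []) (a i)" if i: "i \<in> N" for i
  proof -
    have "fst i \<le> j \<or> fst i = Suc j \<or> Suc (Suc j) \<le> fst i" by arith
    then consider "i \<in> labels n {1..j}" | "i \<in> labels n {Suc j}" | "i \<in> labels n {Suc (Suc j)..k}"
      using i by (auto simp: labels_def)
    then show ?thesis
    proof cases
      case 1
      \<comment> \<open>Closedness together with a vanishing \<open>i\<close>-coefficient says that
        the \<open>l\<close>-coefficients have zero derivative in \<open>i\<close>. Commutation then
        compares with the value on the zero form, and that this is 0 comes from multiplication by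
        0.\<close>
      have "has_weak_dbar N \<Omega> [i] (?u []) (\<lambda>_. 0)"
      proof (rule stage_commutes[OF Suc.prems _ form(1)[OF relevant_Nil] _ _ form(2)[OF relevant_Nil]])
        show "i \<in> labels n {Suc (Suc j)..k} \<union> labels n {1..j}" using 1 by simp
        show "(\<lambda>_ _. 0) \<in> Lp_forms p (labels n {Suc j}) M" by (simp add: Lp_forms_def Lp_0[OF p_ge_1])
        show "parametric_value k n D (Suc j) (T (Suc j)) (\<lambda>_ _. 0) (\<lambda>_. 0)"
          using parametric_value_mult[OF j form[OF relevant_Nil], of 0] by simp
        fix l assume l: "l \<in> labels n {Suc j}"
        then have lN: "l \<in> N" using j by (auto simp: labels_def)
        have ri: "remainder j f i = (\<lambda>_. 0)" using 1 by (auto simp: remainder_def labels_def)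
        show "has_weak_dbar N \<Omega> [i] (stage j f [l]) (\<lambda>_. 0)"
          using IH2 i lN unfolding has_weak_dbar_def dbar_closed_def rem[OF l, symmetric]
          by (simp add: ri loc_integrable_0)
      qed
      with 1 show ?thesis by (auto simp: a_def labels_def)
    next
      case 2
      have "has_weak_dbar N \<Omega> [i] (?u []) (stage j f [i])"
        by (rule parametric_value_solves[OF j form[OF relevant_Nil] IH2 _ 2]) (rule rem)
      with 2 show ?thesis by (auto simp: a_def labels_def)
    next
      case 3
      from gt[of "[]" i] relevant_single[OF 3] 3 show ?thesis by (auto simp: a_def labels_def)
    qed
  qed
  \<comment> \<open>Group \<open>Suc j\<close> cancels exactly by the choice of \<open>a\<close>; in
    later groups this is the recursion of \<open>stage\<close>, and in solved groups it reads 0 = 0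
    - 0.\<close>
  have rem_Suc: "remainder (Suc j) f i z = remainder j f i z - a i z" for i z
    by (auto simp: remainder_def a_def)
  have "dbar_equation N \<Omega> (?u []) a" unfolding dbar_equation_def using a by blast
  then have "dbar_closed N \<Omega> a"
    using finite_N openin_subset[OF open_\<Omega>] by (intro dbar_equation_imp_closed) simp_all
  from dbar_closed_diff[OF finite_N IH2 this] have 2: "dbar_closed N \<Omega> (remainder (Suc j) f)"
    by (simp add: rem_Suc[symmetric])
  have 3: "has_weak_dbar N \<Omega> [i] (stage (Suc j) f []) (\<lambda>z. remainder (Suc j) f i z - stage 0 f [i] z)"
    if i: "i \<in> N" for i
  proof -
    have "(\<lambda>z. remainder (Suc j) f i z - stage 0 f [i] z) = (\<lambda>z. (remainder j f i z - stage 0 f [i] z) - a i z)"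
      by (simp add: rem_Suc fun_eq_iff)
    with has_weak_dbar_diff[OF finite_N setN[OF i] IH3[OF i] a[OF i]] show ?thesis by simp
  qed
  show ?case using 1 2 3 by blast
qed

definition solution :: "label form01 \<Rightarrow> label point \<Rightarrow> complex" where
  "solution f z = (-1) * stage k f [] z"

lemma solution_solves:
  assumes f: "f \<in> B_space p k n D"
  shows "dbar_equation N \<Omega> (solution f) f"
  unfolding dbar_equation_def
proof
  fix i assume i: "i \<in> N"
  have reg: "regular f" and closed: "dbar_closed N \<Omega> f" using f by (auto simp: B_space_def regular_def)
  \<comment> \<open>No unsolved group is left, so by the third invariant \<open>stage k f []\<close>
    solves the equation for minus the representatives of \<open>f\<close>.\<close>
  have "remainder k f i = (\<lambda>_. 0)" using i by (auto simp: remainder_def labels_def)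
  with stage_invariants[OF f order_refl] i
  have "has_weak_dbar N \<Omega> [i] (stage k f []) (\<lambda>z. - stage 0 f [i] z)" by auto
  from has_weak_dbar_mult[OF this, of "-1"]
  have s: "has_weak_dbar N \<Omega> [i] (solution f) (stage 0 f [i])" by (simp add: solution_def[abs_def])
  have fi: "loc_integrable N \<Omega> (f i)" using closed i by (simp add: dbar_closed_def)
  show "has_weak_dbar N \<Omega> [i] (solution f) (f i)"
  proof (rule has_weak_dbar_cong[OF finite_N _ s has_weak_dbarD(1)[OF s] fi])
    show "AE z in cvol N. z \<in> \<Omega> \<longrightarrow> stage 0 f [i] z = f i z"
      using stage_0_AE[OF reg i fi] unfolding AE_cvol_on[OF finite_N open_\<Omega>] by eventually_elim auto
  qed (use i in auto)
qed

lemma B_space_regular: "f \<in> B_space p k n D \<Longrightarrow> regular f"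
  by (auto simp: B_space_def regular_def)

lemma solution_linear: "linear_into_Lp p M (B_space p k n D) solution"
  unfolding linear_into_Lp_def
proof (intro conjI ballI allI)
  fix f assume f: "f \<in> B_space p k n D"
  show "solution f \<in> Lp p M"
    unfolding solution_def[abs_def]
    by (intro Lp_mult p_ge_1 stage_Lp B_space_regular[OF f] relevant_Nil order_refl)
  show "AE z in M. solution (\<lambda>i x. c * f i x) z = c * solution f z" for c
    using stage_mult[OF B_space_regular[OF f] order_refl relevant_Nil, of c]
    by eventually_elim (simp add: solution_def)
  fix g assume g: "g \<in> B_space p k n D"
  show "AE z in M. solution (\<lambda>i x. f i x + g i x) z = solution f z + solution g z"
    using stage_add[OF B_space_regular[OF f] B_space_regular[OF g] order_refl relevant_Nil]
    by eventually_elim (simp add: solution_def)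
qed

lemma solution_bound:
  "\<exists>C>0. \<forall>f\<in>B_space p k n D. Lp_norm p M (solution f) \<le> C * (\<Sum>I\<in>Pow {1..k} - {{}}. class_norm p k n D I f)"
proof -
  obtain C where C: "0 \<le> C" "\<And>f L. regular f \<Longrightarrow> relevant k L \<Longrightarrow>
    stage k f L \<in> Lp p M \<and> Lp_norm p M (stage k f L) \<le> C * total_norm f"
    using stage_bound[OF order_refl] by blast
  \<comment> \<open>\<open>C\<close> may be 0, whereas a positive constant is wanted; hence
    \<open>C + 1\<close>.\<close>
  have "Lp_norm p M (solution f) \<le> (C + 1) * total_norm f" if f: "f \<in> B_space p k n D" for f
  proof -
    note s = C(2)[OF B_space_regular[OF f] relevant_Nil]
    have "Lp_norm p M (solution f) \<le> norm (-1 :: complex) * Lp_norm p M (stage k f [])"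
      unfolding solution_def[abs_def] by (rule Lp_mult(2)[OF p_ge_1 conjunct1[OF s]])
    also have "\<dots> \<le> C * total_norm f" using s by simp
    also have "\<dots> \<le> (C + 1) * total_norm f" using total_norm_nonneg[of f] by (simp add: distrib_right)
    finally show ?thesis .
  qed
  then show ?thesis using C(1) unfolding total_norm_def by (intro exI[of _ "C + 1"]) auto
qed

end

theorem theorem0p5:
  fixes k :: nat and n :: "nat \<Rightarrow> nat" and D :: "nat \<Rightarrow> label point set"
    and p :: ennreal and T :: "nat \<Rightarrow> label form01 \<Rightarrow> label point \<Rightarrow> complex"
  assumes "1 \<le> k" and "\<And>j. j \<in> {1..k} \<Longrightarrow> 1 \<le> n j"
    and "\<And>j. j \<in> {1..k} \<Longrightarrow> bounded_domain (labels n {j}) (D j)"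
    and "1 \<le> p"
    and "\<And>j. j \<in> {1..k} \<Longrightarrow> bounded_linear_Lp p (labels n {j}) (D j) (T j)"
    and "\<And>j. j \<in> {1..k} \<Longrightarrow> solves_dbar p (labels n {j}) (D j) (T j)"
    and "\<And>j. j \<in> {1..k} \<Longrightarrow> p = \<infinity> \<Longrightarrow> acts_parametrically p k n D j (T j)"
    and "\<And>j i m. j \<in> {1..k} \<Longrightarrow> i \<in> {1..k} - {j} \<Longrightarrow> m \<in> {1..n i} \<Longrightarrow>
           commutes_with_dbar p k n D j (T j) (i, m)"
  shows "\<exists>S. linear_into_Lp p (prod_vol n D {1..k}) (B_space p k n D) S \<and>
           (\<forall>f\<in>B_space p k n D.
              dbar_equation (labels n {1..k}) (prod_domain n D {1..k}) (S f) f) \<and>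
           (\<exists>C>0. \<forall>f\<in>B_space p k n D.
              Lp_norm p (prod_vol n D {1..k}) (S f) \<le>
                C * (\<Sum>I\<in>Pow {1..k} - {{}}. class_norm p k n D I f))"
proof -
  interpret product_setting k n D p T
    by (rule product_setting.intro) (fact assms(3-8))+
  show ?thesis using solution_linear solution_solves solution_bound by blast
qed

end
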